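(* Let $f:\mathcal{X}\times\mathcal{Y}\to\mathcal{Z}$ be a function (with $\mathcal{X},\mathcal{Y}$ finite), let $n,t\ge 1$ be integers and $\delta>0$ real. Suppose the communication game $f^{(n),A}$ has a $[t;c;l_1,\ldots,l_t]^A$ safe public coin quantum protocol with error less than $\delta$. Then there is a $[t-1;c+l_1;l_2,\ldots,l_t]^B$ safe public coin quantum protocol for $f$ with error less than $$\epsilon := \delta+\frac12\left(\frac{8 l_1\ln 2}{n}\right)^{1/2}.$$
   Context: For a communication problem $f:\mathcal{X}\times\mathcal{Y}\to\mathcal{Z}$, Alice is given $x\in\mathcal{X}$, Bob is given $y\in\mathcal{Y}$, and they must compute $f(x,y)$. In the game $f^{(n),A}$, Alice is given $x_1,\ldots,x_n\in\mathcal{X}$, and Bob is given $y\in\mathcal{Y}$, an index $i\in\{1,\ldots,n\}$ and copies of $x_1,\ldots,x_{i-1}$; they must compute $f(x_i,y)$. Coinless quantum protocols (Yao's interacting unitary circuits model, without prior entanglement): Alice's and Bob's inputs are in computational basis states and their work qubits are initialised to zero. They alternately apply unitary transformations (depending on their own input) to the qubits in their possession and send some of these qubits to the other player. The number and lengths of the messages are fixed and independent of the inputs. The global state of all qubits is pure at all times when the inputs are computational basis states; no measurements are made during the protocol. At the end the last recipient of a message measures certain answer qubits (chosen independently of the inputs) in the computational basis to determine the answer. In a zero-round protocol with superscript $A$ (respectively $B$), Alice (respectively Bob) determines the answer with no communication. A protocol is secure if the input qubits are never sent as messages, their state is unchanged throughout, and they are never measured (the players work with copies of the inputs). A $[t;c;l_1,\ldots,l_t]^A$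 (respectively $[t;c;l_1,\ldots,l_t]^B$) safe coinless quantum protocol is a secure coinless quantum protocol in which Alice (respectively Bob) starts, there are $t$ rounds (messages), the first message is $l_1+c$ qubits long and the $i$th message is $l_i$ qubits long for $i\geq 2$. The first message consists of a main part of $l_1$ qubits and a safe overhead of $c$ qubits, and the density matrix of the safe overhead is independent of the inputs to Alice and Bob. A safe public coin quantum protocol of a given type is a probability distribution over finitely many safe coinless quantum protocols of that type (equivalently, the players share a state $\sum_r\sqrt{p_r}|r\rangle_A|r\rangle_B$ with $p_r\ge 0$, $\sum_r p_r=1$, copied at the start by CNOT gates; it is never altered, sent or measured, and for coin value $r$ the $r$th coinless protocol is run). The error of a protocol is the maximum over all inputs of the probability of an incorrect answer. *)

theory Defs
  imports "HOL-Probability.Probability_Mass_Function"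
begin

section \<open>Qubit registers\<close>

text \<open>
  Qubits are named by natural numbers.  A computational basis state of a finite set of qubits
  \<open>Q\<close> is written as the set \<open>u \<subseteq> Q\<close> of those qubits that carry the value 1, so that a state
  vector is a function \<open>nat set \<Rightarrow> complex\<close>, of which only the values on \<open>Pow Q\<close> matter, and an
  operator on \<open>Q\<close> is given by its matrix \<open>nat set \<Rightarrow> nat set \<Rightarrow> complex\<close> in that basis.  Subsets,
  rather than numbers below \<open>2 ^ card Q\<close>, make tensor factors easy to address: for disjoint
  \<open>S\<close> and \<open>R\<close>, the basis state \<open>|s\<rangle> \<otimes> |r\<rangle>\<close> of \<open>S \<union> R\<close> is just \<open>s \<union> r\<close>.
\<close>

type_synonym qstate = "nat set \<Rightarrow> complex"
type_synonym qmatrix = "nat set \<Rightarrow> nat set \<Rightarrow> complex"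

definition basis_state :: "nat set \<Rightarrow> qstate" where
  "basis_state u = (\<lambda>v. if v = u then 1 else 0)"

definition unitary_on :: "nat set \<Rightarrow> qmatrix \<Rightarrow> bool" where
  "unitary_on S U \<longleftrightarrow>
     (\<forall>u\<in>Pow S. \<forall>v\<in>Pow S. (\<Sum>s\<in>Pow S. U u s * cnj (U v s)) = (if u = v then 1 else 0)) \<and>
     (\<forall>u\<in>Pow S. \<forall>v\<in>Pow S. (\<Sum>s\<in>Pow S. cnj (U s u) * U s v) = (if u = v then 1 else 0))"

text \<open>\<open>U\<close> acting on the qubits \<open>S\<close>, tensored with the identity on all other qubits.\<close>

definition apply_on :: "nat set \<Rightarrow> qmatrix \<Rightarrow> qstate \<Rightarrow> qstate" where
  "apply_on S U \<psi> = (\<lambda>u. \<Sum>s\<in>Pow S. U (u \<inter> S) s * \<psi> (s \<union> (u - S)))"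

text \<open>
  Density matrix of the qubits \<open>S \<subseteq> Q\<close> when \<open>Q\<close> is in the pure state \<open>\<psi>\<close> (partial trace over
  \<open>Q - S\<close>), set to 0 outside \<open>Pow S\<close> so that equality of density matrices is equality of
  functions.
\<close>

definition reduced_density :: "nat set \<Rightarrow> nat set \<Rightarrow> qstate \<Rightarrow> qmatrix" where
  "reduced_density Q S \<psi> = (\<lambda>u v.
     if u \<subseteq> S \<and> v \<subseteq> S then (\<Sum>e\<in>Pow (Q - S). \<psi> (u \<union> e) * cnj (\<psi> (v \<union> e))) else 0)"

section \<open>Communication problems\<close>

text \<open>
  The players' inputs may be correlated (Bob may hold copies of part of Alice's input), so the
  legal input pairs form an arbitrary set rather than a product.
\<close>

record ('a, 'b, 'z) comm_problem =
  legal_inputs :: "('a \<times> 'b) set"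
  target :: "'a \<Rightarrow> 'b \<Rightarrow> 'z"

definition comm_of_fun :: "'x set \<Rightarrow> 'y set \<Rightarrow> ('x \<Rightarrow> 'y \<Rightarrow> 'z) \<Rightarrow> ('x, 'y, 'z) comm_problem" where
  "comm_of_fun X Y f = \<lparr>legal_inputs = X \<times> Y, target = f\<rparr>"

text \<open>
  The game \<open>f\<^sup>(\<^sup>n\<^sup>)\<^sup>,\<^sup>A\<close>.  Alice's input \<open>[x\<^sub>1, \<dots>, x\<^sub>n]\<close> is a list, so \<open>x\<^sub>i\<close> is \<open>xs ! (i - 1)\<close>; Bob's
  input is \<open>(y, i, [x\<^sub>1, \<dots>, x\<^sub>i\<^sub>-\<^sub>1])\<close> with \<open>1 \<le> i \<le> n\<close>.
\<close>

definition game_A ::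
  "'x set \<Rightarrow> 'y set \<Rightarrow> ('x \<Rightarrow> 'y \<Rightarrow> 'z) \<Rightarrow> nat \<Rightarrow> ('x list, 'y \<times> nat \<times> 'x list, 'z) comm_problem"
where
  "game_A X Y f n =
     \<lparr>legal_inputs = {(xs, (y, i, take (i - 1) xs)) | xs y i.
                        length xs = n \<and> set xs \<subseteq> X \<and> y \<in> Y \<and> i \<in> {1..n}},
      target = (\<lambda>xs (y, i, ps). f (xs ! (i - 1)) y)\<rparr>"

section \<open>Coinless quantum protocols\<close>

datatype player = Alice | Bob

fun opponent :: "player \<Rightarrow> player" where
  "opponent Alice = Bob"
| "opponent Bob = Alice"

text \<open>
  Steps are numbered from 0.  In step \<open>k\<close> the player whose turn it is applies a unitary
  transformation to all qubits he holds and then, for \<open>k < length messages\<close>, hands the qubits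
  \<open>messages ! k\<close> over to the opponent.  There is one more step than there are messages: in the
  last one the final recipient applies a unitary transformation before the measurement of
  \<open>answer_qubits\<close>; without messages this is the only step, and it is the starting player's.
  Neither the sets of qubits nor \<open>decode\<close> depend on the inputs.
\<close>

record ('a, 'b, 'z) protocol =
  starter :: player
  init_qubits :: "player \<Rightarrow> nat set"
  input_qubits :: "player \<Rightarrow> nat set"
  encode_A :: "'a \<Rightarrow> nat set"
  encode_B :: "'b \<Rightarrow> nat set"
  ops_A :: "nat \<Rightarrow> 'a \<Rightarrow> qmatrix"
  ops_B :: "nat \<Rightarrow> 'b \<Rightarrow> qmatrix"
  messages :: "nat set list"
  safe_overhead :: "nat set"
  answer_qubits :: "nat set"
  decode :: "nat set \<Rightarrow> 'z"

definition all_qubits :: "('a, 'b, 'z) protocol \<Rightarrow> nat set" where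
  "all_qubits P = init_qubits P Alice \<union> init_qubits P Bob"

definition all_input_qubits :: "('a, 'b, 'z) protocol \<Rightarrow> nat set" where
  "all_input_qubits P = input_qubits P Alice \<union> input_qubits P Bob"

definition rounds :: "('a, 'b, 'z) protocol \<Rightarrow> nat" where
  "rounds P = length (messages P)"

definition turn :: "('a, 'b, 'z) protocol \<Rightarrow> nat \<Rightarrow> player" where
  "turn P k = (if even k then starter P else opponent (starter P))"

text \<open>The qubits in the possession of a player when \<open>k\<close> messages have been sent.\<close>

primrec held :: "('a, 'b, 'z) protocol \<Rightarrow> nat \<Rightarrow> player \<Rightarrow> nat set" where
  "held P 0 = init_qubits P"
| "held P (Suc k) = (\<lambda>p. if p = turn P k then held P k p - messages P ! k
                          else held P k p \<union> messages P ! k)"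

definition step_op :: "('a, 'b, 'z) protocol \<Rightarrow> nat \<Rightarrow> 'a \<Rightarrow> 'b \<Rightarrow> qmatrix" where
  "step_op P k a b = (case turn P k of Alice \<Rightarrow> ops_A P k a | Bob \<Rightarrow> ops_B P k b)"

text \<open>
  The global state after \<open>k\<close> unitary transformations.  Initially the input qubits are in the
  basis states encoding the inputs and all other qubits are zero.
\<close>

primrec state_after :: "('a, 'b, 'z) protocol \<Rightarrow> 'a \<Rightarrow> 'b \<Rightarrow> nat \<Rightarrow> qstate" where
  "state_after P a b 0 = basis_state (encode_A P a \<union> encode_B P b)"
| "state_after P a b (Suc k) =
     apply_on (held P k (turn P k)) (step_op P k a b) (state_after P a b k)"

definition final_state :: "('a, 'b, 'z) protocol \<Rightarrow> 'a \<Rightarrow> 'b \<Rightarrow> qstate" where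
  "final_state P a b = state_after P a b (Suc (rounds P))"

definition coinless_protocol ::
  "('a, 'b, 'z) comm_problem \<Rightarrow> ('a, 'b, 'z) protocol \<Rightarrow> bool"
where
  "coinless_protocol F P \<longleftrightarrow>
     (\<forall>p. finite (init_qubits P p) \<and> input_qubits P p \<subseteq> init_qubits P p) \<and>
     init_qubits P Alice \<inter> init_qubits P Bob = {} \<and>
     inj_on (encode_A P) (fst ` legal_inputs F) \<and>
     inj_on (encode_B P) (snd ` legal_inputs F) \<and>
     (\<forall>(a, b)\<in>legal_inputs F.
        encode_A P a \<subseteq> input_qubits P Alice \<and> encode_B P b \<subseteq> input_qubits P Bob) \<and>
     (\<forall>(a, b)\<in>legal_inputs F. \<forall>k\<le>rounds P.
        unitary_on (held P k (turn P k)) (step_op P k a b)) \<and>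
     (\<forall>k<rounds P. messages P ! k \<subseteq> held P k (turn P k)) \<and>
     answer_qubits P \<subseteq> held P (rounds P) (turn P (rounds P))"

definition secure :: "('a, 'b, 'z) comm_problem \<Rightarrow> ('a, 'b, 'z) protocol \<Rightarrow> bool" where
  "secure F P \<longleftrightarrow>
     (\<forall>k<rounds P. messages P ! k \<inter> all_input_qubits P = {}) \<and>
     (\<forall>(a, b)\<in>legal_inputs F. \<forall>k\<le>Suc (rounds P).
        reduced_density (all_qubits P) (all_input_qubits P) (state_after P a b k) =
        reduced_density (all_qubits P) (all_input_qubits P) (state_after P a b 0)) \<and>
     answer_qubits P \<inter> all_input_qubits P = {}"

text \<open>
  \<open>safe_coinless_protocol F s t c l P\<close>: \<open>P\<close> is a \<open>[t; c; l\<^sub>1, \<dots>, l\<^sub>t]\<close> safe coinless protocol for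
  \<open>F\<close> in which \<open>s\<close> starts, where \<open>l\<^sub>i\<close> is \<open>l ! (i - 1)\<close>.  The safe overhead is inspected at the
  moment the first message is sent, i.e. after one unitary transformation; for \<open>t = 0\<close> there is
  no first message and \<open>c\<close> plays no role.
\<close>

definition safe_coinless_protocol ::
  "('a, 'b, 'z) comm_problem \<Rightarrow> player \<Rightarrow> nat \<Rightarrow> nat \<Rightarrow> nat list \<Rightarrow> ('a, 'b, 'z) protocol \<Rightarrow> bool"
where
  "safe_coinless_protocol F s t c l P \<longleftrightarrow>
     coinless_protocol F P \<and> secure F P \<and> starter P = s \<and> rounds P = t \<and> length l = t \<and>
     (\<forall>k<t. card (messages P ! k) = (if k = 0 then l ! 0 + c else l ! k)) \<and>
     (t > 0 \<longrightarrow>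
        safe_overhead P \<subseteq> messages P ! 0 \<and> card (safe_overhead P) = c \<and>
        (\<exists>\<rho>. \<forall>(a, b)\<in>legal_inputs F.
           reduced_density (all_qubits P) (safe_overhead P) (state_after P a b 1) = \<rho>))"

text \<open>Probability that the decoded measurement outcome differs from the correct answer.\<close>

definition coinless_error_prob ::
  "('a, 'b, 'z) comm_problem \<Rightarrow> ('a, 'b, 'z) protocol \<Rightarrow> 'a \<Rightarrow> 'b \<Rightarrow> real"
where
  "coinless_error_prob F P a b =
     (\<Sum>u\<in>{u \<in> Pow (all_qubits P). decode P (u \<inter> answer_qubits P) \<noteq> target F a b}.
        (cmod (final_state P a b u))\<^sup>2)"

section \<open>Public coin protocols\<close>

definition safe_public_coin_protocol ::
  "('a, 'b, 'z) comm_problem \<Rightarrow> player \<Rightarrow> nat \<Rightarrow> nat \<Rightarrow> nat list \<Rightarrow>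
   ('a, 'b, 'z) protocol pmf \<Rightarrow> bool"
where
  "safe_public_coin_protocol F s t c l \<P> \<longleftrightarrow>
     finite (set_pmf \<P>) \<and> (\<forall>P\<in>set_pmf \<P>. safe_coinless_protocol F s t c l P)"

definition error_prob ::
  "('a, 'b, 'z) comm_problem \<Rightarrow> ('a, 'b, 'z) protocol pmf \<Rightarrow> 'a \<Rightarrow> 'b \<Rightarrow> real"
where
  "error_prob F \<P> a b = measure_pmf.expectation \<P> (\<lambda>P. coinless_error_prob F P a b)"

text \<open>
  Error probabilities are nonnegative, so the inserted 0 only serves to give problems without
  any legal input the error 0.  Used for finite sets of legal inputs.
\<close>

definition worst_case_error ::
  "('a, 'b, 'z) comm_problem \<Rightarrow> ('a, 'b, 'z) protocol pmf \<Rightarrow> real"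
where
  "worst_case_error F \<P> = Max (insert 0 ((\<lambda>(a, b). error_prob F \<P> a b) ` legal_inputs F))"

end

theory Submission
  imports Defs "Jordan_Normal_Form.Spectral_Radius"
begin

text \<open>
  Let \<open>x\<^sub>1, \<dots>, x\<^sub>n\<close> be independent and let \<open>\<rho>(ws)\<close> be the average first message of the protocol for
  the game over all inputs of Alice with prefix \<open>ws\<close>.  The relative entropies of \<open>\<rho>(ws @ [x])\<close>
  with respect to \<open>\<rho>(ws)\<close> add up, in expectation, to that of the full message with respect to its
  average (chain rule).  A message with main part of \<open>l\<^sub>1\<close> qubits and fixed overhead \<open>\<sigma>\<close> is at most
  \<open>4 ^ l\<^sub>1\<close> times the state \<open>2 ^ (- l\<^sub>1) \<cdot> 1 \<otimes> \<sigma>\<close>, so the sum is at most \<open>2 l\<^sub>1 ln 2\<close>, which is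
  \<open>2 l\<^sub>1 ln 2 / n\<close> on average over the positions.

  For a fixed position and prefix, Bob can prepare a purification of the average message himself
  and send the purifying part, which is independent of all inputs, as safe overhead.  Knowing \<open>x\<close>,
  Alice rotates it towards the purification which the old protocol would have produced.  With
  canonical purifications the inner product is \<open>B = Tr (\<surd>\<rho>(ws @ [x]) \<surd>\<rho>(ws))\<close>, the relative
  entropy is at least \<open>2 (1 - B)\<close>, and the error grows by at most \<open>sqrt (1 - B\<^sup>2) \<le> sqrt (2 (1 - B))\<close>.
  Some position and prefix are at least as good as the average.  This bounds the average error for
  every distribution of \<open>(x, y)\<close>; a minimax argument gives the worst case.
\<close>

section \<open>Unitary and Hermitian matrices on finite index sets\<close>

text \<open>The factor \<open>4 ^ l\<^sub>1\<close> is a product of two dimensions: Cauchy-Schwarz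
  over the \<open>2 ^ l\<^sub>1\<close> basis states of the main part bounds a message by
  \<open>2 ^ l\<^sub>1\<close> times the identity tensored with the overhead, and normalising the
  identity costs another \<open>2 ^ l\<^sub>1\<close>. The new protocol has to be fixed before its
  inputs are known and has to keep the global state pure. So the position and the prefix are wired
  into it, and the letters after \<open>x\<close> are averaged over coherently: a register that is
  never measured holds them in superposition. No logarithm or square root of a matrix is ever
  formed. Each density matrix comes with one chosen eigendecomposition, which serves both for its
  entropy and for its purification. Public coins enter only at the two ends. Against a fixed
  distribution of inputs some single coinless protocol of the old mixture is as good as the mixture,
  so only coinless protocols are transformed; the new coins come from the minimax argument. That
  argument reaches the optimal value only approximately, and the slack is taken from the strict
  inequality assumed for the old error.\<close>

definition inner_on :: "'i set \<Rightarrow> ('i \<Rightarrow> complex) \<Rightarrow> ('i \<Rightarrow> complex) \<Rightarrow> complex" where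
  "inner_on I f g = (\<Sum>i\<in>I. cnj (f i) * g i)"

text \<open>Over an arbitrary index set rather than \<open>Pow S\<close>, so that the spectral
  theorem can be proved by induction on the index set.\<close>

definition unitary_mat :: "'i set \<Rightarrow> ('i \<Rightarrow> 'i \<Rightarrow> complex) \<Rightarrow> bool" where
  "unitary_mat I U \<longleftrightarrow>
     (\<forall>u\<in>I. \<forall>v\<in>I. (\<Sum>s\<in>I. U u s * cnj (U v s)) = (if u = v then 1 else 0)) \<and>
     (\<forall>u\<in>I. \<forall>v\<in>I. (\<Sum>s\<in>I. cnj (U s u) * U s v) = (if u = v then 1 else 0))"

definition hermitian_mat :: "'i set \<Rightarrow> ('i \<Rightarrow> 'i \<Rightarrow> complex) \<Rightarrow> bool" where
  "hermitian_mat I A \<longleftrightarrow> (\<forall>i\<in>I. \<forall>j\<in>I. A j i = cnj (A i j))"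

lemma unitary_on_iff: "unitary_on S U \<longleftrightarrow> unitary_mat (Pow S) U"
  unfolding unitary_on_def unitary_mat_def ..

lemma inner_on_commute: "inner_on I g f = cnj (inner_on I f g)"
  by (simp add: inner_on_def mult.commute)

lemma inner_on_self: "inner_on I f f = of_real (\<Sum>i\<in>I. (cmod (f i))\<^sup>2)"
  by (simp add: inner_on_def complex_norm_square mult.commute flip: of_real_power)

lemma inner_on_diff_left: "inner_on I (\<lambda>i. f i - g i) h = inner_on I f h - inner_on I g h"
  by (simp add: inner_on_def algebra_simps sum_subtractf)

lemma inner_on_diff_right: "inner_on I h (\<lambda>i. f i - g i) = inner_on I h f - inner_on I h g"
  by (simp add: inner_on_def algebra_simps sum_subtractf)

lemma inner_on_cong: "(\<And>i. i \<in> I \<Longrightarrow> f i = f' i) \<Longrightarrow> (\<And>i. i \<in> I \<Longrightarrow> g i = g' i) \<Longrightarrow> inner_on I f g = inner_on I f' g'"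
  by (simp add: inner_on_def)

lemma sum_delta_left:
  assumes "finite I" "k \<in> I"
  shows "(\<Sum>i\<in>I. (if k = i then 1 else 0) * g i) = (g k :: complex)"
  using assms by (simp add: if_distrib[of "\<lambda>x. x * _"] cong: if_cong)

lemma unitary_mat_inner:
  assumes I: "finite I" and U: "unitary_mat I U"
  shows "inner_on I (\<lambda>i. \<Sum>k\<in>I. U i k * f k) (\<lambda>i. \<Sum>k\<in>I. U i k * g k) = inner_on I f g"
proof -
  have "inner_on I (\<lambda>i. \<Sum>k\<in>I. U i k * f k) (\<lambda>i. \<Sum>k\<in>I. U i k * g k)
      = (\<Sum>s\<in>I. \<Sum>k\<in>I. \<Sum>l\<in>I. cnj (f k) * g l * (cnj (U s k) * U s l))"
    unfolding inner_on_def cnj_sum sum_product by (intro sum.cong refl) (simp add: algebra_simps)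
  also have "\<dots> = (\<Sum>k\<in>I. \<Sum>l\<in>I. \<Sum>s\<in>I. cnj (f k) * g l * (cnj (U s k) * U s l))"
    by (subst sum.swap, rule sum.cong[OF refl], rule sum.swap)
  also have "\<dots> = (\<Sum>k\<in>I. \<Sum>l\<in>I. cnj (f k) * g l * (if k = l then 1 else 0))"
    using U unfolding sum_distrib_left[symmetric] unitary_mat_def by simp
  also have "\<dots> = (\<Sum>k\<in>I. cnj (f k) * g k)"
    using I by (simp add: if_distrib cong: if_cong)
  finally show ?thesis by (simp add: inner_on_def)
qed

lemma unitary_mat_adjoint: "unitary_mat I (\<lambda>i j. cnj (U j i)) \<longleftrightarrow> unitary_mat I U"
proof -
  have "(\<Sum>s\<in>I. cnj (U s u) * cnj (cnj (U s v))) = (if u = v then 1 else 0) \<longleftrightarrow>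
      (\<Sum>s\<in>I. cnj (U s u) * U s v) = (if u = v then 1 else 0)"
    "(\<Sum>s\<in>I. cnj (cnj (U u s)) * cnj (U v s)) = (if u = v then 1 else 0) \<longleftrightarrow>
      (\<Sum>s\<in>I. U u s * cnj (U v s)) = (if u = v then 1 else 0)" for u v
    by simp_all
  then show ?thesis unfolding unitary_mat_def by blast
qed

lemma unitary_mat_mult:
  assumes I: "finite I" and U: "unitary_mat I U" and V: "unitary_mat I V"
  shows "unitary_mat I (\<lambda>i j. \<Sum>k\<in>I. U i k * V k j)"
proof -
  have cols: "(\<Sum>s\<in>I. cnj (\<Sum>k\<in>I. U s k * V k u) * (\<Sum>k\<in>I. U s k * V k v)) = (if u = v then 1 else 0)"
    if "unitary_mat I U" "unitary_mat I V" "u \<in> I" "v \<in> I" for U V :: "'a \<Rightarrow> 'a \<Rightarrow> complex" and u v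
    using unitary_mat_inner[OF I that(1), of "\<lambda>k. V k u" "\<lambda>k. V k v"] that(2-)
    by (simp add: inner_on_def unitary_mat_def)
  \<comment> \<open>The row relations of a product are the column relations of the product of the
    adjoints in reverse order.\<close>
  have "(\<Sum>s\<in>I. (\<Sum>k\<in>I. U u k * V k s) * cnj (\<Sum>k\<in>I. U v k * V k s)) = (if u = v then 1 else 0)"
    if "u \<in> I" "v \<in> I" for u v
    using cols[OF V[folded unitary_mat_adjoint[of I V]] U[folded unitary_mat_adjoint[of I U]] that]
    by (simp add: mult.commute)
  then show ?thesis using cols[OF U V] unfolding unitary_mat_def by blast
qed

lemma unitary_mat_id: "finite I \<Longrightarrow> unitary_mat I (\<lambda>i j. if i = j then 1 else 0)"
  unfolding unitary_mat_def
  by (auto simp: if_distrib[of cnj] if_distrib[of "\<lambda>x. x * _"] cong: if_cong)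

text \<open>
  The complex Householder map \<open>1 - w w\<^sup>* / \<langle>w, f\<rangle>\<close> with \<open>w = f - g\<close>; it is unitary because
  \<open>\<parallel>w\<parallel>\<^sup>2 = 2 Re \<langle>w, f\<rangle>\<close>.
\<close>

lemma householder:
  assumes I: "finite I" and eq: "inner_on I f f = inner_on I g g"
  obtains U where "unitary_mat I U" "\<And>i. i \<in> I \<Longrightarrow> (\<Sum>j\<in>I. U i j * f j) = g i"
    "\<And>h i. inner_on I f h = inner_on I g h \<Longrightarrow> i \<in> I \<Longrightarrow> (\<Sum>j\<in>I. U i j * h j) = h i"
proof -
  define w where "w = (\<lambda>i. f i - g i)"
  define W where "W = inner_on I w f"
  \<comment> \<open>For \<open>W = 0\<close> division gives \<open>c = 0\<close> and
    \<open>U\<close> is the identity; \<open>W0\<close> shows that \<open>f\<close> and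
    \<open>g\<close> agree on \<open>I\<close> in that case.\<close>
  define c where "c = 1 / W"
  define U where "U = (\<lambda>i j. (if i = j then 1 else 0) - c * w i * cnj (w j))"
  have ww: "inner_on I w w = W + cnj W"
    unfolding W_def w_def inner_on_diff_left inner_on_diff_right
    using eq inner_on_commute[of I f g] inner_on_commute[of I g g] by simp
  have U_apply: "(\<Sum>j\<in>I. U i j * h j) = h i - c * w i * inner_on I w h" if "i \<in> I" for i h
    unfolding U_def inner_on_def left_diff_distrib sum_subtractf
    using I that by (simp add: sum_delta_left sum_distrib_left mult.assoc)
  have W0: "w i = 0" if "W = 0" "i \<in> I" for i
  proof -
    have "(\<Sum>i\<in>I. (cmod (w i))\<^sup>2) = 0"
      using ww \<open>W = 0\<close> inner_on_self[of I w] by (metis add.right_neutral complex_cnj_zero of_real_eq_0_iff)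
    then show ?thesis using that I by (simp add: sum_nonneg_eq_0_iff)
  qed
  have key: "c * cnj c * inner_on I w w = c + cnj c"
    unfolding ww c_def by (cases "W = 0") (simp_all add: field_simps)
  \<comment> \<open>A general scalar \<open>a\<close> serves both halves of unitarity: the adjoint
    of \<open>U\<close> has the same form with \<open>cnj c\<close>. The equation for
    \<open>a\<close> makes the terms in \<open>w u * cnj (w v)\<close> cancel.\<close>
  have rows: "(\<Sum>s\<in>I. ((if u = s then 1 else 0) - a * w u * cnj (w s)) * cnj ((if v = s then 1 else 0) - a * w v * cnj (w s)))
      = (if u = v then 1 else 0)" if uv: "u \<in> I" "v \<in> I" and a: "a * cnj a * inner_on I w w = a + cnj a" for u v a
  proof -
    have "(\<Sum>s\<in>I. ((if u = s then 1 else 0) - a * w u * cnj (w s)) * cnj ((if v = s then 1 else 0) - a * w v * cnj (w s)))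
      = (\<Sum>s\<in>I. (if u = s then 1 else 0) * (if v = s then 1 else 0)) - a * w u * (\<Sum>s\<in>I. (if v = s then 1 else 0) * cnj (w s))
        - cnj a * cnj (w v) * (\<Sum>s\<in>I. (if u = s then 1 else 0) * w s) + w u * cnj (w v) * (a * cnj a * inner_on I w w)"
      unfolding inner_on_def sum_distrib_left sum_subtractf[symmetric] sum.distrib[symmetric]
      by (intro sum.cong refl) (simp add: algebra_simps)
    also have "\<dots> = (if u = v then 1 else 0)"
      unfolding sum_delta_left[OF I uv(1)] sum_delta_left[OF I uv(2)] a by (auto simp: algebra_simps)
    finally show ?thesis .
  qed
  have "unitary_mat I U"
    unfolding unitary_mat_def
  proof (intro conjI ballI)
    fix u v assume uv: "u \<in> I" "v \<in> I"
    show "(\<Sum>s\<in>I. U u s * cnj (U v s)) = (if u = v then 1 else 0)"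
      unfolding U_def by (rule rows[OF uv key])
    have "cnj c * cnj (cnj c) * inner_on I w w = cnj c + cnj (cnj c)" using key by (simp add: mult_ac add.commute)
    note adj = rows[OF uv this]
    have "cnj (U s u) * U s v = ((if u = s then 1 else 0) - cnj c * w u * cnj (w s)) *
        cnj ((if v = s then 1 else 0) - cnj c * w v * cnj (w s))" for s
      by (cases "u = s"; cases "v = s") (auto simp: U_def mult_ac)
    then show "(\<Sum>s\<in>I. cnj (U s u) * U s v) = (if u = v then 1 else 0)"
      using adj by (simp only:)
  qed
  moreover have "(\<Sum>j\<in>I. U i j * f j) = g i" if "i \<in> I" for i
    unfolding U_apply[OF that] W_def[symmetric] using W0[OF _ that]
    by (cases "W = 0") (auto simp: c_def w_def)
  moreover have "(\<Sum>j\<in>I. U i j * h j) = h i" if "inner_on I f h = inner_on I g h" "i \<in> I" for h i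
    unfolding U_apply[OF that(2)] w_def inner_on_diff_left using that by simp
  ultimately show ?thesis using that by blast
qed

text \<open>In the induction, a Householder map moves the new vector and fixes the earlier ones.\<close>

lemma same_gram_unitary:
  assumes R: "finite R" and "finite I"
    and "\<And>i j. i \<in> I \<Longrightarrow> j \<in> I \<Longrightarrow> inner_on R (F i) (F j) = inner_on R (G i) (G j)"
  shows "\<exists>U. unitary_mat R U \<and> (\<forall>i\<in>I. \<forall>r\<in>R. (\<Sum>s\<in>R. U r s * F i s) = G i r)"
  using assms(2,3)
proof (induction I rule: finite_induct)
  case empty
  then show ?case using unitary_mat_id[OF R] by blast
next
  case (insert a I)
  then obtain U where U: "unitary_mat R U" "\<And>i r. i \<in> I \<Longrightarrow> r \<in> R \<Longrightarrow> (\<Sum>s\<in>R. U r s * F i s) = G i r"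
    by (metis insertCI)
  define f where "f = (\<lambda>r. \<Sum>s\<in>R. U r s * F a s)"
  have ff: "inner_on R f f = inner_on R (G a) (G a)"
    unfolding f_def unitary_mat_inner[OF R U(1)] using insert.prems by simp
  \<comment> \<open>Thus \<open>f - G a\<close> is orthogonal to every earlier \<open>G i\<close>,
    which is why the Householder map fixes them.\<close>
  have fG: "inner_on R f (G i) = inner_on R (G a) (G i)" if "i \<in> I" for i
  proof -
    have "inner_on R f (G i) = inner_on R f (\<lambda>r. \<Sum>s\<in>R. U r s * F i s)"
      using U(2)[OF that] by (intro inner_on_cong) auto
    also have "\<dots> = inner_on R (F a) (F i)" unfolding f_def by (rule unitary_mat_inner[OF R U(1)])
    finally show ?thesis using insert.prems that by simp
  qed
  obtain H where H: "unitary_mat R H" "\<And>r. r \<in> R \<Longrightarrow> (\<Sum>s\<in>R. H r s * f s) = G a r"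
    "\<And>h r. inner_on R f h = inner_on R (G a) h \<Longrightarrow> r \<in> R \<Longrightarrow> (\<Sum>s\<in>R. H r s * h s) = h r"
    using householder[OF R ff] by blast
  define V where "V = (\<lambda>i j. \<Sum>k\<in>R. H i k * U k j)"
  have V: "(\<Sum>s\<in>R. V r s * h s) = (\<Sum>k\<in>R. H r k * (\<Sum>s\<in>R. U k s * h s))" for r h
    unfolding V_def sum_distrib_left sum_distrib_right by (subst sum.swap) (simp add: mult.assoc)
  have "(\<Sum>s\<in>R. V r s * F i s) = G i r" if "i \<in> insert a I" "r \<in> R" for i r
  proof (cases "i = a")
    case True
    then show ?thesis unfolding V using H(2)[OF that(2)] by (simp add: f_def)
  next
    case False
    then have "i \<in> I" using that by simp
    then have "(\<Sum>s\<in>R. V r s * F i s) = (\<Sum>k\<in>R. H r k * G i k)"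
      unfolding V using U(2) by simp
    then show ?thesis using H(3)[OF fG[OF \<open>i \<in> I\<close>] that(2)] by simp
  qed
  moreover have "unitary_mat R V" unfolding V_def by (rule unitary_mat_mult[OF R H(1) U(1)])
  ultimately show ?case by blast
qed

section \<open>Eigenvectors and the spectral theorem\<close>

lemma eigenvector_exists:
  fixes A :: "'i \<Rightarrow> 'i \<Rightarrow> complex"
  assumes I: "finite I" "I \<noteq> {}"
  obtains v e where "inner_on I v v = 1" "\<And>i. i \<in> I \<Longrightarrow> (\<Sum>j\<in>I. A i j * v j) = e * v i"
proof -
  define n where "n = card I"
  have n: "n > 0" using I by (simp add: n_def card_gt_0_iff)
  \<comment> \<open>An enumeration of \<open>I\<close> turns \<open>A\<close> into a square complex
    matrix, whose spectrum is nonempty.\<close>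
  obtain b where b: "bij_betw b {0..<n} I" using ex_bij_betw_nat_finite[OF I(1)] n_def by blast
  define B where "B = mat n n (\<lambda>(i, j). A (b i) (b j))"
  have B: "B \<in> carrier_mat n n" by (simp add: B_def)
  obtain e where "eigenvalue B e"
    using spectrum_non_empty[OF B n] unfolding spectrum_def by blast
  then obtain x where x: "x \<in> carrier_vec n" "x \<noteq> 0\<^sub>v n" "B *\<^sub>v x = e \<cdot>\<^sub>v x"
    unfolding eigenvalue_def eigenvector_def using B by auto
  define u where "u = (\<lambda>i. vec_index x (inv_into {0..<n} b i))"
  have ub: "u (b k) = vec_index x k" if "k < n" for k
    unfolding u_def using b that by (simp add: bij_betw_def)
  have eig: "(\<Sum>j\<in>I. A i j * u j) = e * u i" if "i \<in> I" for i
  proof -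
    obtain k where k: "k < n" "i = b k" using b \<open>i \<in> I\<close> by (force simp: bij_betw_def)
    have "(\<Sum>j\<in>I. A i j * u j) = (\<Sum>l\<in>{0..<n}. A i (b l) * u (b l))"
      by (rule sum.reindex_bij_betw[OF b, symmetric])
    also have "\<dots> = vec_index (B *\<^sub>v x) k"
      using k x(1) by (simp add: B_def scalar_prod_def ub)
    also have "\<dots> = e * u i" using k x(1,3) ub by simp
    finally show ?thesis .
  qed
  obtain k where k: "k < n" "vec_index x k \<noteq> 0"
    using x(1,2) by (metis carrier_vecD eq_vecI index_zero_vec(1) index_zero_vec(2))
  define N where "N = (\<Sum>i\<in>I. (cmod (u i))\<^sup>2)"
  have "b k \<in> I" using b k by (auto simp: bij_betw_def)
  then have "N > 0" unfolding N_def using k ub[of k] I by (intro sum_pos2[where i = "b k"]) auto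
  define v where "v = (\<lambda>i. u i / of_real (sqrt N))"
  have "inner_on I v v = 1"
  proof -
    have "(\<Sum>i\<in>I. (cmod (v i))\<^sup>2) = N / N"
      unfolding v_def using \<open>N > 0\<close>
      by (simp add: norm_divide power_divide N_def flip: sum_divide_distrib)
    then show ?thesis using \<open>N > 0\<close> by (simp add: inner_on_self)
  qed
  moreover have "(\<Sum>j\<in>I. A i j * v j) = e * v i" if "i \<in> I" for i
    using eig[OF that] by (simp add: v_def flip: sum_divide_distrib)
  ultimately show ?thesis using that by blast
qed

text \<open>Deflation: a unitary \<open>H\<close> sends the coordinate vector of the new index to a
  unit eigenvector, and conjugation by \<open>H\<close> splits off its eigenvalue, leaving a
  Hermitian matrix on the smaller index set.\<close>

lemma spectral_decomposition:
  assumes "finite I" "hermitian_mat I A"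
  shows "\<exists>(V :: 'i \<Rightarrow> 'i \<Rightarrow> complex) (p :: 'i \<Rightarrow> real). unitary_mat I V \<and>
    (\<forall>i\<in>I. \<forall>j\<in>I. A i j = (\<Sum>k\<in>I. p k * V i k * cnj (V j k)))"
  using assms
proof (induction I arbitrary: A rule: finite_induct)
  case empty
  then show ?case by (simp add: unitary_mat_def)
next
  case (insert a I)
  let ?J = "insert a I"
  have J: "finite ?J" using insert by simp
  have herm: "A j i = cnj (A i j)" if "i \<in> ?J" "j \<in> ?J" for i j
    using insert.prems that unfolding hermitian_mat_def by blast
  obtain v e where v: "inner_on ?J v v = 1" "\<And>i. i \<in> ?J \<Longrightarrow> (\<Sum>j\<in>?J. A i j * v j) = e * v i"
    using eigenvector_exists[OF J] by blast
  define d where "d = (\<lambda>i. if i = a then 1 else (0::complex))"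
  have "inner_on ?J d d = inner_on ?J v v"
    using insert.hyps by (simp add: v(1)) (auto simp: inner_on_def d_def intro!: sum.neutral)
  note dd = this
  obtain H where H: "unitary_mat ?J H"
    "\<And>i. i \<in> ?J \<Longrightarrow> (\<Sum>j\<in>?J. H i j * d j) = v i"
    by (rule householder[OF J dd]) (rule that)
  have Ha: "H i a = v i" if "i \<in> ?J" for i
    using H(2)[OF that] J by (simp add: d_def if_distrib[of "\<lambda>x. _ * x"] cong: if_cong)
  have H1: "(\<Sum>s\<in>?J. H u s * cnj (H v s)) = (if u = v then 1 else 0)"
    and H2: "(\<Sum>s\<in>?J. cnj (H s u) * H s v) = (if u = v then 1 else 0)"
    if "u \<in> ?J" "v \<in> ?J" for u v
    using H(1) that unfolding unitary_mat_def by blast+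
  define B where "B = (\<lambda>i j. \<Sum>k\<in>?J. \<Sum>l\<in>?J. cnj (H k i) * A k l * H l j)"
  have Bherm: "B j i = cnj (B i j)" for i j
  proof -
    have "B j i = (\<Sum>l\<in>?J. \<Sum>k\<in>?J. cnj (H k j) * A k l * H l i)"
      unfolding B_def by (rule sum.swap)
    also have "\<dots> = (\<Sum>l\<in>?J. \<Sum>k\<in>?J. cnj (cnj (H l i) * A l k * H k j))"
    proof (intro sum.cong refl)
      fix k l assume "l \<in> ?J" "k \<in> ?J"
      from herm[OF this] show "cnj (H k j) * A k l * H l i = cnj (cnj (H l i) * A l k * H k j)"
        by simp
    qed
    finally show ?thesis unfolding B_def cnj_sum .
  qed
  \<comment> \<open>Column \<open>a\<close> of \<open>H\<close> is the eigenvector, so column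
    \<open>a\<close> of the conjugated matrix is diagonal; hermiticity carries this over to the row
    and makes \<open>e\<close> real.\<close>
  have Ba: "B i a = (if i = a then e else 0)" if "i \<in> ?J" for i
  proof -
    have "B i a = (\<Sum>k\<in>?J. cnj (H k i) * (\<Sum>l\<in>?J. A k l * v l))"
      unfolding B_def sum_distrib_left by (auto intro!: sum.cong simp: Ha mult.assoc)
    also have "\<dots> = e * (\<Sum>k\<in>?J. cnj (H k i) * H k a)"
      unfolding sum_distrib_left[of e] by (intro sum.cong refl) (simp add: v(2) Ha del: sum.insert)
    also have "\<dots> = (if i = a then e else 0)" using H2[OF that, of a] by simp
    finally show ?thesis .
  qed
  have Ba': "B a i = (if i = a then e else 0)" if "i \<in> ?J" for i
    using Bherm[of i a] Ba[OF that] by (cases "i = a") simp_all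
  have e_real: "e = of_real (Re e)"
    using Bherm[of a a] Ba[of a] by (simp add: complex_eq_iff)
  have AB: "A i j = (\<Sum>k\<in>?J. \<Sum>l\<in>?J. H i k * B k l * cnj (H j l))" if ij: "i \<in> ?J" "j \<in> ?J" for i j
  proof -
    have "(\<Sum>k\<in>?J. H i k * B k l) = (\<Sum>m\<in>?J. A i m * H m l)" for l
    proof -
      have "(\<Sum>k\<in>?J. H i k * B k l) = (\<Sum>k\<in>?J. \<Sum>n\<in>?J. \<Sum>m\<in>?J. H i k * cnj (H n k) * (A n m * H m l))"
        unfolding B_def sum_distrib_left by (simp only: mult.assoc)
      also have "\<dots> = (\<Sum>n\<in>?J. \<Sum>m\<in>?J. \<Sum>k\<in>?J. H i k * cnj (H n k) * (A n m * H m l))"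
        by (subst sum.swap, rule sum.cong[OF refl], rule sum.swap)
      also have "\<dots> = (\<Sum>n\<in>?J. (if i = n then 1 else 0) * (\<Sum>m\<in>?J. A n m * H m l))"
        unfolding sum_distrib_right[symmetric] sum_distrib_left using H1[OF ij(1)]
        by (intro sum.cong refl) simp
      also have "\<dots> = (\<Sum>m\<in>?J. A i m * H m l)" by (rule sum_delta_left[OF J ij(1)])
      finally show ?thesis .
    qed
    note HB = this
    have "(\<Sum>k\<in>?J. \<Sum>l\<in>?J. H i k * B k l * cnj (H j l)) = (\<Sum>l\<in>?J. (\<Sum>k\<in>?J. H i k * B k l) * cnj (H j l))"
      unfolding sum_distrib_right by (rule sum.swap)
    also have "\<dots> = (\<Sum>l\<in>?J. \<Sum>m\<in>?J. H m l * cnj (H j l) * A i m)"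
      unfolding HB sum_distrib_right by (intro sum.cong refl) (simp add: mult_ac)
    also have "\<dots> = (\<Sum>m\<in>?J. (\<Sum>l\<in>?J. H m l * cnj (H j l)) * A i m)"
      unfolding sum_distrib_right by (rule sum.swap)
    also have "\<dots> = (\<Sum>m\<in>?J. (if j = m then 1 else 0) * A i m)"
      by (intro sum.cong refl) (subst H1, assumption, rule ij(2), auto)
    also have "\<dots> = A i j" by (rule sum_delta_left[OF J ij(2)])
    finally show ?thesis ..
  qed
  have "hermitian_mat I B" unfolding hermitian_mat_def using Bherm by blast
  from insert.IH[OF this] obtain W :: "'i \<Rightarrow> 'i \<Rightarrow> complex" and p :: "'i \<Rightarrow> real" where
    W: "unitary_mat I W" "\<And>i j. i \<in> I \<Longrightarrow> j \<in> I \<Longrightarrow> B i j = (\<Sum>k\<in>I. p k * W i k * cnj (W j k))"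
    by blast
  \<comment> \<open>The diagonalising matrix of the smaller block, extended by 1 in the corner
    \<open>a\<close>.\<close>
  define W' where "W' = (\<lambda>i j. if i = a then (if j = a then 1 else 0) else if j = a then 0 else W i j)"
  define p' where "p' = (\<lambda>k. if k = a then Re e else p k)"
  have aI: "i \<noteq> a" if "i \<in> I" for i using insert.hyps that by blast
  have W': "unitary_mat ?J W'"
    using W(1) insert.hyps aI unfolding unitary_mat_def W'_def by (auto cong: sum.cong)
  have BW: "B i j = (\<Sum>k\<in>?J. p' k * W' i k * cnj (W' j k))" if "i \<in> ?J" "j \<in> ?J" for i j
  proof (cases "i = a \<or> j = a")
    case True
    then have "B i j = (if i = j then e else 0)" using Ba Ba' that by auto
    then show ?thesis using True insert.hyps e_real aI by (auto simp: W'_def p'_def)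
  next
    case False
    then show ?thesis using that W(2) insert.hyps aI by (auto simp: W'_def p'_def intro!: sum.cong)
  qed
  define V where "V = (\<lambda>i j. \<Sum>k\<in>?J. H i k * W' k j)"
  have "unitary_mat ?J V" unfolding V_def by (rule unitary_mat_mult[OF J H(1) W'])
  moreover have "A i j = (\<Sum>m\<in>?J. p' m * V i m * cnj (V j m))" if ij: "i \<in> ?J" "j \<in> ?J" for i j
  proof -
    have "A i j = (\<Sum>k\<in>?J. \<Sum>l\<in>?J. \<Sum>m\<in>?J. p' m * (H i k * W' k m) * cnj (H j l * W' l m))"
      unfolding AB[OF ij]
      by (intro sum.cong refl) (simp add: BW sum_distrib_left sum_distrib_right mult_ac del: sum.insert)
    also have "\<dots> = (\<Sum>m\<in>?J. \<Sum>k\<in>?J. \<Sum>l\<in>?J. p' m * (H i k * W' k m) * cnj (H j l * W' l m))"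
    proof -
      have "(\<Sum>k\<in>?J. \<Sum>l\<in>?J. \<Sum>m\<in>?J. p' m * (H i k * W' k m) * cnj (H j l * W' l m))
        = (\<Sum>k\<in>?J. \<Sum>m\<in>?J. \<Sum>l\<in>?J. p' m * (H i k * W' k m) * cnj (H j l * W' l m))"
        by (rule sum.cong[OF refl], rule sum.swap)
      also have "\<dots> = (\<Sum>m\<in>?J. \<Sum>k\<in>?J. \<Sum>l\<in>?J. p' m * (H i k * W' k m) * cnj (H j l * W' l m))"
        by (rule sum.swap)
      finally show ?thesis .
    qed
    also have "\<dots> = (\<Sum>m\<in>?J. p' m * V i m * cnj (V j m))"
    proof (intro sum.cong refl)
      fix m
      have "V i m * cnj (V j m) = (\<Sum>k\<in>?J. \<Sum>l\<in>?J. (H i k * W' k m) * cnj (H j l * W' l m))"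
        unfolding V_def cnj_sum by (rule sum_product)
      then show "(\<Sum>k\<in>?J. \<Sum>l\<in>?J. p' m * (H i k * W' k m) * cnj (H j l * W' l m)) = p' m * V i m * cnj (V j m)"
        by (simp only: mult.assoc sum_distrib_left)
    qed
    finally show ?thesis .
  qed
  ultimately show ?case by blast
qed

section \<open>Relative entropy\<close>

text \<open>The form \<open><v, A v>\<close>, which is real for Hermitian \<open>A\<close>. It
  expresses the order of matrices and, evaluated on eigenvectors of \<open>B\<close>, the trace of
  \<open>A ln B\<close>.\<close>

definition quad_form :: "'i set \<Rightarrow> ('i \<Rightarrow> 'i \<Rightarrow> complex) \<Rightarrow> ('i \<Rightarrow> complex) \<Rightarrow> real" where
  "quad_form I A v = Re (\<Sum>i\<in>I. \<Sum>j\<in>I. cnj (v i) * A i j * v j)"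

text \<open>Eigenvectors and eigenvalues are carried as data, since entropies, overlaps and
  purifications are all written with the same choice of them.\<close>

definition spectral :: "'i set \<Rightarrow> ('i \<Rightarrow> 'i \<Rightarrow> complex) \<Rightarrow> ('i \<Rightarrow> 'i \<Rightarrow> complex) \<Rightarrow> ('i \<Rightarrow> real) \<Rightarrow> bool" where
  "spectral I A V p \<longleftrightarrow> unitary_mat I V \<and> (\<forall>k\<in>I. 0 \<le> p k) \<and>
     (\<forall>i\<in>I. \<forall>j\<in>I. A i j = (\<Sum>k\<in>I. p k * V i k * cnj (V j k)))"

definition mcol :: "('i \<Rightarrow> 'j \<Rightarrow> complex) \<Rightarrow> 'j \<Rightarrow> 'i \<Rightarrow> complex" where
  "mcol V k = (\<lambda>i. V i k)"

lemma inner_on_mcol: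
  assumes "unitary_mat I V" "j \<in> I" "k \<in> I"
  shows "inner_on I (mcol V j) (mcol V k) = (if j = k then 1 else 0)"
  using assms by (simp add: unitary_mat_def inner_on_def mcol_def)

lemma parseval:
  assumes I: "finite I" and V: "unitary_mat I V"
  shows "(\<Sum>k\<in>I. inner_on I f (mcol V k) * inner_on I (mcol V k) g) = inner_on I f g"
proof -
  have "(\<Sum>k\<in>I. inner_on I f (mcol V k) * inner_on I (mcol V k) g)
     = (\<Sum>k\<in>I. \<Sum>i\<in>I. \<Sum>j\<in>I. cnj (f i) * g j * (V i k * cnj (V j k)))"
    unfolding inner_on_def sum_product mcol_def by (intro sum.cong refl) (simp add: mult_ac)
  also have "\<dots> = (\<Sum>i\<in>I. \<Sum>j\<in>I. \<Sum>k\<in>I. cnj (f i) * g j * (V i k * cnj (V j k)))"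
    by (subst sum.swap, rule sum.cong[OF refl], rule sum.swap)
  also have "\<dots> = (\<Sum>i\<in>I. \<Sum>j\<in>I. cnj (f i) * g j * (if i = j then 1 else 0))"
    using V unfolding sum_distrib_left[symmetric] unitary_mat_def by simp
  also have "\<dots> = inner_on I f g"
    using I by (simp add: if_distrib inner_on_def cong: if_cong)
  finally show ?thesis .
qed

lemma parseval_norm:
  assumes I: "finite I" and V: "unitary_mat I V"
  shows "(\<Sum>k\<in>I. (cmod (inner_on I (mcol V k) f))\<^sup>2) = (\<Sum>i\<in>I. (cmod (f i))\<^sup>2)"
proof -
  have "of_real (\<Sum>k\<in>I. (cmod (inner_on I (mcol V k) f))\<^sup>2) = 
      (\<Sum>k\<in>I. inner_on I f (mcol V k) * inner_on I (mcol V k) f)"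
    unfolding of_real_sum using inner_on_commute[of I f]
    by (intro sum.cong refl) (simp add: complex_norm_square mult.commute flip: of_real_power)
  also have "\<dots> = of_real (\<Sum>i\<in>I. (cmod (f i))\<^sup>2)"
    by (simp add: parseval[OF I V] inner_on_self)
  finally show ?thesis by (simp only: of_real_eq_iff)
qed

lemma mcol_norm:
  assumes "unitary_mat I V" "k \<in> I"
  shows "(\<Sum>i\<in>I. (cmod (mcol V k i))\<^sup>2) = 1"
  using inner_on_mcol[OF assms assms(2)] inner_on_self[of I "mcol V k"] by (metis of_real_eq_1_iff)

lemma quad_form_decomposition:
  assumes A: "\<And>i j. i \<in> I \<Longrightarrow> j \<in> I \<Longrightarrow> A i j = (\<Sum>k\<in>I. complex_of_real (p k) * V i k * cnj (V j k))"
  shows "quad_form I A v = (\<Sum>k\<in>I. p k * (cmod (inner_on I (mcol V k) v))\<^sup>2)"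
proof -
  have "(\<Sum>i\<in>I. \<Sum>j\<in>I. cnj (v i) * A i j * v j)
     = (\<Sum>i\<in>I. \<Sum>j\<in>I. \<Sum>k\<in>I. p k * (cnj (v i) * V i k * (cnj (V j k) * v j)))"
    by (intro sum.cong refl) (simp add: A sum_distrib_left sum_distrib_right mult_ac)
  also have "\<dots> = (\<Sum>i\<in>I. \<Sum>k\<in>I. \<Sum>j\<in>I. p k * (cnj (v i) * V i k * (cnj (V j k) * v j)))"
    by (rule sum.cong[OF refl], rule sum.swap)
  also have "\<dots> = (\<Sum>k\<in>I. \<Sum>i\<in>I. \<Sum>j\<in>I. p k * (cnj (v i) * V i k * (cnj (V j k) * v j)))"
    by (rule sum.swap)
  also have "\<dots> = (\<Sum>k\<in>I. p k * (inner_on I v (mcol V k) * inner_on I (mcol V k) v))"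
    unfolding inner_on_def sum_product mcol_def by (intro sum.cong refl) (simp add: sum_distrib_left)
  also have "\<dots> = of_real (\<Sum>k\<in>I. p k * (cmod (inner_on I (mcol V k) v))\<^sup>2)"
    unfolding of_real_sum using inner_on_commute[of I v]
    by (intro sum.cong refl) (simp add: complex_norm_square mult.commute flip: of_real_power)
  finally show ?thesis unfolding quad_form_def by simp
qed

lemma quad_form_spectral:
  assumes "spectral I A V p"
  shows "quad_form I A v = (\<Sum>k\<in>I. p k * (cmod (inner_on I (mcol V k) v))\<^sup>2)"
  using assms by (intro quad_form_decomposition) (simp add: spectral_def)

lemma trace_spectral:
  assumes S: "spectral I A V p"
  shows "(\<Sum>i\<in>I. A i i) = of_real (\<Sum>k\<in>I. p k)"
proof -
  have "(\<Sum>i\<in>I. A i i) = (\<Sum>i\<in>I. \<Sum>k\<in>I. p k * (cnj (V i k) * V i k))"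
    using S unfolding spectral_def by (intro sum.cong refl) (simp add: mult_ac)
  also have "\<dots> = (\<Sum>k\<in>I. p k * (\<Sum>i\<in>I. cnj (V i k) * V i k))"
    by (subst sum.swap) (simp add: sum_distrib_left)
  also have "\<dots> = (\<Sum>k\<in>I. p k)"
    using S unfolding spectral_def unitary_mat_def by simp
  finally show ?thesis by simp
qed

lemma spectral_exists:
  assumes "finite I" "hermitian_mat I A" and pos: "\<And>v. 0 \<le> quad_form I A v"
  shows "\<exists>V p. spectral I A V p"
proof -
  obtain V :: "'a \<Rightarrow> 'a \<Rightarrow> complex" and p :: "'a \<Rightarrow> real" where V: "unitary_mat I V"
    and A: "\<And>i j. i \<in> I \<Longrightarrow> j \<in> I \<Longrightarrow> A i j = (\<Sum>k\<in>I. p k * V i k * cnj (V j k))"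
    using spectral_decomposition[OF assms(1,2)] by blast
  have "0 \<le> p k" if k: "k \<in> I" for k
  proof -
    have quad: "quad_form I A v = (\<Sum>l\<in>I. p l * (cmod (inner_on I (mcol V l) v))\<^sup>2)" for v
      by (intro quad_form_decomposition A)
    have "quad_form I A (mcol V k) = (\<Sum>l\<in>I. if l = k then p l else 0)"
      unfolding quad using k by (intro sum.cong refl) (simp add: inner_on_mcol[OF V])
    then show ?thesis using pos[of "mcol V k"] k assms(1) by simp
  qed
  then show ?thesis using V A unfolding spectral_def by blast
qed

text \<open>The trace of \<open>sqrt A sqrt B\<close>, expanded in the eigenbases of the two
  matrices.\<close>

definition overlap :: "'i set \<Rightarrow> ('i \<Rightarrow> 'i \<Rightarrow> complex) \<Rightarrow> ('i \<Rightarrow> real) \<Rightarrow> ('i \<Rightarrow> 'i \<Rightarrow> complex) \<Rightarrow> ('i \<Rightarrow> real) \<Rightarrow> real" where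
  "overlap I V p W q = (\<Sum>j\<in>I. \<Sum>k\<in>I. (cmod (inner_on I (mcol V j) (mcol W k)))\<^sup>2 * sqrt (p j * q k))"

text \<open>The squared overlaps between two orthonormal bases form a doubly stochastic matrix, by
  Parseval in either basis.\<close>

lemma cross_sums:
  assumes I: "finite I" and V: "unitary_mat I V" and W: "unitary_mat I W"
  shows "j \<in> I \<Longrightarrow> (\<Sum>k\<in>I. (cmod (inner_on I (mcol V j) (mcol W k)))\<^sup>2) = 1"
    and "k \<in> I \<Longrightarrow> (\<Sum>j\<in>I. (cmod (inner_on I (mcol V j) (mcol W k)))\<^sup>2) = 1"
proof -
  show "j \<in> I \<Longrightarrow> (\<Sum>k\<in>I. (cmod (inner_on I (mcol V j) (mcol W k)))\<^sup>2) = 1"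
    using parseval_norm[OF I W, of "mcol V j"] mcol_norm[OF V, of j]
    by (subst inner_on_commute) simp
  show "k \<in> I \<Longrightarrow> (\<Sum>j\<in>I. (cmod (inner_on I (mcol V j) (mcol W k)))\<^sup>2) = 1"
    using parseval_norm[OF I V, of "mcol W k"] mcol_norm[OF W, of k] by simp
qed

text \<open>
  Both sides are sums over the pairs of eigenvectors, weighted by their squared overlaps, so the
  inequality reduces to \<open>ln x \<le> x - 1\<close> for \<open>x = sqrt (q / p)\<close>.
\<close>

lemma relative_entropy_ge_overlap:
  assumes I: "finite I" and A: "spectral I A V p" and B: "spectral I B W q"
    and p1: "(\<Sum>k\<in>I. p k) = 1"
    and supp: "\<And>k. k \<in> I \<Longrightarrow> q k = 0 \<Longrightarrow> quad_form I A (mcol W k) = 0"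
  shows "2 * (1 - overlap I V p W q) \<le>
    (\<Sum>j\<in>I. p j * ln (p j)) - (\<Sum>k\<in>I. quad_form I A (mcol W k) * ln (q k))"
proof -
  define w where "w = (\<lambda>j k. (cmod (inner_on I (mcol V j) (mcol W k)))\<^sup>2)"
  have VW: "unitary_mat I V" "unitary_mat I W" using A B by (auto simp: spectral_def)
  have p0: "0 \<le> p k" and q0: "0 \<le> q k" if "k \<in> I" for k
    using A B that by (auto simp: spectral_def)
  have w1: "(\<Sum>k\<in>I. w j k) = 1" if "j \<in> I" for j
    unfolding w_def by (rule cross_sums(1)[OF I VW that])
  have qf: "quad_form I A (mcol W k) = (\<Sum>j\<in>I. p j * w j k)" for k
    unfolding quad_form_spectral[OF A] w_def ..
  \<comment> \<open>These products vanish wherever \<open>q k = 0\<close>, so the value of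
    \<open>ln\<close> at 0 never enters.\<close>
  have pw: "p j * w j k = 0" if "j \<in> I" "k \<in> I" "q k = 0" for j k
    using supp[OF that(2,3)] that(1) p0 unfolding qf
    by (subst (asm) sum_nonneg_eq_0_iff[OF I]) (auto simp: w_def)
  have summand: "2 * (w j k * p j - w j k * sqrt (p j * q k)) \<le> w j k * p j * ln (p j) - p j * w j k * ln (q k)"
    if jk: "j \<in> I" "k \<in> I" for j k
  proof (cases "p j * w j k = 0")
    case True
    then show ?thesis using q0[OF jk(2)] by (auto simp: w_def)
  next
    case False
    then have pq: "p j > 0" "q k > 0" using p0[OF jk(1)] q0[OF jk(2)] pw[OF jk] by (auto simp: less_le)
    have "ln (sqrt (q k / p j)) \<le> sqrt (q k / p j) - 1" using pq by (intro ln_le_minus_one) simp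
    then have "ln (q k) - ln (p j) \<le> 2 * (sqrt (q k / p j) - 1)"
      using pq by (simp add: ln_sqrt ln_div)
    then have "p j * (2 * (1 - sqrt (q k / p j))) \<le> p j * (ln (p j) - ln (q k))"
      using pq by (intro mult_left_mono) auto
    moreover have "p j * sqrt (q k / p j) = sqrt (p j * q k)"
      using pq by (simp add: real_sqrt_mult real_sqrt_divide field_simps)
    ultimately have "2 * (p j - sqrt (p j * q k)) \<le> p j * (ln (p j) - ln (q k))"
      by (simp add: algebra_simps)
    then have "w j k * (2 * (p j - sqrt (p j * q k))) \<le> w j k * (p j * (ln (p j) - ln (q k)))"
      by (intro mult_left_mono) (simp_all add: w_def)
    then show ?thesis by (simp add: algebra_simps)
  qed
  have s1: "(\<Sum>j\<in>I. \<Sum>k\<in>I. w j k * c j) = (\<Sum>j\<in>I. c j)" for c :: "'a \<Rightarrow> real"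
    using w1 by (simp flip: sum_distrib_right)
  have ov: "overlap I V p W q = (\<Sum>j\<in>I. \<Sum>k\<in>I. w j k * sqrt (p j * q k))"
    unfolding overlap_def w_def ..
  have "2 * (1 - overlap I V p W q) = (\<Sum>j\<in>I. \<Sum>k\<in>I. 2 * (w j k * p j - w j k * sqrt (p j * q k)))"
    unfolding sum_distrib_left[symmetric] sum_subtractf s1 p1 ov ..
  also have "\<dots> \<le> (\<Sum>j\<in>I. \<Sum>k\<in>I. w j k * p j * ln (p j) - p j * w j k * ln (q k))"
    by (intro sum_mono summand)
  also have "\<dots> = (\<Sum>j\<in>I. p j * ln (p j)) - (\<Sum>j\<in>I. \<Sum>k\<in>I. p j * w j k * ln (q k))"
    unfolding sum_subtractf mult.assoc s1 ..
  also have "(\<Sum>j\<in>I. \<Sum>k\<in>I. p j * w j k * ln (q k)) = (\<Sum>k\<in>I. quad_form I A (mcol W k) * ln (q k))"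
    unfolding qf sum_distrib_right by (rule sum.swap)
  finally show ?thesis .
qed

text \<open>The inequality of the arithmetic and geometric means, averaged with doubly stochastic
  weights.\<close>

lemma overlap_le_1:
  assumes I: "finite I" and A: "spectral I A V p" and B: "spectral I B W q"
    and p1: "(\<Sum>k\<in>I. p k) = 1" and q1: "(\<Sum>k\<in>I. q k) = 1"
  shows "overlap I V p W q \<le> 1"
proof -
  define w where "w = (\<lambda>j k. (cmod (inner_on I (mcol V j) (mcol W k)))\<^sup>2)"
  have VW: "unitary_mat I V" "unitary_mat I W" using A B by (auto simp: spectral_def)
  have "overlap I V p W q \<le> (\<Sum>j\<in>I. \<Sum>k\<in>I. w j k * ((p j + q k) / 2))"
    unfolding overlap_def w_def using A B
    by (intro sum_mono mult_left_mono arith_geo_mean_sqrt) (auto simp: spectral_def)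
  also have "\<dots> = ((\<Sum>j\<in>I. \<Sum>k\<in>I. p j * w j k) + (\<Sum>k\<in>I. \<Sum>j\<in>I. q k * w j k)) / 2"
    by (subst (3) sum.swap) (simp add: sum.distrib algebra_simps add_divide_distrib flip: sum_divide_distrib)
  also have "\<dots> = ((\<Sum>j\<in>I. p j * (\<Sum>k\<in>I. w j k)) + (\<Sum>k\<in>I. q k * (\<Sum>j\<in>I. w j k))) / 2"
    by (simp add: sum_distrib_left)
  also have "\<dots> = ((\<Sum>j\<in>I. p j) + (\<Sum>k\<in>I. q k)) / 2"
    unfolding w_def using cross_sums[OF I VW] by simp
  finally show ?thesis using p1 q1 by simp
qed

lemma overlap_nonneg:
  assumes "spectral I A V p" "spectral I B W q"
  shows "0 \<le> overlap I V p W q"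
  using assms unfolding overlap_def spectral_def by (intro sum_nonneg mult_nonneg_nonneg) auto

text \<open>
  A substitute for the operator monotonicity of the logarithm: \<open>A \<le> K B\<close> gives
  \<open>p\<^sub>j \<langle>a\<^sub>j, B\<^sup>-\<^sup>1 a\<^sub>j\<rangle> \<le> K\<close> for each eigenvector \<open>a\<^sub>j\<close> of \<open>A\<close>, after which scalar concavity suffices.
\<close>

lemma relative_entropy_le_ln:
  assumes I: "finite I" and A: "spectral I A V p" and B: "spectral I B W q"
    and p1: "(\<Sum>k\<in>I. p k) = 1" and K: "K > 0"
    and le: "\<And>v. quad_form I A v \<le> K * quad_form I B v"
  shows "(\<Sum>j\<in>I. p j * ln (p j)) - (\<Sum>k\<in>I. quad_form I A (mcol W k) * ln (q k)) \<le> ln K"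
proof -
  define ov where "ov = (\<lambda>j k. inner_on I (mcol V j) (mcol W k))"
  define w where "w = (\<lambda>j k. (cmod (ov j k))\<^sup>2)"
  have VW: "unitary_mat I V" "unitary_mat I W" using A B by (auto simp: spectral_def)
  have p0: "0 \<le> p k" and q0: "0 \<le> q k" if "k \<in> I" for k
    using A B that by (auto simp: spectral_def)
  have w1: "(\<Sum>k\<in>I. w j k) = 1" if "j \<in> I" for j
    unfolding w_def ov_def by (rule cross_sums(1)[OF I VW that])
  have qf: "quad_form I A (mcol W k) = (\<Sum>j\<in>I. p j * w j k)" for k
    unfolding quad_form_spectral[OF A] w_def ov_def ..
  have "quad_form I B (mcol W k) = q k" if "k \<in> I" for k
  proof -
    have "quad_form I B (mcol W k) = (\<Sum>j\<in>I. if j = k then q j else 0)"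
      unfolding quad_form_spectral[OF B] using that
      by (intro sum.cong refl) (simp add: inner_on_mcol[OF VW(2)])
    then show ?thesis using that I by simp
  qed
  then have supp: "(\<Sum>j\<in>I. p j * w j k) = 0" if "k \<in> I" "q k = 0" for k
    using le[of "mcol W k"] that p0 sum_nonneg[of I "\<lambda>j. p j * w j k"] unfolding qf w_def by simp
  have pw: "p j * w j k = 0" if "j \<in> I" "k \<in> I" "q k = 0" for j k
    using supp[OF that(2,3)] that(1) p0
    by (subst (asm) sum_nonneg_eq_0_iff[OF I]) (auto simp: w_def)
  have bound: "p j * (\<Sum>k\<in>I. w j k * inverse (q k)) \<le> K" if j: "j \<in> I" for j
  proof -
    define T where "T = (\<Sum>k\<in>I. w j k * inverse (q k))"
    have T0: "0 \<le> T" unfolding T_def w_def using q0 by (intro sum_nonneg) simp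
    \<comment> \<open>This is \<open>B^-1\<close> applied to eigenvector \<open>a_j\<close> of
      \<open>A\<close>, with \<open>inverse 0 = 0\<close> off the support of \<open>B\<close>. Then
      \<open><a_j, v> = <v, B v> = T\<close>, and testing the order relation on \<open>v\<close>
      gives \<open>p j * T^2 \<le> K * T\<close>.\<close>
    define v where "v = (\<lambda>i. \<Sum>k\<in>I. inverse (q k) * cnj (ov j k) * W i k)"
    have inner_v: "inner_on I f v = (\<Sum>k\<in>I. inverse (q k) * cnj (ov j k) * inner_on I f (mcol W k))" for f
      unfolding v_def inner_on_def sum_distrib_left mcol_def
      by (subst sum.swap) (simp add: mult_ac)
    have Wv: "inner_on I (mcol W k) v = inverse (q k) * cnj (ov j k)" if "k \<in> I" for k
      unfolding inner_v using I that by (simp add: inner_on_mcol[OF VW(2)] if_distrib cong: if_cong)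
    have Vv: "inner_on I (mcol V j) v = of_real T"
      unfolding inner_v T_def of_real_sum w_def ov_def
      by (intro sum.cong refl) (simp add: complex_norm_square mult_ac flip: of_real_power)
    have "quad_form I B v = T"
      unfolding quad_form_spectral[OF B] T_def
    proof (intro sum.cong refl)
      fix k assume "k \<in> I"
      then show "q k * (cmod (inner_on I (mcol W k) v))\<^sup>2 = w j k * inverse (q k)"
        using q0[of k] by (cases "q k = 0")
          (simp_all add: Wv w_def norm_mult norm_inverse power_mult_distrib power2_eq_square)
    qed
    moreover have "p j * T\<^sup>2 \<le> quad_form I A v"
    proof -
      have "p j * (cmod (inner_on I (mcol V j) v))\<^sup>2 \<le> quad_form I A v"
        unfolding quad_form_spectral[OF A] using j p0
        by (intro member_le_sum[of j I "\<lambda>k. p k * (cmod (inner_on I (mcol V k) v))\<^sup>2"]) (auto simp: I)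
      then show ?thesis using T0 by (simp add: Vv)
    qed
    ultimately have "p j * T\<^sup>2 \<le> K * T" using le[of v] by simp
    then have "T * (p j * T) \<le> T * K" by (simp add: power2_eq_square mult_ac)
    then have "p j * T \<le> K" using T0 K by (cases "T = 0") auto
    then show ?thesis by (simp add: T_def)
  qed
  have row: "(\<Sum>k\<in>I. w j k * p j * ln (p j) - p j * w j k * ln (q k)) \<le> p j * ln K" if j: "j \<in> I" for j
  proof (cases "p j = 0")
    case False
    then have pj: "p j > 0" using p0[OF j] by simp
    have "w j k * p j * ln (p j) - p j * w j k * ln (q k) \<le>
       p j * (w j k * (ln K - 1) + p j / K * (w j k * inverse (q k)))" if k: "k \<in> I" for k
    proof (cases "w j k = 0")
      case False
      then have qk: "q k > 0" using pw[OF j k] pj q0[OF k] by (auto simp: less_le)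
      \<comment> \<open>The tangent of \<open>ln\<close> at 1. After summation over \<open>k\<close>
        with weights \<open>w j k\<close>, the last term is at most 1 by \<open>bound\<close> and
        cancels the -1.\<close>
      have "ln (p j / q k / K) \<le> p j / q k / K - 1" using pj qk K by (intro ln_le_minus_one) simp
      then have "ln (p j) - ln (q k) \<le> ln K - 1 + p j / K * inverse (q k)"
        using pj qk K by (simp add: ln_div ln_mult field_simps)
      then have "p j * w j k * (ln (p j) - ln (q k)) \<le> p j * w j k * (ln K - 1 + p j / K * inverse (q k))"
        using pj by (intro mult_left_mono) (simp_all add: w_def)
      then show ?thesis by (simp add: algebra_simps)
    qed simp
    then have "(\<Sum>k\<in>I. w j k * p j * ln (p j) - p j * w j k * ln (q k)) \<le>
      (\<Sum>k\<in>I. p j * (w j k * (ln K - 1) + p j / K * (w j k * inverse (q k))))"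
      by (rule sum_mono)
    also have "\<dots> = p j * ((\<Sum>k\<in>I. w j k) * (ln K - 1) + (p j * (\<Sum>k\<in>I. w j k * inverse (q k))) / K)"
      by (simp add: sum_distrib_left sum_distrib_right sum.distrib sum_subtractf sum_divide_distrib algebra_simps)
    also have "\<dots> \<le> p j * ln K"
      unfolding w1[OF j] using bound[OF j] K pj by (intro mult_left_mono) (simp_all add: divide_le_eq)
    finally show ?thesis .
  qed simp
  have "(\<Sum>j\<in>I. \<Sum>k\<in>I. w j k * p j * ln (p j) - p j * w j k * ln (q k)) \<le> (\<Sum>j\<in>I. p j * ln K)"
    by (intro sum_mono row)
  also have "\<dots> = ln K" using p1 by (simp flip: sum_distrib_right)
  also have "(\<Sum>j\<in>I. \<Sum>k\<in>I. w j k * p j * ln (p j) - p j * w j k * ln (q k)) =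
     (\<Sum>j\<in>I. p j * ln (p j)) - (\<Sum>j\<in>I. \<Sum>k\<in>I. p j * w j k * ln (q k))"
    unfolding sum_subtractf using w1 by (simp add: mult.assoc flip: sum_distrib_right)
  also have "(\<Sum>j\<in>I. \<Sum>k\<in>I. p j * w j k * ln (q k)) = (\<Sum>k\<in>I. quad_form I A (mcol W k) * ln (q k))"
    unfolding qf sum_distrib_right by (rule sum.swap)
  finally show ?thesis .
qed

section \<open>Quadratic forms of averages and of Gram matrices\<close>

lemma quad_form_cong:
  "(\<And>i j. i \<in> I \<Longrightarrow> j \<in> I \<Longrightarrow> A i j = B i j) \<Longrightarrow> quad_form I A v = quad_form I B v"
  unfolding quad_form_def by (intro arg_cong[where f = Re] sum.cong refl) simp

lemma quad_form_sum:
  "quad_form I (\<lambda>i j. \<Sum>x\<in>X. complex_of_real (c x) * A x i j) v = (\<Sum>x\<in>X. c x * quad_form I (A x) v)"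
proof -
  have "(\<Sum>i\<in>I. \<Sum>j\<in>I. cnj (v i) * (\<Sum>x\<in>X. complex_of_real (c x) * A x i j) * v j)
      = (\<Sum>i\<in>I. \<Sum>j\<in>I. \<Sum>x\<in>X. complex_of_real (c x) * (cnj (v i) * A x i j * v j))"
    by (intro sum.cong refl) (simp add: sum_distrib_left sum_distrib_right mult_ac)
  also have "\<dots> = (\<Sum>i\<in>I. \<Sum>x\<in>X. \<Sum>j\<in>I. complex_of_real (c x) * (cnj (v i) * A x i j * v j))"
    by (rule sum.cong[OF refl], rule sum.swap)
  also have "\<dots> = (\<Sum>x\<in>X. \<Sum>i\<in>I. \<Sum>j\<in>I. complex_of_real (c x) * (cnj (v i) * A x i j * v j))"
    by (rule sum.swap)
  also have "\<dots> = (\<Sum>x\<in>X. complex_of_real (c x) * (\<Sum>i\<in>I. \<Sum>j\<in>I. cnj (v i) * A x i j * v j))"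
    by (simp add: sum_distrib_left)
  finally show ?thesis unfolding quad_form_def by (simp del: complex_scaleR)
qed

lemma quad_form_eigenvector:
  assumes "finite I" "spectral I A V p" "k \<in> I"
  shows "quad_form I A (mcol V k) = p k"
proof -
  have "quad_form I A (mcol V k) = (\<Sum>j\<in>I. if j = k then p j else 0)"
    unfolding quad_form_spectral[OF assms(2)] using assms(2,3)
    by (intro sum.cong refl) (simp add: inner_on_mcol spectral_def)
  then show ?thesis using assms by simp
qed

lemma quad_form_nonneg: "spectral I A V p \<Longrightarrow> 0 \<le> quad_form I A v"
  by (simp add: quad_form_spectral) (auto simp: spectral_def intro!: sum_nonneg)

text \<open>If \<open>F i e\<close> is the amplitude of the joint basis state \<open>(i, e)\<close>,
  this is the density matrix that remains after tracing out \<open>E\<close>.\<close>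

definition gram :: "'e set \<Rightarrow> ('i \<Rightarrow> 'e \<Rightarrow> complex) \<Rightarrow> 'i \<Rightarrow> 'i \<Rightarrow> complex" where
  "gram E F i j = (\<Sum>e\<in>E. F i e * cnj (F j e))"

lemma quad_form_gram:
  "quad_form I (gram E F) v = (\<Sum>e\<in>E. (cmod (\<Sum>i\<in>I. cnj (v i) * F i e))\<^sup>2)"
proof -
  have "(\<Sum>i\<in>I. \<Sum>j\<in>I. cnj (v i) * gram E F i j * v j)
      = (\<Sum>i\<in>I. \<Sum>j\<in>I. \<Sum>e\<in>E. (cnj (v i) * F i e) * cnj (cnj (v j) * F j e))"
    unfolding gram_def by (intro sum.cong refl) (simp add: sum_distrib_left sum_distrib_right mult_ac)
  also have "\<dots> = (\<Sum>i\<in>I. \<Sum>e\<in>E. \<Sum>j\<in>I. (cnj (v i) * F i e) * cnj (cnj (v j) * F j e))"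
    by (rule sum.cong[OF refl], rule sum.swap)
  also have "\<dots> = (\<Sum>e\<in>E. \<Sum>i\<in>I. \<Sum>j\<in>I. (cnj (v i) * F i e) * cnj (cnj (v j) * F j e))"
    by (rule sum.swap)
  also have "\<dots> = (\<Sum>e\<in>E. of_real ((cmod (\<Sum>i\<in>I. cnj (v i) * F i e))\<^sup>2))"
    unfolding sum_product[symmetric] cnj_sum[symmetric]
    by (simp add: complex_norm_square flip: of_real_power)
  finally show ?thesis unfolding quad_form_def by (simp del: of_real_power)
qed

lemma spectral_gram:
  assumes "finite I"
  shows "\<exists>V p. spectral I (gram E F) V p"
proof (rule spectral_exists[OF assms])
  show "hermitian_mat I (gram E F)"
    unfolding hermitian_mat_def gram_def by (simp add: mult.commute)
  show "0 \<le> quad_form I (gram E F) v" for v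
    unfolding quad_form_gram by (intro sum_nonneg) simp
qed

section \<open>Words with product weights, and the chain rule\<close>

definition words :: "'x set \<Rightarrow> nat \<Rightarrow> 'x list set" where
  "words X k = {ws. set ws \<subseteq> X \<and> length ws = k}"

definition wt :: "('x \<Rightarrow> real) \<Rightarrow> 'x list \<Rightarrow> real" where
  "wt \<mu> ws = prod_list (map \<mu> ws)"

lemma finite_words [simp]: "finite X \<Longrightarrow> finite (words X k)"
  unfolding words_def by (rule finite_lists_length_eq)

lemma words_0 [simp]: "words X 0 = {[]}"
  by (auto simp: words_def)

lemma wt_simps [simp]: "wt \<mu> [] = 1" "wt \<mu> (x # ws) = \<mu> x * wt \<mu> ws" "wt \<mu> (us @ ws) = wt \<mu> us * wt \<mu> ws"
  by (simp_all add: wt_def)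

lemma wt_nonneg:
  assumes "\<And>x. x \<in> X \<Longrightarrow> 0 \<le> \<mu> x" "set ws \<subseteq> X"
  shows "0 \<le> wt \<mu> ws"
  using assms(2) by (induction ws) (auto simp: assms(1))

lemma sum_words_snoc:
  "(\<Sum>ws\<in>words X (Suc k). g ws) = (\<Sum>ws\<in>words X k. \<Sum>x\<in>X. g (ws @ [x]))"
proof -
  have "bij_betw (\<lambda>(ws, x). ws @ [x]) (words X k \<times> X) (words X (Suc k))"
    by (rule bij_betw_byWitness[where f' = "\<lambda>ws. (butlast ws, last ws)"])
      (auto simp: words_def length_Suc_conv_rev)
  then show ?thesis
    by (subst sum.reindex_bij_betw[symmetric]) (auto simp: sum.cartesian_product case_prod_unfold)
qed

lemma sum_words_append:
  "(\<Sum>ws\<in>words X (k + l). g ws) = (\<Sum>us\<in>words X k. \<Sum>vs\<in>words X l. g (us @ vs))"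
proof -
  have "bij_betw (\<lambda>(us, vs). us @ vs) (words X k \<times> words X l) (words X (k + l))"
    by (rule bij_betw_byWitness[where f' = "\<lambda>ws. (take k ws, drop k ws)"])
      (auto simp: words_def dest: in_set_takeD in_set_dropD)
  then show ?thesis
    by (subst sum.reindex_bij_betw[symmetric]) (auto simp: sum.cartesian_product case_prod_unfold)
qed

lemma sum_wt_words:
  assumes "(\<Sum>x\<in>X. \<mu> x) = 1"
  shows "(\<Sum>ws\<in>words X k. wt \<mu> ws) = 1"
  by (induction k) (simp_all add: sum_words_snoc assms flip: sum_distrib_left)

text \<open>
  The chain rule: along the martingale \<open>R\<close> of density matrices, the expected relative entropies
  between consecutive terms telescope to the one between the leaves and the root.
\<close>

lemma chain_rule_bound:
  fixes R :: "'x list \<Rightarrow> 'i \<Rightarrow> 'i \<Rightarrow> complex"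
  assumes I: "finite I" and X: "finite X"
    and \<mu>0: "\<And>x. x \<in> X \<Longrightarrow> 0 \<le> \<mu> x" and \<mu>1: "(\<Sum>x\<in>X. \<mu> x) = 1"
    and R: "\<And>ws. set ws \<subseteq> X \<Longrightarrow> length ws \<le> n \<Longrightarrow> spectral I (R ws) (V ws) (p ws)"
    and p1: "\<And>ws. set ws \<subseteq> X \<Longrightarrow> length ws \<le> n \<Longrightarrow> (\<Sum>k\<in>I. p ws k) = 1"
    and mart: "\<And>ws i j. set ws \<subseteq> X \<Longrightarrow> length ws < n \<Longrightarrow> i \<in> I \<Longrightarrow> j \<in> I \<Longrightarrow>
      R ws i j = (\<Sum>x\<in>X. complex_of_real (\<mu> x) * R (ws @ [x]) i j)"
    and T: "spectral I T W q" and q1: "(\<Sum>k\<in>I. q k) = 1" and K: "K > 0"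
    and leaf: "\<And>xs v. set xs \<subseteq> X \<Longrightarrow> length xs = n \<Longrightarrow> quad_form I (R xs) v \<le> K * quad_form I T v"
  shows "(\<Sum>i<n. \<Sum>ws\<in>words X i. wt \<mu> ws * (\<Sum>x\<in>X. \<mu> x *
      (2 * (1 - overlap I (V (ws @ [x])) (p (ws @ [x])) (V ws) (p ws))))) \<le> ln K"
proof -
  define h where "h = (\<lambda>ws. \<Sum>k\<in>I. p ws k * ln (p ws k))"
  have qmart: "quad_form I (R ws) v = (\<Sum>x\<in>X. \<mu> x * quad_form I (R (ws @ [x])) v)"
    if "set ws \<subseteq> X" "length ws < n" for ws v
    unfolding quad_form_sum[symmetric] by (intro quad_form_cong mart that)
  have root: "quad_form I (R []) v = (\<Sum>ws\<in>words X k. wt \<mu> ws * quad_form I (R ws) v)"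
    if "k \<le> n" for k v
    using that
  proof (induction k)
    case (Suc k)
    then have "quad_form I (R []) v = (\<Sum>ws\<in>words X k. wt \<mu> ws * quad_form I (R ws) v)" by simp
    also have "\<dots> = (\<Sum>ws\<in>words X k. wt \<mu> ws * (\<Sum>x\<in>X. \<mu> x * quad_form I (R (ws @ [x])) v))"
      using Suc.prems by (intro sum.cong refl arg_cong2[where f = "(*)"] qmart) (auto simp: words_def)
    finally show ?case by (simp add: sum_words_snoc sum_distrib_left mult.assoc)
  qed simp
  have step: "(\<Sum>x\<in>X. \<mu> x * (2 * (1 - overlap I (V (ws @ [x])) (p (ws @ [x])) (V ws) (p ws))))
      \<le> (\<Sum>x\<in>X. \<mu> x * h (ws @ [x])) - h ws" if ws: "set ws \<subseteq> X" "length ws < n" for ws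
  proof -
    define Q where "Q = (\<lambda>x k. quad_form I (R (ws @ [x])) (mcol (V ws) k))"
    have Rws: "spectral I (R ws) (V ws) (p ws)" using R ws by simp
    have Rx: "spectral I (R (ws @ [x])) (V (ws @ [x])) (p (ws @ [x]))"
      and px: "(\<Sum>k\<in>I. p (ws @ [x]) k) = 1" if "x \<in> X" for x
      using R[of "ws @ [x]"] p1[of "ws @ [x]"] ws that by auto
    \<comment> \<open>\<open>R ws\<close> is the average of its successors, so its eigenvalues
      average their diagonals in its eigenbasis; this is why the cross terms average to
      \<open>h ws\<close>.\<close>
    have pQ: "p ws k = (\<Sum>x\<in>X. \<mu> x * Q x k)" if "k \<in> I" for k
      using qmart[OF ws, of "mcol (V ws) k"] quad_form_eigenvector[OF I Rws that] by (simp add: Q_def)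
    have Q0: "0 \<le> Q x k" if "x \<in> X" for x k
      unfolding Q_def by (rule quad_form_nonneg[OF Rx[OF that]])
    have "\<mu> x * (2 * (1 - overlap I (V (ws @ [x])) (p (ws @ [x])) (V ws) (p ws)))
        \<le> \<mu> x * (h (ws @ [x]) - (\<Sum>k\<in>I. Q x k * ln (p ws k)))" if x: "x \<in> X" for x
    proof (cases "\<mu> x = 0")
      case False
      \<comment> \<open>A letter of positive weight contributes a state supported inside the support
        of the average, so its relative entropy is finite.\<close>
      have "Q x k = 0" if "k \<in> I" "p ws k = 0" for k
      proof -
        have "\<mu> x * Q x k = 0"
          using that pQ[OF that(1)] \<mu>0 Q0 x X by (simp add: sum_nonneg_eq_0_iff)
        then show ?thesis using False by simp
      qed
      then have "2 * (1 - overlap I (V (ws @ [x])) (p (ws @ [x])) (V ws) (p ws))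
        \<le> h (ws @ [x]) - (\<Sum>k\<in>I. Q x k * ln (p ws k))"
        unfolding h_def Q_def by (intro relative_entropy_ge_overlap[OF I Rx[OF x] Rws px[OF x]])
      then show ?thesis using \<mu>0[OF x] by (intro mult_left_mono)
    qed simp
    then have "(\<Sum>x\<in>X. \<mu> x * (2 * (1 - overlap I (V (ws @ [x])) (p (ws @ [x])) (V ws) (p ws))))
        \<le> (\<Sum>x\<in>X. \<mu> x * (h (ws @ [x]) - (\<Sum>k\<in>I. Q x k * ln (p ws k))))"
      by (rule sum_mono)
    also have "\<dots> = (\<Sum>x\<in>X. \<mu> x * h (ws @ [x])) - (\<Sum>x\<in>X. \<Sum>k\<in>I. \<mu> x * Q x k * ln (p ws k))"
      by (simp add: right_diff_distrib sum_subtractf sum_distrib_left mult.assoc)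
    also have "(\<Sum>x\<in>X. \<Sum>k\<in>I. \<mu> x * Q x k * ln (p ws k)) = h ws"
      unfolding h_def by (subst sum.swap) (simp add: pQ sum_distrib_right)
    finally show ?thesis .
  qed
  \<comment> \<open>Minus the expected entropy at level \<open>i\<close>; its increments dominate
    the single steps.\<close>
  define H where "H = (\<lambda>i. \<Sum>ws\<in>words X i. wt \<mu> ws * h ws)"
  have "(\<Sum>ws\<in>words X i. wt \<mu> ws * (\<Sum>x\<in>X. \<mu> x *
      (2 * (1 - overlap I (V (ws @ [x])) (p (ws @ [x])) (V ws) (p ws))))) \<le> H (Suc i) - H i" if "i < n" for i
  proof -
    have "(\<Sum>ws\<in>words X i. wt \<mu> ws * (\<Sum>x\<in>X. \<mu> x *
      (2 * (1 - overlap I (V (ws @ [x])) (p (ws @ [x])) (V ws) (p ws)))))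
      \<le> (\<Sum>ws\<in>words X i. wt \<mu> ws * ((\<Sum>x\<in>X. \<mu> x * h (ws @ [x])) - h ws))"
      using that by (intro sum_mono mult_left_mono step wt_nonneg[OF \<mu>0]) (auto simp: words_def)
    also have "\<dots> = H (Suc i) - H i"
      unfolding H_def sum_words_snoc
      by (simp add: right_diff_distrib sum_subtractf sum_distrib_left mult.assoc)
    finally show ?thesis .
  qed
  then have "(\<Sum>i<n. \<Sum>ws\<in>words X i. wt \<mu> ws * (\<Sum>x\<in>X. \<mu> x *
      (2 * (1 - overlap I (V (ws @ [x])) (p (ws @ [x])) (V ws) (p ws))))) \<le> (\<Sum>i<n. H (Suc i) - H i)"
    by (intro sum_mono) simp
  also have "\<dots> = H n - H 0" by (rule sum_lessThan_telescope)
  also have "\<dots> = H n - h []" by (simp add: H_def)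
  \<comment> \<open>The drop in entropy is the expected relative entropy of the leaves to
    \<open>T\<close> minus that of the root to \<open>T\<close>. The former is at most
    \<open>ln K\<close>, the latter nonnegative because overlaps are at most 1.\<close>
  also have "\<dots> \<le> ln K"
  proof -
    define Z where "Z = (\<lambda>ws. \<Sum>k\<in>I. quad_form I (R ws) (mcol W k) * ln (q k))"
    have "h xs - Z xs \<le> ln K" if "xs \<in> words X n" for xs
      unfolding h_def Z_def using that
      by (intro relative_entropy_le_ln[OF I R T p1 K leaf]) (auto simp: words_def)
    then have "(\<Sum>xs\<in>words X n. wt \<mu> xs * (h xs - Z xs)) \<le> (\<Sum>xs\<in>words X n. wt \<mu> xs * ln K)"
      by (intro sum_mono mult_left_mono wt_nonneg[OF \<mu>0]) (auto simp: words_def)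
    also have "\<dots> = ln K" by (simp add: sum_wt_words[OF \<mu>1] flip: sum_distrib_right)
    also have "(\<Sum>xs\<in>words X n. wt \<mu> xs * (h xs - Z xs)) = H n - (\<Sum>xs\<in>words X n. wt \<mu> xs * Z xs)"
      by (simp add: H_def right_diff_distrib sum_subtractf)
    also have "(\<Sum>xs\<in>words X n. wt \<mu> xs * Z xs) = Z []"
      unfolding Z_def root[OF order.refl] sum_distrib_left sum_distrib_right
      by (subst sum.swap) (simp add: mult.assoc)
    finally have 1: "H n - Z [] \<le> ln K" .
    have supp: "quad_form I (R []) (mcol W k) = 0" if "k \<in> I" "q k = 0" for k
    proof -
      have "quad_form I (R xs) (mcol W k) = 0" if "xs \<in> words X n" for xs
        using leaf[of xs "mcol W k"] quad_form_nonneg[OF R, of xs "mcol W k"] that \<open>q k = 0\<close>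
        by (simp add: quad_form_eigenvector[OF I T \<open>k \<in> I\<close>] words_def)
      then show ?thesis unfolding root[OF order.refl] by simp
    qed
    have R0: "spectral I (R []) (V []) (p [])" and p0: "(\<Sum>k\<in>I. p [] k) = 1" using R p1 by auto
    have "2 * (1 - overlap I (V []) (p []) W q) \<le> h [] - Z []"
      unfolding h_def Z_def by (rule relative_entropy_ge_overlap[OF I R0 T p0 supp])
    then show ?thesis using 1 overlap_le_1[OF I R0 T p0 q1] by simp
  qed
  finally show ?thesis .
qed

section \<open>Local operations on qubits\<close>

lemma sum_Pow_Un:
  assumes "H \<inter> S = {}"
  shows "(\<Sum>s\<in>Pow (H \<union> S). g s) = (\<Sum>h\<in>Pow H. \<Sum>s\<in>Pow S. g (h \<union> s))"
proof -
  have "bij_betw (\<lambda>(h, s). h \<union> s) (Pow H \<times> Pow S) (Pow (H \<union> S))"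
    using assms by (intro bij_betw_byWitness[where f' = "\<lambda>u. (u \<inter> H, u \<inter> S)"]) auto
  then show ?thesis
    by (subst sum.reindex_bij_betw[symmetric]) (auto simp: sum.cartesian_product case_prod_unfold)
qed

lemma sum_Pow_split:
  assumes "S \<subseteq> Q"
  shows "(\<Sum>u\<in>Pow Q. g u) = (\<Sum>e\<in>Pow (Q - S). \<Sum>s\<in>Pow S. g (s \<union> e))"
proof -
  have "S \<union> (Q - S) = Q" using assms by blast
  then have "(\<Sum>u\<in>Pow Q. g u) = (\<Sum>s\<in>Pow S. \<Sum>e\<in>Pow (Q - S). g (s \<union> e))"
    using sum_Pow_Un[of S "Q - S" g] by simp
  also have "\<dots> = (\<Sum>e\<in>Pow (Q - S). \<Sum>s\<in>Pow S. g (s \<union> e))" by (rule sum.swap)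
  finally show ?thesis .
qed

lemma apply_on_slice:
  assumes "s \<subseteq> S" "e \<inter> S = {}"
  shows "apply_on S U \<psi> (s \<union> e) = (\<Sum>r\<in>Pow S. U s r * \<psi> (r \<union> e))"
proof -
  have "(s \<union> e) \<inter> S = s" "(s \<union> e) - S = e" using assms by auto
  then show ?thesis by (simp add: apply_on_def)
qed

lemma apply_on_mult:
  "apply_on S U (apply_on S V \<psi>) = apply_on S (\<lambda>a b. \<Sum>c\<in>Pow S. U a c * V c b) \<psi>"
proof
  fix u
  have "apply_on S U (apply_on S V \<psi>) u =
      (\<Sum>c\<in>Pow S. U (u \<inter> S) c * (\<Sum>r\<in>Pow S. V c r * \<psi> (r \<union> (u - S))))"
    unfolding apply_on_def[of S U] by (intro sum.cong refl) (subst apply_on_slice, auto)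
  also have "\<dots> = (\<Sum>r\<in>Pow S. \<Sum>c\<in>Pow S. U (u \<inter> S) c * V c r * \<psi> (r \<union> (u - S)))"
    unfolding sum_distrib_left mult.assoc by (rule sum.swap)
  also have "\<dots> = apply_on S (\<lambda>a b. \<Sum>c\<in>Pow S. U a c * V c b) \<psi> u"
    by (simp add: apply_on_def sum_distrib_right)
  finally show "apply_on S U (apply_on S V \<psi>) u = apply_on S (\<lambda>a b. \<Sum>c\<in>Pow S. U a c * V c b) \<psi> u" .
qed

text \<open>A property of the map instead of the matrix: maps can be composed, commuted and regarded
  on larger registers without writing down tensor products of matrices.\<close>

definition local_unitary :: "nat set \<Rightarrow> (qstate \<Rightarrow> qstate) \<Rightarrow> bool" where
  "local_unitary H T \<longleftrightarrow> (\<exists>U. unitary_on H U \<and> T = apply_on H U)"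

lemma local_unitary_apply_on: "unitary_on H U \<Longrightarrow> local_unitary H (apply_on H U)"
  unfolding local_unitary_def by blast

lemma local_unitary_comp:
  assumes "finite H" "local_unitary H T" "local_unitary H T'"
  shows "local_unitary H (\<lambda>\<psi>. T (T' \<psi>))"
proof -
  obtain U V where UV: "unitary_on H U" "T = apply_on H U" "unitary_on H V" "T' = apply_on H V"
    using assms unfolding local_unitary_def by blast
  have "unitary_on H (\<lambda>a b. \<Sum>c\<in>Pow H. U a c * V c b)"
    using UV assms(1) unfolding unitary_on_iff by (intro unitary_mat_mult) auto
  moreover have "(\<lambda>\<psi>. T (T' \<psi>)) = apply_on H (\<lambda>a b. \<Sum>c\<in>Pow H. U a c * V c b)"
    by (simp add: UV apply_on_mult)
  ultimately show ?thesis unfolding local_unitary_def by blast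
qed

text \<open>The matrix is block diagonal, with one unitary block for each basis state of the control
  register \<open>S\<close>.\<close>

lemma local_unitary_controlled:
  assumes fin: "finite H" "finite S" and disj: "H \<inter> S = {}"
    and W: "\<And>z. z \<subseteq> S \<Longrightarrow> unitary_on H (W z)"
  shows "local_unitary (H \<union> S) (\<lambda>\<psi> u. apply_on H (W (u \<inter> S)) \<psi> u)"
proof -
  define U where "U = (\<lambda>a b. if a \<inter> S = b \<inter> S then W (a \<inter> S) (a \<inter> H) (b \<inter> H) else 0)"
  have parts: "(h \<union> z) \<inter> S = z" "(h \<union> z) \<inter> H = h" if "h \<subseteq> H" "z \<subseteq> S" for h z
    using that disj by auto
  have finP: "finite (Pow S)" using fin by simp
  have eq: "u = v \<longleftrightarrow> u \<inter> S = v \<inter> S \<and> u \<inter> H = v \<inter> H" if "u \<subseteq> H \<union> S" "v \<subseteq> H \<union> S" for u v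
    using that by blast
  have "(\<Sum>s\<in>Pow (H \<union> S). U u s * cnj (U v s)) = (if u = v then 1 else 0)"
    if uv: "u \<subseteq> H \<union> S" "v \<subseteq> H \<union> S" for u v
  proof -
    have "(\<Sum>s\<in>Pow (H \<union> S). U u s * cnj (U v s)) = (\<Sum>h\<in>Pow H. \<Sum>z\<in>Pow S. if u \<inter> S = z then
        (if u \<inter> S = v \<inter> S then W (u \<inter> S) (u \<inter> H) h * cnj (W (u \<inter> S) (v \<inter> H) h) else 0) else 0)"
      unfolding sum_Pow_Un[OF disj] by (intro sum.cong refl) (auto simp: U_def parts)
    also have "\<dots> = (if u \<inter> S = v \<inter> S then (\<Sum>h\<in>Pow H. W (u \<inter> S) (u \<inter> H) h * cnj (W (u \<inter> S) (v \<inter> H) h)) else 0)"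
      using finP by simp
    also have "(\<Sum>h\<in>Pow H. W (u \<inter> S) (u \<inter> H) h * cnj (W (u \<inter> S) (v \<inter> H) h)) = (if u \<inter> H = v \<inter> H then 1 else 0)"
      using W[of "u \<inter> S"] unfolding unitary_on_def by blast
    finally show ?thesis by (simp add: eq[OF uv])
  qed
  moreover have "(\<Sum>s\<in>Pow (H \<union> S). cnj (U s u) * U s v) = (if u = v then 1 else 0)"
    if uv: "u \<subseteq> H \<union> S" "v \<subseteq> H \<union> S" for u v
  proof -
    have "(\<Sum>s\<in>Pow (H \<union> S). cnj (U s u) * U s v) = (\<Sum>h\<in>Pow H. \<Sum>z\<in>Pow S. if u \<inter> S = z then
        (if u \<inter> S = v \<inter> S then cnj (W (u \<inter> S) h (u \<inter> H)) * W (u \<inter> S) h (v \<inter> H) else 0) else 0)"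
      unfolding sum_Pow_Un[OF disj] by (intro sum.cong refl) (auto simp: U_def parts)
    also have "\<dots> = (if u \<inter> S = v \<inter> S then (\<Sum>h\<in>Pow H. cnj (W (u \<inter> S) h (u \<inter> H)) * W (u \<inter> S) h (v \<inter> H)) else 0)"
      using finP by simp
    also have "(\<Sum>h\<in>Pow H. cnj (W (u \<inter> S) h (u \<inter> H)) * W (u \<inter> S) h (v \<inter> H)) = (if u \<inter> H = v \<inter> H then 1 else 0)"
      using W[of "u \<inter> S"] unfolding unitary_on_def by blast
    finally show ?thesis by (simp add: eq[OF uv])
  qed
  ultimately have "unitary_on (H \<union> S) U" unfolding unitary_on_def by blast
  moreover have "apply_on (H \<union> S) U \<psi> u = apply_on H (W (u \<inter> S)) \<psi> u" for \<psi> u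
  proof -
    have e: "(u \<inter> S) \<union> (u - (H \<union> S)) = u - H" using disj by blast
    have "apply_on (H \<union> S) U \<psi> u = (\<Sum>h\<in>Pow H. \<Sum>z\<in>Pow S. if u \<inter> S = z then
        W (u \<inter> S) (u \<inter> H) h * \<psi> (h \<union> ((u \<inter> S) \<union> (u - (H \<union> S)))) else 0)"
    proof -
      have "u \<inter> (H \<union> S) \<inter> S = u \<inter> S" "u \<inter> (H \<union> S) \<inter> H = u \<inter> H" by auto
      then show ?thesis
        unfolding apply_on_def sum_Pow_Un[OF disj]
        by (intro sum.cong refl) (auto simp: U_def parts Un_assoc)
    qed
    also have "\<dots> = (\<Sum>h\<in>Pow H. W (u \<inter> S) (u \<inter> H) h * \<psi> (h \<union> (u - H)))"
      unfolding e using finP by simp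
    finally show ?thesis by (simp add: apply_on_def)
  qed
  then have "(\<lambda>\<psi> u. apply_on H (W (u \<inter> S)) \<psi> u) = apply_on (H \<union> S) U" by (intro ext) simp
  ultimately show ?thesis unfolding local_unitary_def by blast
qed

text \<open>Control by the additional qubits with a constant family is the same as tensoring with
  the identity.\<close>

lemma local_unitary_mono:
  assumes "local_unitary H T" "H \<subseteq> H'" "finite H'"
  shows "local_unitary H' T"
proof -
  obtain U where U: "unitary_on H U" "T = apply_on H U"
    using assms unfolding local_unitary_def by blast
  have "local_unitary (H \<union> (H' - H)) (\<lambda>\<psi> u. apply_on H U \<psi> u)"
    using U assms finite_subset by (intro local_unitary_controlled[where W = "\<lambda>_. U"]) auto
  moreover have "H \<union> (H' - H) = H'" using assms by blast
  ultimately show ?thesis using U by simp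
qed

lemma local_unitary_inner:
  assumes "local_unitary H T" "H \<subseteq> Q" "finite Q"
  shows "inner_on (Pow Q) (T \<psi>) (T \<phi>) = inner_on (Pow Q) \<psi> \<phi>"
proof -
  obtain U where U: "unitary_mat (Pow H) U" "T = apply_on H U"
    using assms unfolding local_unitary_def unitary_on_iff by blast
  have finH: "finite (Pow H)" using assms finite_subset by auto
  have slice: "inner_on (Pow H) (\<lambda>s. T \<psi> (s \<union> e)) (\<lambda>s. T \<phi> (s \<union> e)) =
      inner_on (Pow H) (\<lambda>s. \<psi> (s \<union> e)) (\<lambda>s. \<phi> (s \<union> e))" if "e \<subseteq> Q - H" for e
  proof -
    have "e \<inter> H = {}" using that by blast
    then have "inner_on (Pow H) (\<lambda>s. T \<psi> (s \<union> e)) (\<lambda>s. T \<phi> (s \<union> e)) =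
      inner_on (Pow H) (\<lambda>s. \<Sum>r\<in>Pow H. U s r * \<psi> (r \<union> e)) (\<lambda>s. \<Sum>r\<in>Pow H. U s r * \<phi> (r \<union> e))"
      unfolding U(2) by (intro inner_on_cong) (simp_all add: apply_on_slice)
    also have "\<dots> = inner_on (Pow H) (\<lambda>s. \<psi> (s \<union> e)) (\<lambda>s. \<phi> (s \<union> e))"
      by (rule unitary_mat_inner[OF finH U(1)])
    finally show ?thesis .
  qed
  show ?thesis
    unfolding inner_on_def sum_Pow_split[OF assms(2)]
    by (rule sum.cong[OF refl]) (use slice in \<open>auto simp: inner_on_def\<close>)
qed

text \<open>For fixed \<open>u\<close> and \<open>v\<close> the part of the trace over
  \<open>H\<close> is an inner product, which a unitary on \<open>H\<close> preserves: operations on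
  traced-out qubits are invisible.\<close>

lemma local_unitary_reduced_density:
  assumes "local_unitary H T" "H \<subseteq> Q" "finite Q" "H \<inter> S = {}"
  shows "reduced_density Q S (T \<psi>) = reduced_density Q S \<psi>"
proof -
  obtain U where U: "unitary_mat (Pow H) U" "T = apply_on H U"
    using assms unfolding local_unitary_def unitary_on_iff by blast
  have finH: "finite (Pow H)" using assms finite_subset by auto
  have sub: "H \<subseteq> Q - S" using assms by blast
  have "(\<Sum>e\<in>Pow (Q - S). T \<psi> (u \<union> e) * cnj (T \<psi> (v \<union> e))) =
      (\<Sum>e\<in>Pow (Q - S). \<psi> (u \<union> e) * cnj (\<psi> (v \<union> e)))" if uv: "u \<subseteq> S" "v \<subseteq> S" for u v
    unfolding sum_Pow_split[OF sub]
  proof (rule sum.cong[OF refl])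
    fix e assume e: "e \<in> Pow (Q - S - H)"
    have *: "T \<psi> (w \<union> (s \<union> e)) = (\<Sum>r\<in>Pow H. U s r * \<psi> (w \<union> (r \<union> e)))" if "s \<subseteq> H" "w \<subseteq> S" for w s
    proof -
      have eq: "w \<union> (r \<union> e) = r \<union> (w \<union> e)" for r by blast
      have "(w \<union> e) \<inter> H = {}" using e assms(4) that by blast
      then show ?thesis unfolding U(2) eq using that by (intro apply_on_slice)
    qed
    have "(\<Sum>s\<in>Pow H. T \<psi> (u \<union> (s \<union> e)) * cnj (T \<psi> (v \<union> (s \<union> e)))) =
      inner_on (Pow H) (\<lambda>s. \<Sum>r\<in>Pow H. U s r * \<psi> (v \<union> (r \<union> e))) (\<lambda>s. \<Sum>r\<in>Pow H. U s r * \<psi> (u \<union> (r \<union> e)))"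
      unfolding inner_on_def by (intro sum.cong refl) (simp add: * uv mult.commute)
    also have "\<dots> = inner_on (Pow H) (\<lambda>r. \<psi> (v \<union> (r \<union> e))) (\<lambda>r. \<psi> (u \<union> (r \<union> e)))"
      by (rule unitary_mat_inner[OF finH U(1)])
    finally show "(\<Sum>s\<in>Pow H. T \<psi> (u \<union> (s \<union> e)) * cnj (T \<psi> (v \<union> (s \<union> e)))) =
      (\<Sum>s\<in>Pow H. \<psi> (u \<union> (s \<union> e)) * cnj (\<psi> (v \<union> (s \<union> e))))"
      by (simp add: inner_on_def mult.commute)
  qed
  then show ?thesis unfolding reduced_density_def by (intro ext) simp
qed

text \<open>Multiplication by \<open>g\<close> is an operator that is diagonal in the qubits outside
  \<open>H\<close>. It stands for the projection onto an input value or onto the wrong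
  answers.\<close>

lemma local_unitary_pointwise_mult:
  assumes "local_unitary H T" and g: "\<And>u v. u - H = v - H \<Longrightarrow> g u = g v"
  shows "T (\<lambda>u. g u * \<psi> u) = (\<lambda>u. g u * T \<psi> u)"
proof -
  obtain U where U: "T = apply_on H U" using assms unfolding local_unitary_def by blast
  have "g (s \<union> (u - H)) = g u" if "s \<subseteq> H" for s u using that by (intro g) blast
  then show ?thesis
    unfolding U apply_on_def by (intro ext) (simp add: sum_distrib_left mult_ac)
qed

lemma local_unitary_commute:
  assumes "local_unitary H T" "local_unitary H' T'" "H \<inter> H' = {}"
  shows "T (T' \<psi>) = T' (T \<psi>)"
proof
  fix u
  obtain U U' where U: "T = apply_on H U" "T' = apply_on H' U'"
    using assms unfolding local_unitary_def by blast
  have 1: "(s \<union> (u - H)) \<inter> H' = u \<inter> H'" "r \<union> (s \<union> (u - H) - H') = r \<union> (s \<union> (u - (H \<union> H')))"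
    if "s \<subseteq> H" for s r using assms(3) that by blast+
  have 2: "(r \<union> (u - H')) \<inter> H = u \<inter> H" "s \<union> (r \<union> (u - H') - H) = r \<union> (s \<union> (u - (H \<union> H')))"
    if "r \<subseteq> H'" for s r using assms(3) that by blast+
  have "T (T' \<psi>) u = (\<Sum>s\<in>Pow H. \<Sum>r\<in>Pow H'. U (u \<inter> H) s * (U' (u \<inter> H') r * \<psi> (r \<union> (s \<union> (u - (H \<union> H'))))))"
    unfolding U apply_on_def by (simp add: 1 sum_distrib_left)
  also have "\<dots> = (\<Sum>r\<in>Pow H'. \<Sum>s\<in>Pow H. U (u \<inter> H) s * (U' (u \<inter> H') r * \<psi> (r \<union> (s \<union> (u - (H \<union> H'))))))"
    by (rule sum.swap)
  also have "\<dots> = T' (T \<psi>) u"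
    unfolding U apply_on_def by (simp add: 2 sum_distrib_left mult_ac)
  finally show "T (T' \<psi>) u = T' (T \<psi>) u" .
qed

text \<open>
  The inner product is real, so \<open>Re \<langle>\<psi> + \<phi>, \<psi> - \<phi>\<rangle> = 0\<close> and the projection onto \<open>G\<close> may be
  replaced by half a reflection.
\<close>

lemma measurement_difference:
  assumes I: "finite I" and G: "G \<subseteq> I"
    and \<psi>: "inner_on I \<psi> \<psi> = 1" and \<phi>: "inner_on I \<phi> \<phi> = 1"
    and B: "inner_on I \<phi> \<psi> = complex_of_real b"
  shows "(\<Sum>u\<in>G. (cmod (\<psi> u))\<^sup>2) \<le> (\<Sum>u\<in>G. (cmod (\<phi> u))\<^sup>2) + sqrt (1 - b\<^sup>2)"
proof -
  define a where "a = (\<lambda>u. \<psi> u + \<phi> u)"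
  define d where "d = (\<lambda>u. \<psi> u - \<phi> u)"
  define s where "s = (\<lambda>u. if u \<in> G then 1 else (-1::real))"
  have n1: "(\<Sum>u\<in>I. (cmod (\<psi> u))\<^sup>2) = 1" "(\<Sum>u\<in>I. (cmod (\<phi> u))\<^sup>2) = 1"
    using \<psi> \<phi> unfolding inner_on_self by (simp_all only: of_real_eq_1_iff)
  have reb: "(\<Sum>u\<in>I. Re (cnj (\<phi> u) * \<psi> u)) = b"
    using arg_cong[OF B, of Re] by (simp add: inner_on_def)
  have na: "(cmod (a u))\<^sup>2 = (cmod (\<psi> u))\<^sup>2 + (cmod (\<phi> u))\<^sup>2 + 2 * Re (cnj (\<phi> u) * \<psi> u)"
    and nd: "(cmod (d u))\<^sup>2 = (cmod (\<psi> u))\<^sup>2 + (cmod (\<phi> u))\<^sup>2 - 2 * Re (cnj (\<phi> u) * \<psi> u)"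
    and ad: "Re (cnj (a u) * d u) = (cmod (\<psi> u))\<^sup>2 - (cmod (\<phi> u))\<^sup>2" for u
    unfolding a_def d_def cmod_power2 by (simp_all add: power2_eq_square algebra_simps)
  have sa: "(\<Sum>u\<in>I. (cmod (a u))\<^sup>2) = 2 + 2 * b" "(\<Sum>u\<in>I. (cmod (d u))\<^sup>2) = 2 - 2 * b"
    unfolding na nd sum.distrib sum_subtractf sum_distrib_left[symmetric] n1 reb by simp_all
  have "2 * ((\<Sum>u\<in>G. (cmod (\<psi> u))\<^sup>2) - (\<Sum>u\<in>G. (cmod (\<phi> u))\<^sup>2)) =
      (\<Sum>u\<in>I. (1 + s u) * ((cmod (\<psi> u))\<^sup>2 - (cmod (\<phi> u))\<^sup>2))"
  proof -
    have "(\<Sum>u\<in>I. (1 + s u) * ((cmod (\<psi> u))\<^sup>2 - (cmod (\<phi> u))\<^sup>2)) =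
      (\<Sum>u\<in>I. if u \<in> G then 2 * ((cmod (\<psi> u))\<^sup>2 - (cmod (\<phi> u))\<^sup>2) else 0)"
      by (intro sum.cong refl) (simp add: s_def)
    also have "\<dots> = (\<Sum>u\<in>G. 2 * ((cmod (\<psi> u))\<^sup>2 - (cmod (\<phi> u))\<^sup>2))"
      using G I by (simp add: sum.If_cases Int_absorb1)
    finally show ?thesis by (simp add: sum_subtractf sum_distrib_left)
  qed
  \<comment> \<open>The constant 1 drops out because both vectors have norm 1.\<close>
  also have "\<dots> = (\<Sum>u\<in>I. s u * Re (cnj (a u) * d u))"
    unfolding ad by (simp add: distrib_right sum.distrib) (simp add: sum_subtractf n1)
  also have "\<dots> \<le> (\<Sum>u\<in>I. cmod (a u) * cmod (d u))"
  proof (intro sum_mono)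
    fix u
    have "\<bar>Re (cnj (a u) * d u)\<bar> \<le> cmod (a u) * cmod (d u)"
      using abs_Re_le_cmod[of "cnj (a u) * d u"] by (simp add: norm_mult)
    then show "s u * Re (cnj (a u) * d u) \<le> cmod (a u) * cmod (d u)"
      unfolding s_def by (auto simp: abs_le_iff)
  qed
  also have "\<dots> \<le> sqrt (\<Sum>u\<in>I. (cmod (a u))\<^sup>2) * sqrt (\<Sum>u\<in>I. (cmod (d u))\<^sup>2)"
    using L2_set_mult_ineq[of "\<lambda>u. cmod (a u)" "\<lambda>u. cmod (d u)" I] by (simp add: L2_set_def)
  also have "\<dots> = 2 * sqrt (1 - b\<^sup>2)"
  proof -
    have "(2 + 2 * b) * (2 - 2 * b) = 2\<^sup>2 * (1 - b\<^sup>2)" by (simp add: power2_eq_square algebra_simps)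
    then show ?thesis unfolding sa real_sqrt_mult[symmetric] by (simp only: real_sqrt_mult) simp
  qed
  finally show ?thesis by simp
qed

section \<open>Minimax\<close>

text \<open>Multiplicative weights method, with the total weight as potential.\<close>

lemma minimax_pmf:
  fixes err :: "'s \<Rightarrow> 'z \<Rightarrow> real"
  assumes Z: "finite Z" "Z \<noteq> {}" and \<alpha>: "0 \<le> \<alpha>" "\<alpha> < \<beta>"
    and range: "\<And>s z. s \<in> S \<Longrightarrow> z \<in> Z \<Longrightarrow> 0 \<le> err s z \<and> err s z \<le> 1"
    and response: "\<And>w. (\<And>z. z \<in> Z \<Longrightarrow> 0 \<le> w z) \<Longrightarrow> (\<Sum>z\<in>Z. w z) = 1 \<Longrightarrow>
      \<exists>s\<in>S. (\<Sum>z\<in>Z. w z * err s z) \<le> \<alpha>"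
  shows "\<exists>p. finite (set_pmf p) \<and> set_pmf p \<subseteq> S \<and>
    (\<forall>z\<in>Z. measure_pmf.expectation p (\<lambda>s. err s z) \<le> \<beta>)"
proof -
  \<comment> \<open>The final average is at most \<open>\<alpha> + 2 * \<eta>\<close>, which half
    the gap keeps below \<open>\<beta>\<close>; the cap at 1 serves the lower bound on
    \<open>ln (1 + x)\<close>.\<close>
  define \<eta> where "\<eta> = min 1 ((\<beta> - \<alpha>) / 2)"
  have \<eta>: "0 < \<eta>" "\<eta> \<le> 1" "\<eta> \<le> (\<beta> - \<alpha>) / 2" using \<alpha> by (auto simp: \<eta>_def min_def)
  define N where "N = real (card Z)"
  have N: "N \<ge> 1" using Z by (simp add: N_def Suc_le_eq card_gt_0_iff)
  \<comment> \<open>With so many rounds the initial potential \<open>ln N\<close> costs at most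
    \<open>\<eta>\<close> per round.\<close>
  obtain T :: nat where T: "T \<ge> 1" "ln N / (\<eta> * \<eta>) \<le> real T"
    using real_arch_simple[of "max 1 (ln N / (\<eta> * \<eta>))"] by auto
  have resp: "\<exists>s. s \<in> S \<and> (\<Sum>z\<in>Z. v z * err s z) \<le> \<alpha> * (\<Sum>z\<in>Z. v z)"
    if v: "\<And>z. z \<in> Z \<Longrightarrow> 0 < v z" for v
  proof -
    define V where "V = (\<Sum>z\<in>Z. v z)"
    have "V > 0" unfolding V_def using Z v by (intro sum_pos)
    moreover have "(\<Sum>z\<in>Z. v z / V) = 1" using \<open>V > 0\<close> by (simp add: V_def flip: sum_divide_distrib)
    ultimately obtain s where s: "s \<in> S" "(\<Sum>z\<in>Z. v z / V * err s z) \<le> \<alpha>"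
      using response[of "\<lambda>z. v z / V"] v by (fastforce simp: less_imp_le)
    have "(\<Sum>z\<in>Z. v z * err s z) = V * (\<Sum>z\<in>Z. v z / V * err s z)"
      unfolding sum_distrib_left using \<open>V > 0\<close> by (intro sum.cong refl) simp
    also have "\<dots> \<le> V * \<alpha>" using s \<open>V > 0\<close> by (intro mult_left_mono) auto
    finally show ?thesis using s by (auto simp: V_def mult.commute)
  qed
  define best where "best = (\<lambda>v. SOME s. s \<in> S \<and> (\<Sum>z\<in>Z. v z * err s z) \<le> \<alpha> * (\<Sum>z\<in>Z. v z))"
  have best: "best v \<in> S" "(\<Sum>z\<in>Z. v z * err (best v) z) \<le> \<alpha> * (\<Sum>z\<in>Z. v z)"
    if "\<And>z. z \<in> Z \<Longrightarrow> 0 < v z" for v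
    using someI_ex[OF resp[of v, OF that]] unfolding best_def by simp_all
  \<comment> \<open>In each round the inputs on which the best response errs gain weight, so later
    responses must do better on them.\<close>
  define W where "W = rec_nat (\<lambda>_. 1) (\<lambda>_ v z. v z * (1 + \<eta> * err (best v) z))"
  define s where "s = (\<lambda>t. best (W t))"
  have W0: "W 0 = (\<lambda>_. 1)" and WS: "W (Suc t) = (\<lambda>z. W t z * (1 + \<eta> * err (s t) z))" for t
    by (simp_all add: W_def s_def)
  have Wpos: "0 < W t z" if "z \<in> Z" for t z
    using that
  proof (induction t arbitrary: z)
    case (Suc t)
    then have "s t \<in> S" unfolding s_def by (intro best)
    then show ?case using Suc range \<eta> unfolding WS by (intro mult_pos_pos add_pos_nonneg) auto
  qed (simp add: W0)
  have s: "s t \<in> S" "(\<Sum>z\<in>Z. W t z * err (s t) z) \<le> \<alpha> * (\<Sum>z\<in>Z. W t z)" for t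
    unfolding s_def using Wpos by (intro best; blast)+
  have pot: "(\<Sum>z\<in>Z. W t z) \<le> N * (1 + \<eta> * \<alpha>) ^ t" for t
  proof (induction t)
    case (Suc t)
    have "(\<Sum>z\<in>Z. W (Suc t) z) = (\<Sum>z\<in>Z. W t z) + \<eta> * (\<Sum>z\<in>Z. W t z * err (s t) z)"
      unfolding WS by (simp add: algebra_simps sum.distrib sum_distrib_left)
    also have "\<dots> \<le> (\<Sum>z\<in>Z. W t z) + \<eta> * (\<alpha> * (\<Sum>z\<in>Z. W t z))"
      using s(2) \<eta> by (intro add_left_mono mult_left_mono) auto
    also have "\<dots> = (\<Sum>z\<in>Z. W t z) * (1 + \<eta> * \<alpha>)" by (simp add: algebra_simps)
    also have "\<dots> \<le> N * (1 + \<eta> * \<alpha>) ^ t * (1 + \<eta> * \<alpha>)"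
      using Suc \<eta> \<alpha> by (intro mult_right_mono) auto
    finally show ?case by (simp add: mult_ac)
  qed (simp add: W0 N_def)
  \<comment> \<open>From \<open>ln (1 + x) \<ge> x - x^2\<close> with \<open>x \<le> \<eta>\<close>;
    each round loses at most \<open>\<eta> * \<eta>\<close>.\<close>
  have lnW: "\<eta> * (\<Sum>t<k. err (s t) z) - real k * (\<eta> * \<eta>) \<le> ln (W k z)" if z: "z \<in> Z" for k z
  proof (induction k)
    case (Suc k)
    define x where "x = \<eta> * err (s k) z"
    have r: "0 \<le> err (s k) z" "err (s k) z \<le> 1" using range[OF s(1) z] by auto
    have x: "0 \<le> x" "x \<le> \<eta>" using r \<eta> mult_left_mono[of "err (s k) z" 1 \<eta>] by (auto simp: x_def)
    then have "x \<le> 1" using \<eta> by simp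
    have "x - \<eta> * \<eta> \<le> x - x\<^sup>2" using mult_mono[OF x(2) x(2)] x \<eta> by (simp add: power2_eq_square)
    also have "\<dots> \<le> ln (1 + x)" using x \<open>x \<le> 1\<close> by (intro ln_one_plus_pos_lower_bound)
    finally have "x - \<eta> * \<eta> \<le> ln (1 + x)" .
    moreover have "ln (W (Suc k) z) = ln (W k z) + ln (1 + x)"
      unfolding WS x_def[symmetric] using Wpos[OF z, of k] x by (intro ln_mult_pos) auto
    ultimately show ?case using Suc by (simp add: x_def algebra_simps)
  qed (simp add: W0)
  have avg: "(\<Sum>t<T. err (s t) z) / T \<le> \<beta>" if z: "z \<in> Z" for z
  proof -
    have "W T z \<le> (\<Sum>z\<in>Z. W T z)" using Z z Wpos by (intro member_le_sum) (auto simp: less_imp_le)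
    also have "\<dots> \<le> N * (1 + \<eta> * \<alpha>) ^ T" by (rule pot)
    also have "\<dots> \<le> N * exp (\<eta> * \<alpha>) ^ T"
      using N \<eta> \<alpha> exp_ge_add_one_self[of "\<eta> * \<alpha>"] by (intro mult_left_mono power_mono) auto
    finally have "ln (W T z) \<le> ln (N * exp (\<eta> * \<alpha>) ^ T)"
      using Wpos[OF z] by (meson ln_mono order.strict_trans2)
    also have "\<dots> = ln N + real T * (\<eta> * \<alpha>)" using N by (simp add: ln_mult ln_realpow)
    finally have "\<eta> * (\<Sum>t<T. err (s t) z) \<le> ln N + real T * (\<eta> * \<alpha>) + real T * (\<eta> * \<eta>)"
      using lnW[OF z, of T] by simp
    also have "ln N \<le> real T * (\<eta> * \<eta>)" using T(2) \<eta> by (simp add: divide_le_eq mult.commute)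
    finally have "\<eta> * (\<Sum>t<T. err (s t) z) \<le> \<eta> * (real T * (\<alpha> + 2 * \<eta>))"
      by (simp add: algebra_simps)
    then have "(\<Sum>t<T. err (s t) z) \<le> real T * (\<alpha> + 2 * \<eta>)" using \<eta> by simp
    also have "\<dots> \<le> real T * \<beta>" using \<eta> by (intro mult_left_mono) auto
    finally show ?thesis using T by (simp add: divide_le_eq mult.commute)
  qed
  \<comment> \<open>The mixed strategy plays a uniformly random round of the sequence of
    responses.\<close>
  define p where "p = map_pmf s (pmf_of_set {..<T})"
  have ne: "{..<T} \<noteq> {}" using T by (auto simp: lessThan_empty_iff)
  have "measure_pmf.expectation p (\<lambda>s. err s z) = (\<Sum>t<T. err (s t) z) / T" for z
    unfolding p_def by (simp add: integral_pmf_of_set ne)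
  moreover have "set_pmf p = s ` {..<T}" unfolding p_def using ne by (simp add: set_pmf_of_set)
  ultimately show ?thesis using s(1) avg by (intro exI[of _ p]) auto
qed

section \<open>The first message\<close>

lemma apply_on_basis_state:
  assumes "finite D" "v \<subseteq> D" "w \<inter> D = {}"
  shows "apply_on D U (basis_state (v \<union> w)) u = (if u - D = w then U (u \<inter> D) v else 0)"
proof -
  have "s \<union> (u - D) = v \<union> w \<longleftrightarrow> u - D = w \<and> s = v" if "s \<subseteq> D" for s
    using that assms by blast
  then have "apply_on D U (basis_state (v \<union> w)) u =
      (\<Sum>s\<in>Pow D. if s = v then (if u - D = w then U (u \<inter> D) v else 0) else 0)"
    unfolding apply_on_def basis_state_def by (intro sum.cong refl) auto
  then show ?thesis using assms by simp
qed

locale game_protocol =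
  fixes X :: "'x set" and Y :: "'y set" and f :: "'x \<Rightarrow> 'y \<Rightarrow> 'z"
    and n t c :: nat and l :: "nat list"
    and P :: "('x list, 'y \<times> nat \<times> 'x list, 'z) protocol"
  assumes finite_X: "finite X" and n_pos: "1 \<le> n" and t_pos: "1 \<le> t"
    and safe: "safe_coinless_protocol (game_A X Y f n) Alice t c l P"
begin

abbreviation "Q \<equiv> all_qubits P"
abbreviation "QA \<equiv> init_qubits P Alice"
abbreviation "QB \<equiv> init_qubits P Bob"
abbreviation "M \<equiv> messages P ! 0"
abbreviation "C \<equiv> safe_overhead P"

lemma coinless: "coinless_protocol (game_A X Y f n) P"
  and starter [simp]: "starter P = Alice" and rounds: "rounds P = t" and length_l: "length l = t"
  and card_messages: "k < t \<Longrightarrow> card (messages P ! k) = (if k = 0 then l ! 0 + c else l ! k)"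
  and overhead_sub: "C \<subseteq> M" and card_overhead: "card C = c"
  using safe t_pos unfolding safe_coinless_protocol_def by auto

lemma overhead_indep:
  "\<exists>\<rho>. \<forall>(a, b)\<in>legal_inputs (game_A X Y f n). reduced_density Q C (state_after P a b 1) = \<rho>"
  using safe t_pos unfolding safe_coinless_protocol_def by simp

lemma legal_game:
  "xs \<in> words X n \<Longrightarrow> y \<in> Y \<Longrightarrow> 1 \<le> i \<Longrightarrow> i \<le> n \<Longrightarrow>
    (xs, (y, i, take (i - 1) xs)) \<in> legal_inputs (game_A X Y f n)"
  unfolding game_A_def words_def by auto

lemma finite_init: "finite (init_qubits P p)"
  and disjoint_init: "QA \<inter> QB = {}"
  and message_held: "k < t \<Longrightarrow> messages P ! k \<subseteq> held P k (turn P k)"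
  and answer_held: "answer_qubits P \<subseteq> held P t (turn P t)"
  using coinless rounds unfolding coinless_protocol_def by auto

lemma finite_Q: "finite Q"
  using finite_init by (simp add: all_qubits_def)

lemma
  assumes "(a, b) \<in> legal_inputs (game_A X Y f n)"
  shows encode_A_sub: "encode_A P a \<subseteq> QA" and encode_B_sub: "encode_B P b \<subseteq> QB"
    and step_unitary: "k \<le> t \<Longrightarrow> unitary_on (held P k (turn P k)) (step_op P k a b)"
  using coinless assms rounds unfolding coinless_protocol_def by fastforce+

lemma turn_P: "turn P k = (if even k then Alice else Bob)"
  by (simp add: turn_def)

lemma held_partition:
  assumes "k \<le> t"
  shows "held P k Alice \<inter> held P k Bob = {} \<and> held P k Alice \<union> held P k Bob = Q"
  using assms
proof (induction k)
  case 0
  then show ?case using disjoint_init by (simp add: all_qubits_def)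
next
  case (Suc k)
  then show ?case using message_held[of k] by (auto simp: turn_P split: if_splits)
qed

lemma held_sub: "k \<le> t \<Longrightarrow> held P k p \<subseteq> Q"
  using held_partition[of k] by (cases p) auto

lemma M_sub: "M \<subseteq> QA"
  using message_held[of 0] t_pos by (simp add: turn_P)

lemma held_1: "held P (Suc 0) Alice = QA - M" "held P (Suc 0) Bob = QB \<union> M"
  by (simp_all add: turn_P)

lemma finite_M: "finite M"
  using M_sub finite_init finite_subset by blast

text \<open>The amplitudes on Alice's qubits after her first operation. She starts in a basis state,
  so they form a column of her matrix.\<close>

definition msg_state :: "'x list \<Rightarrow> nat set \<Rightarrow> complex" where
  "msg_state xs s = ops_A P 0 xs s (encode_A P xs)"

lemma state_after_1:
  assumes "(xs, b) \<in> legal_inputs (game_A X Y f n)"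
  shows "state_after P xs b (Suc 0) u = (if u - QA = encode_B P b then msg_state xs (u \<inter> QA) else 0)"
proof -
  have "encode_A P xs \<subseteq> QA" "encode_B P b \<inter> QA = {}"
    using encode_A_sub encode_B_sub assms disjoint_init by blast+
  then show ?thesis
    using apply_on_basis_state[of QA "encode_A P xs" "encode_B P b" "ops_A P 0 xs" u] finite_init
    by (simp add: turn_P step_op_def msg_state_def)
qed

lemma msg_state_norm:
  assumes "xs \<in> words X n" "Y \<noteq> {}"
  shows "(\<Sum>s\<in>Pow QA. (cmod (msg_state xs s))\<^sup>2) = 1"
proof -
  obtain y where "y \<in> Y" using assms by blast
  then have legal: "(xs, (y, 1, take (1 - 1) xs)) \<in> legal_inputs (game_A X Y f n)"
    using legal_game assms n_pos by blast
  have "unitary_mat (Pow QA) (ops_A P 0 xs)"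
    using step_unitary[OF legal, of 0] by (simp add: turn_P step_op_def unitary_on_iff)
  then have "inner_on (Pow QA) (msg_state xs) (msg_state xs) = 1"
    using encode_A_sub[OF legal] unfolding unitary_mat_def inner_on_def msg_state_def by simp
  then show ?thesis unfolding inner_on_self by (simp only: of_real_eq_1_iff)
qed

text \<open>The overhead computed from Alice's qubits alone: Bob's qubits are still in a basis state
  and factor out of the partial trace.\<close>

definition overhead_density :: "'x list \<Rightarrow> qmatrix" where
  "overhead_density xs u v = (\<Sum>e\<in>Pow (QA - C). msg_state xs (u \<union> e) * cnj (msg_state xs (v \<union> e)))"

lemma overhead_density_eq:
  assumes xs: "xs \<in> words X n" "xs' \<in> words X n" and Y: "Y \<noteq> {}" and uv: "u \<subseteq> C" "v \<subseteq> C"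
  shows "overhead_density xs u v = overhead_density xs' u v"
proof -
  obtain y where y: "y \<in> Y" using Y by blast
  \<comment> \<open>At position 1 Bob's prefix is empty, so this input is legal together with every
    word and allows any two words to be compared.\<close>
  define b where "b = (y, 1 :: nat, [] :: 'x list)"
  have legal: "(xs, b) \<in> legal_inputs (game_A X Y f n)" if "xs \<in> words X n" for xs
    using legal_game[OF that y order.refl n_pos] by (simp add: b_def)
  have CA: "C \<subseteq> QA" using overhead_sub M_sub by blast
  have "reduced_density Q C (state_after P xs b 1) u v = overhead_density xs u v" if xs: "xs \<in> words X n" for xs
  proof -
    have encB: "encode_B P b \<subseteq> QB" by (rule encode_B_sub[OF legal[OF xs]])
    have sub: "QA - C \<subseteq> Q - C" by (auto simp: all_qubits_def)
    have Q: "Q - C - (QA - C) = QB" using CA disjoint_init by (auto simp: all_qubits_def)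
    have st: "state_after P xs b (Suc 0) (w \<union> (s \<union> e)) = (if e = encode_B P b then msg_state xs (w \<union> s) else 0)"
      if "w \<subseteq> C" "s \<subseteq> QA - C" "e \<subseteq> QB" for w s e
    proof -
      have "w \<union> (s \<union> e) - QA = e" "(w \<union> (s \<union> e)) \<inter> QA = w \<union> s"
        using that CA disjoint_init by blast+
      then show ?thesis unfolding state_after_1[OF legal[OF xs]] by (cases "e = encode_B P b") simp_all
    qed
    have "reduced_density Q C (state_after P xs b 1) u v =
      (\<Sum>e\<in>Pow QB. \<Sum>s\<in>Pow (QA - C). state_after P xs b (Suc 0) (u \<union> (s \<union> e)) * cnj (state_after P xs b (Suc 0) (v \<union> (s \<union> e))))"
      using uv by (simp add: reduced_density_def sum_Pow_split[OF sub] Q)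
    also have "\<dots> = (\<Sum>e\<in>Pow QB. if e = encode_B P b then overhead_density xs u v else 0)"
    proof (intro sum.cong refl)
      fix e assume "e \<in> Pow QB"
      then show "(\<Sum>s\<in>Pow (QA - C). state_after P xs b (Suc 0) (u \<union> (s \<union> e)) * cnj (state_after P xs b (Suc 0) (v \<union> (s \<union> e))))
          = (if e = encode_B P b then overhead_density xs u v else 0)"
        using uv by (simp add: st overhead_density_def del: state_after.simps)
    qed
    also have "\<dots> = overhead_density xs u v" using encB finite_init by simp
    finally show ?thesis .
  qed
  moreover have "reduced_density Q C (state_after P xs b 1) = reduced_density Q C (state_after P xs' b 1)"
  proof -
    obtain \<rho> where \<rho>: "\<forall>(a, b)\<in>legal_inputs (game_A X Y f n). reduced_density Q C (state_after P a b 1) = \<rho>"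
      using overhead_indep by blast
    show ?thesis
      using bspec[OF \<rho> legal[OF xs(1)]] bspec[OF \<rho> legal[OF xs(2)]] by simp
  qed
  ultimately show ?thesis using xs by metis
qed

lemma msg_state_norm_split:
  assumes "xs \<in> words X n" "Y \<noteq> {}" "S \<subseteq> QA"
  shows "(\<Sum>s\<in>Pow S. \<Sum>e\<in>Pow (QA - S). (cmod (msg_state xs (s \<union> e)))\<^sup>2) = 1"
  using msg_state_norm[OF assms(1,2)] unfolding sum_Pow_split[OF assms(3)]
  by (subst sum.swap)

end

text \<open>
  \<open>density\<close> averages the state of the first message over the unknown part of Alice's input;
  \<open>reference\<close> is the uniform state of the main part tensored with the overhead.
\<close>

locale weighted_game_protocol = game_protocol +
  fixes \<mu> :: "'a \<Rightarrow> real"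
  assumes \<mu>_nonneg: "x \<in> X \<Longrightarrow> 0 \<le> \<mu> x" and \<mu>_sum: "(\<Sum>x\<in>X. \<mu> x) = 1" and Y_ne: "Y \<noteq> {}"
begin

abbreviation "amp ws \<equiv> complex_of_real (sqrt (wt \<mu> ws))"

text \<open>The weights enter as amplitudes, which makes this the partial trace of a pure
  superposition over the unknown letters; Alice's rotation aims at that superposition.\<close>

definition density :: "'a list \<Rightarrow> qmatrix" where
  "density ws = gram (words X (n - length ws) \<times> Pow (QA - M))
     (\<lambda>m (vs, r). amp vs * msg_state (ws @ vs) (m \<union> r))"

lemma density_eq:
  assumes "set ws \<subseteq> X"
  shows "density ws m m' = (\<Sum>vs\<in>words X (n - length ws). complex_of_real (wt \<mu> vs) *
     (\<Sum>r\<in>Pow (QA - M). msg_state (ws @ vs) (m \<union> r) * cnj (msg_state (ws @ vs) (m' \<union> r))))"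
proof -
  have sq: "amp vs * a * (amp vs * cnj b) =
      complex_of_real (wt \<mu> vs) * (a * cnj b)" if "vs \<in> words X k" for vs a b k
  proof -
    have "amp vs * amp vs = complex_of_real (wt \<mu> vs)"
      using wt_nonneg[of X \<mu> vs] \<mu>_nonneg that by (simp add: words_def flip: of_real_mult)
    then show ?thesis by (simp add: mult_ac)
  qed
  show ?thesis
    unfolding density_def gram_def sum_distrib_left sum.cartesian_product
    by (intro sum.cong refl) (auto simp: sq)
qed

lemma density_martingale:
  assumes "set ws \<subseteq> X" "length ws < n"
  shows "density ws m m' = (\<Sum>x\<in>X. complex_of_real (\<mu> x) * density (ws @ [x]) m m')"
proof -
  obtain k where k: "n - length ws = Suc 0 + k" "n - Suc (length ws) = k"
    using assms(2) by (metis Suc_diff_Suc plus_1_eq_Suc One_nat_def)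
  show ?thesis
    unfolding density_eq[OF assms(1)] k(1) sum_words_append
    using assms(1)
    by (simp add: sum_words_snoc density_eq k sum_distrib_left mult.assoc)
qed

lemma trace_density:
  assumes "set ws \<subseteq> X" "length ws \<le> n"
  shows "(\<Sum>m\<in>Pow M. density ws m m) = 1"
proof -
  have "(\<Sum>m\<in>Pow M. density ws m m) = (\<Sum>vs\<in>words X (n - length ws). complex_of_real (wt \<mu> vs) *
     of_real (\<Sum>m\<in>Pow M. \<Sum>r\<in>Pow (QA - M). (cmod (msg_state (ws @ vs) (m \<union> r)))\<^sup>2))"
    unfolding density_eq[OF assms(1)]
    by (subst sum.swap) (simp add: sum_distrib_left complex_norm_square flip: of_real_power)
  also have "\<dots> = (\<Sum>vs\<in>words X (n - length ws). complex_of_real (wt \<mu> vs))"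
    using assms by (intro sum.cong refl) (subst msg_state_norm_split[OF _ Y_ne M_sub], auto simp: words_def)
  also have "\<dots> = 1"
    using sum_wt_words[OF \<mu>_sum] by (metis of_real_1 of_real_sum)
  finally show ?thesis .
qed

definition reference :: "'a list \<Rightarrow> qmatrix" where
  "reference xs u v = (if u - C = v - C then overhead_density xs (u \<inter> C) (v \<inter> C) / 2 ^ (l ! 0) else 0)"

lemma card_main: "card (M - C) = l ! 0"
  using card_messages[of 0] card_overhead overhead_sub t_pos finite_M
  by (simp add: card_Diff_subset finite_subset)

text \<open>Positivity of the reference state: a second register records the main part, and the rest
  of Alice's qubits purify the overhead.\<close>

lemma reference_gram:
  assumes "u \<subseteq> M" "v \<subseteq> M"
  shows "reference xs u v = gram (Pow (M - C) \<times> Pow (QA - C))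
    (\<lambda>u (a, e). if u - C = a then msg_state xs ((u \<inter> C) \<union> e) / complex_of_real (sqrt (2 ^ (l ! 0))) else 0) u v"
proof -
  have sq: "complex_of_real (sqrt (2 ^ (l ! 0))) * complex_of_real (sqrt (2 ^ (l ! 0))) = 2 ^ (l ! 0)"
    by (simp flip: of_real_mult)
  have "gram (Pow (M - C) \<times> Pow (QA - C))
    (\<lambda>u (a, e). if u - C = a then msg_state xs ((u \<inter> C) \<union> e) / complex_of_real (sqrt (2 ^ (l ! 0))) else 0) u v
    = (\<Sum>a\<in>Pow (M - C). \<Sum>e\<in>Pow (QA - C). if u - C = a then (if u - C = v - C then
        msg_state xs ((u \<inter> C) \<union> e) * cnj (msg_state xs ((v \<inter> C) \<union> e)) / 2 ^ (l ! 0) else 0) else 0)"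
    unfolding gram_def sum.cartesian_product
    by (intro sum.cong refl) (auto simp: sq)
  also have "\<dots> = (\<Sum>a\<in>Pow (M - C). if u - C = a then reference xs u v else 0)"
    by (intro sum.cong refl) (auto simp: reference_def overhead_density_def sum_divide_distrib)
  also have "\<dots> = reference xs u v" using assms finite_M by auto
  finally show ?thesis ..
qed

lemma trace_reference:
  assumes "xs \<in> words X n"
  shows "(\<Sum>m\<in>Pow M. reference xs m m) = 1"
proof -
  have CQ: "C \<subseteq> QA" using overhead_sub M_sub by blast
  have "(\<Sum>c\<in>Pow C. overhead_density xs c c) =
      of_real (\<Sum>c\<in>Pow C. \<Sum>e\<in>Pow (QA - C). (cmod (msg_state xs (c \<union> e)))\<^sup>2)"
    by (simp add: overhead_density_def complex_norm_square flip: of_real_power)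
  then have one: "(\<Sum>c\<in>Pow C. overhead_density xs c c) = 1"
    unfolding msg_state_norm_split[OF assms Y_ne CQ] by simp
  have "(\<Sum>m\<in>Pow M. reference xs m m) = (\<Sum>a\<in>Pow (M - C). \<Sum>c\<in>Pow C. overhead_density xs c c / 2 ^ (l ! 0))"
    unfolding sum_Pow_split[OF overhead_sub]
  proof (intro sum.cong refl)
    fix a c assume "a \<in> Pow (M - C)" "c \<in> Pow C"
    then have "(c \<union> a) \<inter> C = c" by auto
    then show "reference xs (c \<union> a) (c \<union> a) = overhead_density xs c c / 2 ^ (l ! 0)"
      by (simp add: reference_def)
  qed
  also have "\<dots> = of_nat (card (Pow (M - C))) * (1 / 2 ^ (l ! 0))"
    using one by (simp flip: sum_divide_distrib)
  also have "\<dots> = 1" using finite_M by (simp add: card_Pow card_main)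
  finally show ?thesis .
qed

text \<open>One factor \<open>2 ^ (l ! 0)\<close> is Cauchy-Schwarz over the values \<open>a\<close>
  of the main part, the other undoes the normalisation of \<open>reference\<close>. The overheads of
  \<open>xs\<close> and \<open>xs0\<close> agree by safety.\<close>

lemma quad_form_density_le:
  assumes xs: "xs \<in> words X n" "xs0 \<in> words X n"
  shows "quad_form (Pow M) (density xs) v \<le> 4 ^ (l ! 0) * quad_form (Pow M) (reference xs0) v"
proof -
  define d where "d = (2 :: real) ^ (l ! 0)"
  have d: "d > 0" "real (card (Pow (M - C))) = d"
    using finite_M by (simp_all add: d_def card_Pow card_main)
  define g where "g = (\<lambda>a e. \<Sum>c\<in>Pow C. cnj (v (c \<union> a)) * msg_state xs (c \<union> e))"
  have "quad_form (Pow M) (reference xs0) v = quad_form (Pow M) (reference xs) v"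
    using overhead_density_eq[OF xs Y_ne] by (intro quad_form_cong) (auto simp: reference_def)
  also have "\<dots> = (\<Sum>a\<in>Pow (M - C). \<Sum>e\<in>Pow (QA - C). (cmod (g a e))\<^sup>2 / d)"
  proof -
    have "(\<Sum>u\<in>Pow M. cnj (v u) * (if u - C = a then msg_state xs ((u \<inter> C) \<union> e) / complex_of_real (sqrt d) else 0))
       = g a e / complex_of_real (sqrt d)" if a: "a \<subseteq> M - C" for a e
    proof -
      have "(\<Sum>u\<in>Pow M. cnj (v u) * (if u - C = a then msg_state xs ((u \<inter> C) \<union> e) / complex_of_real (sqrt d) else 0))
        = (\<Sum>b\<in>Pow (M - C). \<Sum>c\<in>Pow C. if b = a then cnj (v (c \<union> a)) * msg_state xs (c \<union> e) / complex_of_real (sqrt d) else 0)"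
        unfolding sum_Pow_split[OF overhead_sub]
      proof (intro sum.cong refl)
        fix b c assume "b \<in> Pow (M - C)" "c \<in> Pow C"
        then have "c \<union> b - C = b" "(c \<union> b) \<inter> C = c" by auto
        then show "cnj (v (c \<union> b)) * (if c \<union> b - C = a then msg_state xs ((c \<union> b) \<inter> C \<union> e) / complex_of_real (sqrt d) else 0) =
          (if b = a then cnj (v (c \<union> a)) * msg_state xs (c \<union> e) / complex_of_real (sqrt d) else 0)"
          by (cases "b = a") simp_all
      qed
      also have "\<dots> = (\<Sum>b\<in>Pow (M - C). if b = a then g a e / complex_of_real (sqrt d) else 0)"
        by (intro sum.cong refl) (auto simp: g_def sum_divide_distrib)
      also have "\<dots> = g a e / complex_of_real (sqrt d)" using a finite_M by simp
      finally show ?thesis .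
    qed
    note inner = this
    have "quad_form (Pow M) (reference xs) v = quad_form (Pow M) (gram (Pow (M - C) \<times> Pow (QA - C))
      (\<lambda>u (a, e). if u - C = a then msg_state xs ((u \<inter> C) \<union> e) / complex_of_real (sqrt d) else 0)) v"
      unfolding d_def by (intro quad_form_cong reference_gram) auto
    also have "\<dots> = (\<Sum>a\<in>Pow (M - C). \<Sum>e\<in>Pow (QA - C). (cmod (g a e / complex_of_real (sqrt d)))\<^sup>2)"
      unfolding quad_form_gram sum.cartesian_product
      by (intro sum.cong refl) (auto simp: inner)
    finally show ?thesis using d by (simp add: norm_divide power_divide)
  qed
  finally have ref: "d * quad_form (Pow M) (reference xs0) v = (\<Sum>a\<in>Pow (M - C). \<Sum>e\<in>Pow (QA - C). (cmod (g a e))\<^sup>2)"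
    using d by (simp flip: sum_divide_distrib)
  have "quad_form (Pow M) (density xs) v = (\<Sum>r\<in>Pow (QA - M). (cmod (\<Sum>m\<in>Pow M. cnj (v m) * msg_state xs (m \<union> r)))\<^sup>2)"
  proof -
    have "words X (n - length xs) \<times> Pow (QA - M) = Pair [] ` Pow (QA - M)"
      using xs(1) by (auto simp: words_def)
    then show ?thesis
      unfolding density_def quad_form_gram by (simp add: sum.reindex inj_on_def)
  qed
  also have "\<dots> = (\<Sum>r\<in>Pow (QA - M). (cmod (\<Sum>a\<in>Pow (M - C). g a (a \<union> r)))\<^sup>2)"
    unfolding sum_Pow_split[OF overhead_sub] g_def by (simp add: Un_assoc)
  also have "\<dots> \<le> (\<Sum>r\<in>Pow (QA - M). d * (\<Sum>a\<in>Pow (M - C). (cmod (g a (a \<union> r)))\<^sup>2))"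
  proof (rule sum_mono)
    fix r
    have "(cmod (\<Sum>a\<in>Pow (M - C). g a (a \<union> r)))\<^sup>2 \<le> (\<Sum>a\<in>Pow (M - C). 1 * cmod (g a (a \<union> r)))\<^sup>2"
      by (intro power_mono) (simp_all add: norm_sum)
    also have "\<dots> \<le> (\<Sum>a\<in>Pow (M - C). 1\<^sup>2) * (\<Sum>a\<in>Pow (M - C). (cmod (g a (a \<union> r)))\<^sup>2)"
      by (rule Cauchy_Schwarz_ineq_sum)
    finally show "(cmod (\<Sum>a\<in>Pow (M - C). g a (a \<union> r)))\<^sup>2 \<le> d * (\<Sum>a\<in>Pow (M - C). (cmod (g a (a \<union> r)))\<^sup>2)"
      using d by simp
  qed
  also have "\<dots> = d * (\<Sum>a\<in>Pow (M - C). \<Sum>r\<in>Pow (QA - M). (cmod (g a (a \<union> r)))\<^sup>2)"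
    unfolding sum_distrib_left by (rule sum.swap)
  \<comment> \<open>On the left only those \<open>e\<close> occur whose main part is
    \<open>a\<close> itself; admitting all \<open>e\<close> adds nonnegative terms.\<close>
  also have "\<dots> \<le> d * (\<Sum>a\<in>Pow (M - C). \<Sum>e\<in>Pow (QA - C). (cmod (g a e))\<^sup>2)"
  proof (intro mult_left_mono sum_mono)
    fix a assume a: "a \<in> Pow (M - C)"
    have "inj_on ((\<union>) a) (Pow (QA - M))" using a by (auto simp: inj_on_def)
    then have "(\<Sum>r\<in>Pow (QA - M). (cmod (g a (a \<union> r)))\<^sup>2) = (\<Sum>e\<in>(\<union>) a ` Pow (QA - M). (cmod (g a e))\<^sup>2)"
      by (simp add: sum.reindex)
    also have "\<dots> \<le> (\<Sum>e\<in>Pow (QA - C). (cmod (g a e))\<^sup>2)"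
      using a M_sub overhead_sub finite_init by (intro sum_mono2) auto
    finally show "(\<Sum>r\<in>Pow (QA - M). (cmod (g a (a \<union> r)))\<^sup>2) \<le> (\<Sum>e\<in>Pow (QA - C). (cmod (g a e))\<^sup>2)" .
  qed (use d in simp)
  also have "\<dots> = 4 ^ (l ! 0) * quad_form (Pow M) (reference xs0) v"
    unfolding ref[symmetric] by (simp add: d_def flip: power_mult_distrib)
  finally show ?thesis .
qed

lemma information_bound:
  assumes spec: "\<And>ws. set ws \<subseteq> X \<Longrightarrow> length ws \<le> n \<Longrightarrow> spectral (Pow M) (density ws) (V ws) (p ws)"
  shows "(\<Sum>i<n. \<Sum>ws\<in>words X i. wt \<mu> ws * (\<Sum>x\<in>X. \<mu> x *
      (2 * (1 - overlap (Pow M) (V (ws @ [x])) (p (ws @ [x])) (V ws) (p ws))))) \<le> 2 * real (l ! 0) * ln 2"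
proof -
  have fin: "finite (Pow M)" using finite_M by simp
  obtain x0 where "x0 \<in> X" using \<mu>_sum by fastforce
  \<comment> \<open>The overhead is independent of the input, so one arbitrary word fixes the
    reference state.\<close>
  then have xs0: "replicate n x0 \<in> words X n" (is "?xs0 \<in> _") by (auto simp: words_def)
  obtain W q where W: "spectral (Pow M) (gram (Pow (M - C) \<times> Pow (QA - C))
    (\<lambda>u (a, e). if u - C = a then msg_state ?xs0 ((u \<inter> C) \<union> e) / complex_of_real (sqrt (2 ^ (l ! 0))) else 0)) W q"
    using spectral_gram[OF fin] by blast
  then have T: "spectral (Pow M) (reference ?xs0) W q"
    unfolding spectral_def by (simp add: reference_gram)
  have q1: "(\<Sum>k\<in>Pow M. q k) = 1"
    using trace_spectral[OF T] trace_reference[OF xs0] by (metis of_real_eq_1_iff)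
  have p1: "(\<Sum>k\<in>Pow M. p ws k) = 1" if "set ws \<subseteq> X" "length ws \<le> n" for ws
    using trace_spectral[OF spec[OF that]] trace_density[OF that] by (metis of_real_eq_1_iff)
  have "(\<Sum>i<n. \<Sum>ws\<in>words X i. wt \<mu> ws * (\<Sum>x\<in>X. \<mu> x *
      (2 * (1 - overlap (Pow M) (V (ws @ [x])) (p (ws @ [x])) (V ws) (p ws))))) \<le> ln (4 ^ (l ! 0))"
    using density_martingale quad_form_density_le xs0
    by (intro chain_rule_bound[OF fin finite_X \<mu>_nonneg \<mu>_sum spec p1 _ T q1]) (auto simp: words_def)
  also have "ln (4 ^ (l ! 0)) = 2 * real (l ! 0) * ln (2 :: real)"
  proof -
    have "ln (4 :: real) = 2 * ln 2" using ln_realpow[of "2 :: real" 2] by simp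
    then show ?thesis by (simp add: ln_realpow)
  qed
  finally show ?thesis .
qed

end

section \<open>The shortened protocol\<close>

text \<open>Protocols are made of matrices, whereas the construction is done with maps; choice
  recovers a matrix.\<close>

definition mat_on :: "nat set \<Rightarrow> (qstate \<Rightarrow> qstate) \<Rightarrow> qmatrix" where
  "mat_on H T = (SOME U. unitary_on H U \<and> T = apply_on H U)"

lemma mat_on:
  assumes "local_unitary H T"
  shows "unitary_on H (mat_on H T)" "apply_on H (mat_on H T) = T"
  using someI_ex[OF assms[unfolded local_unitary_def]] unfolding mat_on_def by simp_all

text \<open>
  The shortened protocol.  Bob prepares a purification of the expected first message on \<open>M\<close> and
  its copy \<open>M'\<close> and sends \<open>M'\<close> as safe overhead.  Alice rotates \<open>M'\<close>, together with her old qubits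
  and the register \<open>S\<close>, towards the state in which \<open>S\<close> is a superposition of codes of the lists
  \<open>xs\<close> extending \<open>pre @ [x]\<close>; her later operations are controlled by \<open>S\<close>.  The new input
  registers \<open>IA\<close> and \<open>IB\<close> are never touched.
\<close>

locale reduced_protocol = game_protocol X Y f n t c l P
  for X :: "'x set" and Y :: "'y set" and f :: "'x \<Rightarrow> 'y \<Rightarrow> 'z"
    and n t c :: nat and l :: "nat list"
    and P :: "('x list, 'y \<times> nat \<times> 'x list, 'z) protocol" +
  fixes pre :: "'x list" and cp :: "nat \<Rightarrow> nat" and S IA IB :: "nat set"
    and seed :: "'x list \<Rightarrow> nat set" and encx :: "'x \<Rightarrow> nat set" and ency :: "'y \<Rightarrow> nat set"
    and UA :: "'x \<Rightarrow> qmatrix" and UB :: "'y \<Rightarrow> qmatrix" and \<Psi> :: qstate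
  assumes pre_sub: "set pre \<subseteq> X" and pre_len: "length pre < n"
    and fin: "finite S" "finite IA" "finite IB"
    and cp_inj: "inj_on cp (messages P ! 0)"
    and fresh_M': "all_qubits P \<inter> cp ` (messages P ! 0) = {}"
    and fresh_S: "(all_qubits P \<union> cp ` (messages P ! 0)) \<inter> S = {}"
    and fresh_IA: "(all_qubits P \<union> cp ` (messages P ! 0) \<union> S) \<inter> IA = {}"
    and fresh_IB: "(all_qubits P \<union> cp ` (messages P ! 0) \<union> S \<union> IA) \<inter> IB = {}"
    and seed: "inj_on seed (words X n)" "xs \<in> words X n \<Longrightarrow> seed xs \<subseteq> S"
    and encx: "inj_on encx X" "x \<in> X \<Longrightarrow> encx x \<subseteq> IA"
    and ency: "inj_on ency Y" "y \<in> Y \<Longrightarrow> ency y \<subseteq> IB"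
    and UA: "x \<in> X \<Longrightarrow> unitary_on
      ((init_qubits P Alice - messages P ! 0) \<union> S \<union> cp ` (messages P ! 0)) (UA x)"
    and UB: "X \<noteq> {} \<Longrightarrow> y \<in> Y \<Longrightarrow> unitary_on
      (init_qubits P Bob \<union> messages P ! 0 \<union> cp ` (messages P ! 0)) (UB y)"
    and UB_col: "X \<noteq> {} \<Longrightarrow> y \<in> Y \<Longrightarrow>
      u \<subseteq> init_qubits P Bob \<union> messages P ! 0 \<union> cp ` (messages P ! 0) \<Longrightarrow>
      UB y u {} = (if u \<inter> init_qubits P Bob = encode_B P (y, Suc (length pre), pre)
                   then \<Psi> (u - init_qubits P Bob) else 0)"
begin

abbreviation "M' \<equiv> cp ` M"
abbreviation "RA \<equiv> (QA - M) \<union> S \<union> M'"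
abbreviation "RB \<equiv> QB \<union> M \<union> M'"

definition old_input :: "'y \<Rightarrow> 'y \<times> nat \<times> 'x list" where
  "old_input y = (y, Suc (length pre), pre)"

definition new_input :: "'x \<Rightarrow> 'y \<Rightarrow> nat set" where
  "new_input x y = encx x \<union> ency y"

text \<open>Basis states of \<open>S\<close> that encode no word get the identity, which keeps the
  controlled operation unitary.\<close>

definition ctrl :: "nat \<Rightarrow> nat set \<Rightarrow> qmatrix" where
  "ctrl k z = (if z \<in> seed ` words X n then ops_A P k (inv_into (words X n) seed z)
               else (\<lambda>u v. if u = v then 1 else 0))"

definition GA :: "nat \<Rightarrow> qstate \<Rightarrow> qstate" where
  "GA k \<psi> = (\<lambda>u. apply_on (held P k Alice) (ctrl k (u \<inter> S)) \<psi> u)"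

definition GB :: "'y \<Rightarrow> nat \<Rightarrow> qstate \<Rightarrow> qstate" where
  "GB y k = apply_on (held P k Bob) (ops_B P k (old_input y))"

text \<open>Step \<open>k\<close> replays step \<open>k + 1\<close> of \<open>P\<close>; the old
  step 0 is dropped. The rotation comes right before Alice's first replayed step, as the preparation
  does for Bob in \<open>TB\<close>.\<close>

definition TA :: "nat \<Rightarrow> 'x \<Rightarrow> qstate \<Rightarrow> qstate" where
  "TA k x = (if k = 1 then (\<lambda>\<psi>. GA (Suc k) (apply_on RA (UA x) \<psi>)) else GA (Suc k))"

definition TB :: "nat \<Rightarrow> 'y \<Rightarrow> qstate \<Rightarrow> qstate" where
  "TB k y = (if k = 0 then (\<lambda>\<psi>. GB y (Suc k) (apply_on RB (UB y) \<psi>)) else GB y (Suc k))"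

text \<open>The register \<open>M'\<close> changes hands once, with message 0; the old qubits follow
  \<open>P\<close> with a shift by one.\<close>

definition HA :: "nat \<Rightarrow> nat set" where
  "HA k = held P (Suc k) Alice \<union> S \<union> IA \<union> (if k = 0 then {} else M')"

definition HB :: "nat \<Rightarrow> nat set" where
  "HB k = held P (Suc k) Bob \<union> IB \<union> (if k = 0 then M' else {})"

text \<open>The initial distribution of the old qubits is the one after the first message of
  \<open>P\<close>, so \<open>M\<close> starts with Bob. The overhead \<open>M'\<close> is as large
  as that whole message, which explains \<open>c + l ! 0\<close>.\<close>

definition P' :: "('x, 'y, 'z) protocol" where
  "P' = \<lparr>starter = Bob,
     init_qubits = (\<lambda>p. case p of Alice \<Rightarrow> HA 0 | Bob \<Rightarrow> HB 0),
     input_qubits = (\<lambda>p. case p of Alice \<Rightarrow> IA | Bob \<Rightarrow> IB),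
     encode_A = encx, encode_B = ency,
     ops_A = (\<lambda>k x. mat_on (HA k) (TA k x)),
     ops_B = (\<lambda>k y. mat_on (HB k) (TB k y)),
     messages = map (\<lambda>k. if k = 0 then messages P ! 1 \<union> M' else messages P ! Suc k) [0..<t - 1],
     safe_overhead = M',
     answer_qubits = answer_qubits P, decode = decode P\<rparr>"

abbreviation "Q' \<equiv> all_qubits P'"

lemma P'_simps [simp]:
  "starter P' = Bob" "init_qubits P' Alice = HA 0" "init_qubits P' Bob = HB 0"
  "input_qubits P' Alice = IA" "input_qubits P' Bob = IB" "encode_A P' = encx" "encode_B P' = ency"
  "ops_A P' k x = mat_on (HA k) (TA k x)" "ops_B P' k y = mat_on (HB k) (TB k y)"
  "safe_overhead P' = M'" "answer_qubits P' = answer_qubits P" "decode P' = decode P"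
  "rounds P' = t - 1"
  by (simp_all add: P'_def rounds_def)

lemma messages_P': "k < t - 1 \<Longrightarrow>
    messages P' ! k = (if k = 0 then messages P ! 1 \<union> M' else messages P ! Suc k)"
  by (simp add: P'_def)

lemma turn_P': "turn P' k = turn P (Suc k)"
  by (simp add: turn_def)

lemma all_qubits_P': "Q' = Q \<union> M' \<union> S \<union> IA \<union> IB"
  using held_partition[of 1] t_pos by (auto simp: all_qubits_def[of P'] HA_def HB_def)

lemma all_input_qubits_P': "all_input_qubits P' = IA \<union> IB"
  by (simp add: all_input_qubits_def)

lemma finite_M': "finite M'"
  using finite_M by simp

lemma finite_Q': "finite Q'"
  using finite_Q finite_M' fin by (simp add: all_qubits_P')

lemma message_sub: "k < t \<Longrightarrow> messages P ! k \<subseteq> Q"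
  using message_held[of k] held_sub[of k "turn P k"] by simp

lemma held_P':
  assumes "k < t"
  shows "held P' k Alice = HA k \<and> held P' k Bob = HB k"
  using assms
proof (induction k)
  case (Suc k)
  then have IH: "held P' k Alice = HA k" "held P' k Bob = HB k" by auto
  have m: "messages P ! Suc k \<subseteq> Q" using Suc.prems by (intro message_sub)
  have h: "held P (Suc k) p \<subseteq> Q" for p using Suc.prems by (intro held_sub) simp
  have mk: "messages P' ! k = (if k = 0 then messages P ! 1 \<union> M' else messages P ! Suc k)"
    using Suc.prems by (intro messages_P') simp
  have hS: "held P (Suc (Suc k)) p = (if p = turn P (Suc k) then held P (Suc k) p - messages P ! Suc k
      else held P (Suc k) p \<union> messages P ! Suc k)" for p
    by simp
  have hS': "held P' (Suc k) p = (if p = turn P (Suc k) then held P' k p - messages P' ! k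
      else held P' k p \<union> messages P' ! k)" for p
    by (simp add: turn_P')
  show ?case
  proof (cases "even k")
    case True
    then have turn: "turn P (Suc k) = Bob" by (simp add: turn_P)
    have "HB k - messages P' ! k = HB (Suc k)"
    proof -
      have "held P (Suc k) Bob \<union> IB \<union> M' - (messages P ! Suc k \<union> M') = held P (Suc k) Bob - messages P ! Suc k \<union> IB"
        "held P (Suc k) Bob \<union> IB - messages P ! Suc k = held P (Suc k) Bob - messages P ! Suc k \<union> IB"
        using m h[of Bob] fresh_M' fresh_IB by blast+
      then show ?thesis unfolding HB_def hS turn mk by (cases "k = 0") simp_all
    qed
    moreover have "HA k \<union> messages P' ! k = HA (Suc k)"
      unfolding HA_def hS turn mk by auto
    ultimately show ?thesis by (simp add: hS' turn IH del: held.simps)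
  next
    case False
    then have turn: "turn P (Suc k) = Alice" and k: "k \<noteq> 0" by (auto simp: turn_P odd_pos)
    have "HA k - messages P' ! k = HA (Suc k)"
    proof -
      have "held P (Suc k) Alice \<union> S \<union> IA \<union> M' - messages P ! Suc k =
        held P (Suc k) Alice - messages P ! Suc k \<union> S \<union> IA \<union> M'"
        using m h[of Alice] fresh_M' fresh_S fresh_IA by blast
      then show ?thesis using k unfolding HA_def hS turn mk by simp
    qed
    moreover have "HB k \<union> messages P' ! k = HB (Suc k)"
      using k unfolding HB_def hS turn mk by auto
    ultimately show ?thesis by (simp add: hS' turn IH del: held.simps)
  qed
qed simp

lemma legal_old:
  assumes "x \<in> X" "y \<in> Y" "ws \<in> words X (n - Suc (length pre))"
  shows "(pre @ x # ws, old_input y) \<in> legal_inputs (game_A X Y f n)" "pre @ x # ws \<in> words X n"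
proof -
  show w: "pre @ x # ws \<in> words X n" using assms pre_sub pre_len by (auto simp: words_def)
  show "(pre @ x # ws, old_input y) \<in> legal_inputs (game_A X Y f n)"
    using legal_game[OF w assms(2), of "Suc (length pre)"] pre_len by (simp add: old_input_def)
qed

lemma ex_legal_old:
  assumes "x \<in> X" "y \<in> Y"
  obtains xs where "(xs, old_input y) \<in> legal_inputs (game_A X Y f n)"
proof -
  have "replicate (n - Suc (length pre)) x \<in> words X (n - Suc (length pre))"
    using assms by (auto simp: words_def)
  then show ?thesis using legal_old[OF assms] that by blast
qed

section \<open>Locality of the new steps and preservation of the inputs\<close>

lemma GA_local:
  assumes "y \<in> Y" "even k" "k \<le> t"
  shows "local_unitary (held P k Alice \<union> S) (GA k)"
proof -
  have fH: "finite (held P k Alice)" using held_sub[OF assms(3)] finite_Q finite_subset by blast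
  have "unitary_on (held P k Alice) (ctrl k z)" for z
  proof (cases "z \<in> seed ` words X n")
    case True
    then have "inv_into (words X n) seed z \<in> words X n" by (rule inv_into_into)
    \<comment> \<open>Unitarity of the old operations is known for legal inputs only; at position 1
      every word is part of one.\<close>
    then have "(inv_into (words X n) seed z, (y, 1, take (1 - 1) (inv_into (words X n) seed z)))
        \<in> legal_inputs (game_A X Y f n)"
      using assms n_pos by (intro legal_game) auto
    from step_unitary[OF this assms(3)] show ?thesis
      using True assms(2) by (simp add: ctrl_def turn_P step_op_def)
  next
    case False
    then show ?thesis using fH by (simp add: ctrl_def unitary_on_iff unitary_mat_id)
  qed
  moreover have "held P k Alice \<inter> S = {}" using held_sub[OF assms(3)] fresh_S by blast
  ultimately show ?thesis
    using fH fin unfolding GA_def by (intro local_unitary_controlled) auto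
qed

lemma GB_local:
  assumes "x \<in> X" "y \<in> Y" "odd k" "k \<le> t"
  shows "local_unitary (held P k Bob) (GB y k)"
proof -
  obtain xs where "(xs, old_input y) \<in> legal_inputs (game_A X Y f n)"
    using ex_legal_old[OF assms(1,2)] .
  from step_unitary[OF this assms(4)] show ?thesis
    using assms(3) unfolding GB_def by (intro local_unitary_apply_on) (simp add: turn_P step_op_def)
qed

lemma UA_local: "x \<in> X \<Longrightarrow> local_unitary RA (apply_on RA (UA x))"
  by (intro local_unitary_apply_on UA)

lemma UB_local: "x \<in> X \<Longrightarrow> y \<in> Y \<Longrightarrow> local_unitary RB (apply_on RB (UB y))"
  by (intro local_unitary_apply_on UB) auto

lemma TA_local:
  assumes "x \<in> X" "y \<in> Y" "odd k" "k < t"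
  shows "local_unitary (held P (Suc k) Alice \<union> S \<union> M') (TA k x)"
proof -
  let ?H = "held P (Suc k) Alice \<union> S \<union> M'"
  have f: "finite ?H"
    using held_sub[of "Suc k" Alice] assms finite_Q fin finite_M' finite_subset by auto
  have GA: "local_unitary ?H (GA (Suc k))"
    using assms by (intro local_unitary_mono[OF GA_local[OF assms(2)] _ f]) auto
  show ?thesis
  proof (cases "k = 1")
    case True
    then have "local_unitary ?H (apply_on RA (UA x))"
      by (intro local_unitary_mono[OF UA_local[OF assms(1)] _ f]) (auto simp: turn_P)
    then show ?thesis using local_unitary_comp[OF f GA] True by (simp add: TA_def)
  qed (simp add: TA_def GA del: held.simps)
qed

lemma TB_local:
  assumes "x \<in> X" "y \<in> Y" "even k" "k < t"
  shows "local_unitary (held P (Suc k) Bob \<union> (if k = 0 then M' else {})) (TB k y)"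
proof -
  let ?H = "held P (Suc k) Bob \<union> (if k = 0 then M' else {})"
  have f: "finite ?H"
    using held_sub[of "Suc k" Bob] assms finite_Q finite_M' finite_subset by auto
  have GB: "local_unitary ?H (GB y (Suc k))"
    using assms by (intro local_unitary_mono[OF GB_local[OF assms(1,2)] _ f]) auto
  show ?thesis
  proof (cases "k = 0")
    case True
    then have "local_unitary ?H (apply_on RB (UB y))"
      by (intro local_unitary_mono[OF UB_local[OF assms(1,2)] _ f]) (auto simp: turn_P)
    then show ?thesis using local_unitary_comp[OF f GB] True by (simp add: TB_def)
  qed (use GB in \<open>simp add: TB_def del: held.simps\<close>)
qed

definition T :: "nat \<Rightarrow> 'x \<Rightarrow> 'y \<Rightarrow> qstate \<Rightarrow> qstate" where
  "T k x y = (if even k then TB k y else TA k x)"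

text \<open>The set \<open>H\<close> avoids the input registers although the players hold them;
  security rests on this.\<close>

lemma T_local:
  assumes "x \<in> X" "y \<in> Y" "k < t"
  obtains H where "local_unitary H (T k x y)" "H \<subseteq> held P' k (turn P' k)" "H \<inter> (IA \<union> IB) = {}"
    "H \<subseteq> Q \<union> M' \<union> S"
proof (cases "even k")
  case True
  show ?thesis
  proof (rule that)
    show "local_unitary (held P (Suc k) Bob \<union> (if k = 0 then M' else {})) (T k x y)"
      using TB_local[OF assms(1,2) True assms(3)] True by (simp add: T_def)
  qed (use True assms held_P'[OF assms(3)] held_sub[of "Suc k" Bob] fresh_IA fresh_IB
       in \<open>auto simp: turn_P' turn_P HB_def\<close>)
next
  case False
  show ?thesis
  proof (rule that)
    show "local_unitary (held P (Suc k) Alice \<union> S \<union> M') (T k x y)"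
      using TA_local[OF assms(1,2) False assms(3)] False by (simp add: T_def)
  qed (use False assms held_P'[OF assms(3)] held_sub[of "Suc k" Alice] fresh_IA fresh_IB
       in \<open>auto simp: turn_P' turn_P HA_def split: if_splits\<close>)
qed

lemma step_P':
  assumes "x \<in> X" "y \<in> Y" "k < t"
  shows "unitary_on (held P' k (turn P' k)) (step_op P' k x y)"
    "apply_on (held P' k (turn P' k)) (step_op P' k x y) = T k x y"
proof -
  obtain H where H: "local_unitary H (T k x y)" "H \<subseteq> held P' k (turn P' k)"
    by (rule T_local[OF assms]) (rule that)
  have f: "finite (held P' k (turn P' k))"
    using held_P'[OF assms(3)] held_sub[of "Suc k" "turn P' k"] assms(3) finite_Q finite_M' fin
    by (cases "turn P' k") (simp_all add: HA_def HB_def finite_subset[of _ Q])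
  have L: "local_unitary (held P' k (turn P' k)) (T k x y)" by (rule local_unitary_mono[OF H f])
  have op: "step_op P' k x y = mat_on (held P' k (turn P' k)) (T k x y)"
    using held_P'[OF assms(3)] by (auto simp: step_op_def turn_P' turn_P T_def)
  show "unitary_on (held P' k (turn P' k)) (step_op P' k x y)"
    "apply_on (held P' k (turn P' k)) (step_op P' k x y) = T k x y"
    using mat_on[OF L] unfolding op by simp_all
qed

lemma state_P':
  assumes "x \<in> X" "y \<in> Y" "k < t"
  shows "state_after P' x y (Suc k) = T k x y (state_after P' x y k)"
  using step_P'(2)[OF assms] by simp

lemma state_P'_0: "state_after P' x y 0 = basis_state (new_input x y)"
  by (simp add: new_input_def)

lemma new_input_sub:
  assumes "x \<in> X" "y \<in> Y"
  shows "new_input x y \<subseteq> IA \<union> IB"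
  using encx(2)[OF assms(1)] ency(2)[OF assms(2)] by (auto simp: new_input_def)

text \<open>The steps act outside the input registers and hence commute with the projection onto the
  encoded input.\<close>

lemma state_P'_support:
  assumes "x \<in> X" "y \<in> Y" "k \<le> t"
  shows "state_after P' x y k u = (if u \<inter> (IA \<union> IB) = new_input x y then 1 else 0) * state_after P' x y k u"
  using assms(3)
proof (induction k arbitrary: u)
  case 0
  then show ?case using new_input_sub[OF assms(1,2)] unfolding state_P'_0 by (auto simp: basis_state_def)
next
  case (Suc k)
  define g where "g = (\<lambda>u. if u \<inter> (IA \<union> IB) = new_input x y then 1 else (0 :: complex))"
  have k: "k < t" using Suc.prems by simp
  obtain H where H: "local_unitary H (T k x y)" "H \<inter> (IA \<union> IB) = {}"
    by (rule T_local[OF assms(1,2) k]) (rule that)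
  have "g u = g v" if "u - H = v - H" for u v
  proof -
    have "u \<inter> (IA \<union> IB) = v \<inter> (IA \<union> IB)" using that H(2) by blast
    then show ?thesis by (simp add: g_def)
  qed
  note gT = local_unitary_pointwise_mult[where g = g, OF H(1) this]
  have "state_after P' x y k = (\<lambda>u. g u * state_after P' x y k u)"
    using Suc.IH k unfolding g_def by (intro ext) simp
  then have "T k x y (state_after P' x y k) = (\<lambda>u. g u * T k x y (state_after P' x y k) u)"
    using gT[of "state_after P' x y k"] by simp
  then show ?case unfolding state_P'[OF assms(1,2) k] g_def by (rule fun_cong)
qed

lemma state_P'_norm:
  assumes "x \<in> X" "y \<in> Y" "k \<le> t"
  shows "inner_on (Pow Q') (state_after P' x y k) (state_after P' x y k) = 1"
  using assms(3)
proof (induction k)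
  case 0
  have "new_input x y \<in> Pow Q'"
    using new_input_sub[OF assms(1,2)] by (auto simp: all_qubits_P')
  then have "(\<Sum>u\<in>Pow Q'. if u = new_input x y then 1 else 0) = (1 :: complex)"
    using finite_Q' by simp
  moreover have "inner_on (Pow Q') (basis_state (new_input x y)) (basis_state (new_input x y)) =
      (\<Sum>u\<in>Pow Q'. if u = new_input x y then 1 else 0)"
    unfolding inner_on_def basis_state_def by (intro sum.cong refl) simp
  ultimately show ?case unfolding state_P'_0 by simp
next
  case (Suc k)
  have k: "k < t" using Suc.prems by simp
  obtain H where H: "local_unitary H (T k x y)" "H \<subseteq> Q \<union> M' \<union> S"
    by (rule T_local[OF assms(1,2) k]) (rule that)
  have "H \<subseteq> Q'" using H(2) by (auto simp: all_qubits_P')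
  then show ?case
    unfolding state_P'[OF assms(1,2) k] using local_unitary_inner[OF H(1) _ finite_Q'] Suc by simp
qed

text \<open>The support leaves one entry that can be nonzero and the norm makes it 1. As the result
  does not depend on \<open>k\<close>, the inputs are unchanged throughout.\<close>

lemma input_density_P':
  assumes "x \<in> X" "y \<in> Y" "k \<le> t"
  shows "reduced_density Q' (IA \<union> IB) (state_after P' x y k) =
    (\<lambda>u v. if u = new_input x y \<and> v = new_input x y then 1 else 0)"
proof (intro ext)
  fix u v
  let ?\<psi> = "state_after P' x y k" and ?I = "IA \<union> IB" and ?J = "Q' - (IA \<union> IB)"
  have sub: "?I \<subseteq> Q'" by (auto simp: all_qubits_P')
  have z: "?\<psi> (w \<union> e) = 0" if "w \<subseteq> ?I" "e \<subseteq> ?J" "w \<noteq> new_input x y" for w e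
  proof -
    have "(w \<union> e) \<inter> ?I = w" using that by blast
    then show ?thesis using state_P'_support[OF assms, of "w \<union> e"] that(3) by simp
  qed
  have fI: "finite ?I" using fin by simp
  have "(\<Sum>e\<in>Pow ?J. \<Sum>w\<in>Pow ?I. cnj (?\<psi> (w \<union> e)) * ?\<psi> (w \<union> e)) = 1"
    using state_P'_norm[OF assms] unfolding inner_on_def sum_Pow_split[OF sub] .
  also have "(\<Sum>e\<in>Pow ?J. \<Sum>w\<in>Pow ?I. cnj (?\<psi> (w \<union> e)) * ?\<psi> (w \<union> e)) =
      (\<Sum>e\<in>Pow ?J. \<Sum>w\<in>Pow ?I. if w = new_input x y then ?\<psi> (w \<union> e) * cnj (?\<psi> (w \<union> e)) else 0)"
    by (intro sum.cong refl) (auto simp: z)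
  also have "\<dots> = (\<Sum>e\<in>Pow ?J. ?\<psi> (new_input x y \<union> e) * cnj (?\<psi> (new_input x y \<union> e)))"
    using new_input_sub[OF assms(1,2)] fI by simp
  finally show "reduced_density Q' ?I ?\<psi> u v =
      (if u = new_input x y \<and> v = new_input x y then 1 else 0)"
  proof (cases "u = new_input x y \<and> v = new_input x y")
    case False
    have "(\<Sum>e\<in>Pow ?J. ?\<psi> (u \<union> e) * cnj (?\<psi> (v \<union> e))) = 0" if "u \<subseteq> ?I" "v \<subseteq> ?I"
      using False z that by (intro sum.neutral) auto
    then show ?thesis using False by (auto simp: reduced_density_def)
  qed (use new_input_sub[OF assms(1,2)] in \<open>simp add: reduced_density_def\<close>)
qed

end

lemma Un_eq_Un_iff:
  assumes "A \<subseteq> Z" "A' \<subseteq> Z" "B \<inter> Z = {}" "B' \<inter> Z = {}"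
  shows "A \<union> B = A' \<union> B' \<longleftrightarrow> A = A' \<and> B = B'"
proof
  assume eq: "A \<union> B = A' \<union> B'"
  have "A = (A \<union> B) \<inter> Z" "A' = (A' \<union> B') \<inter> Z" "B = (A \<union> B) - Z" "B' = (A' \<union> B') - Z"
    using assms by blast+
  then show "A = A' \<and> B = B'" using eq by metis
qed simp

section \<open>The shortened protocol is safe\<close>

context reduced_protocol
begin

text \<open>Bob's old qubits are now mere work qubits, into which he writes the encoding of his old
  input. Alice's old qubits outside \<open>M\<close> and the register \<open>S\<close> are still
  0.\<close>

definition prepared :: "'x \<Rightarrow> 'y \<Rightarrow> qstate" where
  "prepared x y u = (if u - (M \<union> M') = encode_B P (old_input y) \<union> new_input x y
                     then \<Psi> (u \<inter> (M \<union> M')) else 0)"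

lemma encode_old_sub:
  assumes "x \<in> X" "y \<in> Y"
  shows "encode_B P (old_input y) \<subseteq> QB"
  using ex_legal_old[OF assms] encode_B_sub by blast

lemma QB_disjoint: "QB \<inter> (M \<union> M') = {}"
  using disjoint_init M_sub fresh_M' by (auto simp: all_qubits_def)

lemma new_input_disjoint:
  assumes "x \<in> X" "y \<in> Y"
  shows "new_input x y \<inter> (Q \<union> M' \<union> S) = {}"
  using new_input_sub[OF assms] fresh_IA fresh_IB by blast

lemma init_sub_Q: "QA \<subseteq> Q" "QB \<subseteq> Q"
  by (auto simp: all_qubits_def)

lemma UB_prepared:
  assumes "x \<in> X" "y \<in> Y"
  shows "apply_on RB (UB y) (basis_state (new_input x y)) = prepared x y"
proof
  fix u
  have X: "X \<noteq> {}" using assms by blast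
  have disj: "new_input x y \<inter> RB = {}"
    using new_input_disjoint[OF assms] init_sub_Q M_sub by blast
  have fRB: "finite RB" using finite_init finite_M finite_M' by simp
  have e: "encode_B P (old_input y) \<subseteq> QB" by (rule encode_old_sub[OF assms])
  have iff: "u - RB = new_input x y \<and> u \<inter> RB \<inter> QB = encode_B P (old_input y) \<longleftrightarrow>
      u - (M \<union> M') = encode_B P (old_input y) \<union> new_input x y"
  proof -
    have "u - (M \<union> M') = (u \<inter> RB \<inter> QB) \<union> (u - RB)" using QB_disjoint by blast
    moreover have "(u - RB) \<inter> QB = {}" "new_input x y \<inter> QB = {}" using disj by blast+
    ultimately show ?thesis using Un_eq_Un_iff[of "u \<inter> RB \<inter> QB" QB _ "u - RB"] e by auto
  qed
  have arg: "u \<inter> RB - QB = u \<inter> (M \<union> M')" using QB_disjoint by blast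
  have "apply_on RB (UB y) (basis_state ({} \<union> new_input x y)) u =
      (if u - RB = new_input x y then UB y (u \<inter> RB) {} else 0)"
    by (rule apply_on_basis_state[OF fRB _ disj]) simp
  also have "UB y (u \<inter> RB) {} = (if u \<inter> RB \<inter> QB = encode_B P (old_input y) then \<Psi> (u \<inter> RB - QB) else 0)"
    using UB_col[OF X assms(2), of "u \<inter> RB"] by (simp add: old_input_def)
  finally show "apply_on RB (UB y) (basis_state (new_input x y)) u = prepared x y u"
    unfolding prepared_def iff[symmetric] arg by simp
qed

text \<open>Bob's replay of the old step 1 does not touch \<open>M'\<close>, so the overhead is a
  partial trace of \<open>\<Psi>\<close>, in which neither input occurs.\<close>

lemma overhead_density_P':
  assumes "x \<in> X" "y \<in> Y"
  shows "reduced_density Q' M' (state_after P' x y 1) =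
    (\<lambda>a b. if a \<subseteq> M' \<and> b \<subseteq> M' then (\<Sum>m\<in>Pow M. \<Psi> (m \<union> a) * cnj (\<Psi> (m \<union> b))) else 0)"
proof -
  let ?v = "encode_B P (old_input y) \<union> new_input x y"
  have "state_after P' x y 1 = GB y 1 (prepared x y)"
    using state_P'[OF assms, of 0] t_pos UB_prepared[OF assms] state_P'_0[of x y]
    by (simp add: T_def TB_def del: state_after.simps)
  moreover have "reduced_density Q' M' (GB y 1 (prepared x y)) =
      reduced_density Q' M' (prepared x y)"
  proof (rule local_unitary_reduced_density[OF GB_local[OF assms] _ finite_Q'])
    have "held P 1 Bob \<subseteq> Q" using held_sub[OF t_pos] .
    then show "held P 1 Bob \<subseteq> Q'" "held P 1 Bob \<inter> M' = {}"
      using fresh_M' unfolding all_qubits_P' by blast+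
  qed (use t_pos in simp_all)
  ultimately have "reduced_density Q' M' (state_after P' x y 1) =
      reduced_density Q' M' (prepared x y)"
    by (simp only:)
  also have "\<dots> = (\<lambda>a b. if a \<subseteq> M' \<and> b \<subseteq> M' then (\<Sum>m\<in>Pow M. \<Psi> (m \<union> a) * cnj (\<Psi> (m \<union> b))) else 0)"
  proof (intro ext)
    fix a b
    have M: "M \<subseteq> Q' - M'" using M_sub init_sub_Q fresh_M' unfolding all_qubits_P' by blast
    have v: "?v \<subseteq> Q' - M' - M"
      using encode_old_sub[OF assms] new_input_sub[OF assms] new_input_disjoint[OF assms] QB_disjoint init_sub_Q M_sub
      by (auto simp: all_qubits_P')
    have val: "prepared x y (w \<union> (m \<union> e)) = (if e = ?v then \<Psi> (m \<union> w) else 0)"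
      if "w \<subseteq> M'" "m \<subseteq> M" "e \<subseteq> Q' - M' - M" for w m e
    proof -
      have "w \<union> (m \<union> e) - (M \<union> M') = e" "(w \<union> (m \<union> e)) \<inter> (M \<union> M') = m \<union> w" using that by blast+
      then show ?thesis unfolding prepared_def by (cases "e = ?v") simp_all
    qed
    have "(\<Sum>e\<in>Pow (Q' - M'). prepared x y (a \<union> e) * cnj (prepared x y (b \<union> e))) =
        (\<Sum>m\<in>Pow M. \<Psi> (m \<union> a) * cnj (\<Psi> (m \<union> b)))" if ab: "a \<subseteq> M'" "b \<subseteq> M'"
    proof -
      have "(\<Sum>e\<in>Pow (Q' - M'). prepared x y (a \<union> e) * cnj (prepared x y (b \<union> e))) =
        (\<Sum>e\<in>Pow (Q' - M' - M). if e = ?v then \<Sum>m\<in>Pow M. \<Psi> (m \<union> a) * cnj (\<Psi> (m \<union> b)) else 0)"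
        unfolding sum_Pow_split[OF M]
      proof (rule sum.cong[OF refl])
        fix e assume "e \<in> Pow (Q' - M' - M)"
        then show "(\<Sum>s\<in>Pow M. prepared x y (a \<union> (s \<union> e)) * cnj (prepared x y (b \<union> (s \<union> e)))) =
          (if e = ?v then \<Sum>m\<in>Pow M. \<Psi> (m \<union> a) * cnj (\<Psi> (m \<union> b)) else 0)"
          using ab by (simp add: val)
      qed
      also have "\<dots> = (\<Sum>m\<in>Pow M. \<Psi> (m \<union> a) * cnj (\<Psi> (m \<union> b)))"
        using v finite_Q' by simp
      finally show ?thesis .
    qed
    then show "reduced_density Q' M' (prepared x y) a b =
      (if a \<subseteq> M' \<and> b \<subseteq> M' then (\<Sum>m\<in>Pow M. \<Psi> (m \<union> a) * cnj (\<Psi> (m \<union> b))) else 0)"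
      by (auto simp: reduced_density_def)
  qed
  finally show ?thesis .
qed

lemma coinless_P': "coinless_protocol (comm_of_fun X Y f) P'"
  unfolding coinless_protocol_def
proof (intro conjI)
  have h: "held P (Suc 0) p \<subseteq> Q" for p using t_pos by (intro held_sub) simp
  have fh: "finite (held P (Suc 0) p)" for p using h finite_Q finite_subset by blast
  show "\<forall>p. finite (init_qubits P' p) \<and> input_qubits P' p \<subseteq> init_qubits P' p"
  proof
    fix p show "finite (init_qubits P' p) \<and> input_qubits P' p \<subseteq> init_qubits P' p"
      using fh[of p] fin finite_M' by (cases p) (auto simp: HA_def HB_def simp del: held.simps)
  qed
  show "init_qubits P' Alice \<inter> init_qubits P' Bob = {}"
    using held_partition[of "Suc 0"] t_pos h[of Alice] h[of Bob] fresh_M' fresh_S fresh_IA fresh_IB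
    by (auto simp: HA_def HB_def simp del: held.simps)
  show "inj_on (encode_A P') (fst ` legal_inputs (comm_of_fun X Y f))"
    "inj_on (encode_B P') (snd ` legal_inputs (comm_of_fun X Y f))"
    using encx(1) ency(1) by (auto simp: comm_of_fun_def inj_on_def)
  show "\<forall>(a, b)\<in>legal_inputs (comm_of_fun X Y f).
      encode_A P' a \<subseteq> input_qubits P' Alice \<and> encode_B P' b \<subseteq> input_qubits P' Bob"
    using encx(2) ency(2) by (auto simp: comm_of_fun_def)
  show "\<forall>(a, b)\<in>legal_inputs (comm_of_fun X Y f). \<forall>k\<le>rounds P'.
      unitary_on (held P' k (turn P' k)) (step_op P' k a b)"
    using step_P'(1) t_pos by (auto simp: comm_of_fun_def)
  show "\<forall>k<rounds P'. messages P' ! k \<subseteq> held P' k (turn P' k)"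
  proof (intro allI impI)
    fix k assume "k < rounds P'"
    then have k: "k < t - 1" "Suc k < t" by auto
    have "held P' k (turn P' k) = (if even k then HB k else HA k)"
      using held_P'[of k] k by (simp add: turn_P' turn_P)
    moreover have "messages P ! Suc k \<subseteq> held P (Suc k) (if even k then Bob else Alice)"
      using message_held[OF k(2)] by (cases "even k") (simp_all add: turn_P del: held.simps)
    ultimately show "messages P' ! k \<subseteq> held P' k (turn P' k)"
      unfolding messages_P'[OF k(1)] by (auto simp: HA_def HB_def simp del: held.simps)
  qed
  have "held P' (t - 1) (turn P' (t - 1)) = (if even (t - 1) then HB (t - 1) else HA (t - 1))"
    using held_P'[of "t - 1"] t_pos by (simp add: turn_P' turn_P)
  then show "answer_qubits P' \<subseteq> held P' (rounds P') (turn P' (rounds P'))"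
    using answer_held t_pos by (auto simp: turn_P HA_def HB_def simp del: held.simps)
qed

lemma safe_P': "safe_coinless_protocol (comm_of_fun X Y f) Bob (t - 1) (c + l ! 0) (tl l) P'"
proof -
  have "secure (comm_of_fun X Y f) P'"
    unfolding secure_def
  proof (intro conjI)
    have Qd: "Q \<inter> (IA \<union> IB) = {}" "M' \<inter> (IA \<union> IB) = {}" using fresh_IA fresh_IB by blast+
    show "\<forall>k<rounds P'. messages P' ! k \<inter> all_input_qubits P' = {}"
    proof (intro allI impI)
      fix k assume "k < rounds P'"
      then have k: "k < t - 1" "Suc k < t" by auto
      show "messages P' ! k \<inter> all_input_qubits P' = {}"
        using Qd message_sub[OF k(2)] unfolding messages_P'[OF k(1)] all_input_qubits_P' by auto
    qed
    show "\<forall>(a, b)\<in>legal_inputs (comm_of_fun X Y f). \<forall>k\<le>Suc (rounds P').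
       reduced_density Q' (all_input_qubits P') (state_after P' a b k) =
       reduced_density Q' (all_input_qubits P') (state_after P' a b 0)"
      using t_pos by (auto simp: comm_of_fun_def all_input_qubits_P' input_density_P' simp del: state_after.simps)
    show "answer_qubits P' \<inter> all_input_qubits P' = {}"
      using answer_held held_sub[of t "turn P t"] Qd unfolding all_input_qubits_P' by auto
  qed
  moreover have cM': "card M' = c + l ! 0"
    using cp_inj card_messages[of 0] t_pos by (simp add: card_image)
  have "card (messages P' ! k) = (if k = 0 then tl l ! 0 + (c + l ! 0) else tl l ! k)" if k: "k < t - 1" for k
  proof -
    have "Suc k < t" using k by simp
    then have m: "card (messages P ! Suc k) = l ! Suc k" "messages P ! Suc k \<subseteq> Q"
      by (simp_all add: card_messages message_sub)
    then have "card (messages P ! Suc k \<union> M') = l ! Suc k + (c + l ! 0)"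
      using fresh_M' finite_M' finite_Q cM' by (subst card_Un_disjoint) (auto intro: finite_subset)
    moreover have "tl l ! k = l ! Suc k" using length_l k by (intro nth_tl) simp
    ultimately show ?thesis using m unfolding messages_P'[OF k] by (cases "k = 0") simp_all
  qed
  moreover have "M' \<subseteq> messages P' ! 0" if "0 < t - 1" using messages_P'[OF that] by simp
  moreover have "\<exists>\<rho>. \<forall>(a, b)\<in>legal_inputs (comm_of_fun X Y f).
      reduced_density Q' M' (state_after P' a b 1) = \<rho>"
    using overhead_density_P' by (auto simp: comm_of_fun_def simp del: state_after.simps)
  ultimately show ?thesis
    using coinless_P' length_l cM' unfolding safe_coinless_protocol_def by simp
qed

section \<open>Replaying the old protocol\<close>

definition G :: "'y \<Rightarrow> nat \<Rightarrow> qstate \<Rightarrow> qstate" where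
  "G y k = (if even k then GA k else GB y k)"

text \<open>The old steps 1 to \<open>k\<close>, with Alice's steps controlled by the word in
  \<open>S\<close>; step 0 is replaced by preparation and rotation.\<close>

primrec run :: "'y \<Rightarrow> nat \<Rightarrow> qstate \<Rightarrow> qstate" where
  "run y 0 \<psi> = \<psi>"
| "run y (Suc k) \<psi> = G y (Suc k) (run y k \<psi>)"

lemma G_local:
  assumes "x \<in> X" "y \<in> Y" "k \<le> t"
  shows "local_unitary (Q \<union> S) (G y k)"
proof -
  have f: "finite (Q \<union> S)" using finite_Q fin by simp
  show ?thesis
  proof (cases "even k")
    case True
    have "local_unitary (Q \<union> S) (GA k)"
      using held_sub[OF assms(3)] by (intro local_unitary_mono[OF GA_local[OF assms(2) True assms(3)] _ f]) blast
    then show ?thesis using True by (simp add: G_def)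
  next
    case False
    have "local_unitary (Q \<union> S) (GB y k)"
      using held_sub[OF assms(3)] by (intro local_unitary_mono[OF GB_local[OF assms(1,2) False assms(3)] _ f]) blast
    then show ?thesis using False by (simp add: G_def)
  qed
qed

lemma run_inner:
  assumes "x \<in> X" "y \<in> Y" "k \<le> t"
  shows "inner_on (Pow Q') (run y k \<psi>) (run y k \<phi>) = inner_on (Pow Q') \<psi> \<phi>"
  using assms(3)
proof (induction k)
  case (Suc k)
  have sub: "Q \<union> S \<subseteq> Q'" by (auto simp: all_qubits_P')
  show ?case
    using Suc local_unitary_inner[OF G_local[OF assms(1,2) Suc.prems] sub finite_Q'] by simp
qed simp

text \<open>Alice rotates after Bob has replayed step 1, whereas the comparison with the old run
  needs the rotation first. The two act on disjoint qubits.\<close>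

lemma UA_GB_commute:
  assumes "x \<in> X" "y \<in> Y"
  shows "apply_on RA (UA x) (GB y 1 \<psi>) = GB y 1 (apply_on RA (UA x) \<psi>)"
proof -
  have "RA \<inter> held P 1 Bob = {}"
    using disjoint_init M_sub fresh_M' fresh_S init_sub_Q unfolding One_nat_def held_1 by blast
  moreover have "local_unitary (held P 1 Bob) (GB y 1)" using GB_local[OF assms, of 1] t_pos by simp
  ultimately show ?thesis by (intro local_unitary_commute[OF UA_local[OF assms(1)]])
qed

lemma state_P'_run:
  assumes "x \<in> X" "y \<in> Y" "1 \<le> k" "k < t"
  shows "state_after P' x y (Suc k) = run y (Suc k) (apply_on RA (UA x) (prepared x y))"
  using assms(3,4)
proof (induction k rule: dec_induct)
  case base
  have "state_after P' x y 1 = GB y 1 (prepared x y)"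
    using state_P'[OF assms(1,2), of 0] t_pos UB_prepared[OF assms(1,2)] state_P'_0[of x y]
    by (simp add: T_def TB_def del: state_after.simps)
  then have "state_after P' x y (Suc 1) = GA 2 (apply_on RA (UA x) (GB y 1 (prepared x y)))"
    using state_P'[OF assms(1,2), of 1] base by (simp add: T_def TA_def numeral_2_eq_2 del: state_after.simps)
  then show ?case
    unfolding UA_GB_commute[OF assms(1,2)] by (simp add: G_def numeral_2_eq_2 del: state_after.simps)
next
  case (step k)
  then have "state_after P' x y (Suc (Suc k)) = T (Suc k) x y (run y (Suc k) (apply_on RA (UA x) (prepared x y)))"
    using state_P'[OF assms(1,2), of "Suc k"] by (simp del: state_after.simps run.simps)
  then show ?case using step.hyps by (simp add: T_def TA_def TB_def G_def del: state_after.simps)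
qed

definition wrong :: "'x \<Rightarrow> 'y \<Rightarrow> nat set set" where
  "wrong x y = {u \<in> Pow Q'. decode P (u \<inter> answer_qubits P) \<noteq> f x y}"

text \<open>
  For \<open>t = 1\<close> Alice never acts; her rotation is inserted nevertheless, since it does not
  affect the measurement.
\<close>

lemma error_P':
  assumes "x \<in> X" "y \<in> Y"
  shows "coinless_error_prob (comm_of_fun X Y f) P' x y =
    (\<Sum>u\<in>wrong x y. (cmod (run y t (apply_on RA (UA x) (prepared x y)) u))\<^sup>2)"
proof -
  have err: "coinless_error_prob (comm_of_fun X Y f) P' x y = (\<Sum>u\<in>wrong x y. (cmod (state_after P' x y t u))\<^sup>2)"
    using t_pos by (simp add: coinless_error_prob_def final_state_def comm_of_fun_def wrong_def del: state_after.simps)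
  show ?thesis
  proof (cases "t = 1")
    case False
    then have t: "1 \<le> t - 1" "t - 1 < t" "Suc (t - 1) = t" using t_pos by auto
    show ?thesis
      unfolding err using state_P'_run[OF assms t(1,2)] unfolding t(3) by simp
  next
    case True
    define \<psi> where "\<psi> = GB y 1 (prepared x y)"
    define g where "g = (\<lambda>u. if decode P (u \<inter> answer_qubits P) \<noteq> f x y then 1 else (0 :: complex))"
    have st: "state_after P' x y 1 = \<psi>"
      using state_P'[OF assms, of 0] t_pos UB_prepared[OF assms] state_P'_0[of x y]
      by (simp add: T_def TB_def \<psi>_def del: state_after.simps)
    have st': "state_after P' x y t = \<psi>"
      using arg_cong[OF True, of "state_after P' x y"] unfolding st .
    have run_t: "run y t \<phi> = GB y 1 \<phi>" for \<phi>
      using arg_cong[OF True, of "\<lambda>k. run y k \<phi>"] by (simp add: G_def)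
    have "answer_qubits P \<subseteq> held P 1 Bob" using answer_held True by (simp add: turn_P)
    \<comment> \<open>With a single message it is Bob who measures, and Alice's rotation avoids all
      his qubits.\<close>
    then have ans: "RA \<inter> answer_qubits P = {}"
      using disjoint_init M_sub fresh_M' fresh_S init_sub_Q unfolding One_nat_def held_1 by blast
    have "g u = g v" if "u - RA = v - RA" for u v
    proof -
      have "u \<inter> answer_qubits P = v \<inter> answer_qubits P" using that ans by blast
      then show ?thesis by (simp add: g_def)
    qed
    note mult = local_unitary_pointwise_mult[where g = g, OF UA_local[OF assms(1)] this]
    have RA: "RA \<subseteq> Q'" using init_sub_Q by (auto simp: all_qubits_P')
    have sum: "complex_of_real (\<Sum>u\<in>wrong x y. (cmod (\<phi> u))\<^sup>2) = inner_on (Pow Q') (\<lambda>u. g u * \<phi> u) (\<lambda>u. g u * \<phi> u)" for \<phi>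
    proof -
      have "(\<Sum>u\<in>Pow Q'. (cmod (g u * \<phi> u))\<^sup>2) = (\<Sum>u\<in>wrong x y. (cmod (\<phi> u))\<^sup>2)"
        using finite_Q' by (intro sum.mono_neutral_cong_right) (auto simp: wrong_def g_def)
      then show ?thesis unfolding inner_on_self by simp
    qed
    have "complex_of_real (\<Sum>u\<in>wrong x y. (cmod (apply_on RA (UA x) \<psi> u))\<^sup>2) =
       complex_of_real (\<Sum>u\<in>wrong x y. (cmod (\<psi> u))\<^sup>2)"
      unfolding sum
      using local_unitary_inner[OF UA_local[OF assms(1)] RA finite_Q', of "\<lambda>u. g u * \<psi> u" "\<lambda>u. g u * \<psi> u"]
      by (simp only: mult)
    then show ?thesis
      unfolding err st' run_t of_real_eq_iff \<psi>_def UA_GB_commute[OF assms] by simp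
  qed
qed

end

section \<open>Error of the shortened protocol\<close>

text \<open>Injectivity of \<open>g\<close> leaves at most one term in each sum, so there are no
  cross terms: a superposition over distinct codes behaves like a mixture.\<close>

lemma cnj_sum_if_mult:
  fixes g :: "'a \<Rightarrow> 'b" and h h' :: "'a \<Rightarrow> complex"
  assumes A: "finite A" and g: "inj_on g A"
  shows "cnj (\<Sum>a\<in>A. if z = g a then h a else 0) * (\<Sum>a\<in>A. if z = g a then h' a else 0) =
    (\<Sum>a\<in>A. if z = g a then cnj (h a) * h' a else 0)"
proof (cases "z \<in> g ` A")
  case True
  then obtain a0 where a0: "a0 \<in> A" "z = g a0" by blast
  have "z = g a \<longleftrightarrow> a = a0" if "a \<in> A" for a using g a0 that by (auto simp: inj_on_def)
  then have "(\<Sum>a\<in>A. if z = g a then k a else 0) = (\<Sum>a\<in>A. if a = a0 then k a else 0)" for k :: "'a \<Rightarrow> complex"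
    by (intro sum.cong refl) auto
  then show ?thesis using A a0 by simp
next
  case False
  then have "(\<Sum>a\<in>A. if z = g a then k a else 0) = 0" for k :: "'a \<Rightarrow> complex"
    by (intro sum.neutral) auto
  then show ?thesis by simp
qed

definition uncopy :: "(nat \<Rightarrow> nat) \<Rightarrow> nat set \<Rightarrow> nat set \<Rightarrow> nat set" where
  "uncopy cp M u = {q \<in> M. cp q \<in> u}"

text \<open>
  The canonical purification \<open>\<Sum>\<^sub>k \<surd>p\<^sub>k |v\<^sub>k\<rangle> \<otimes> |conj v\<^sub>k\<rangle>\<close> on the registers \<open>M\<close> and \<open>cp ` M\<close>.
\<close>

definition canonical :: "(nat \<Rightarrow> nat) \<Rightarrow> nat set \<Rightarrow> qmatrix \<Rightarrow> (nat set \<Rightarrow> real) \<Rightarrow> qstate" where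
  "canonical cp M V p u = (\<Sum>k\<in>Pow M. complex_of_real (sqrt (p k)) * V (u \<inter> M) k * cnj (V (uncopy cp M u) k))"

lemma canonical_Un:
  assumes "inj_on cp M" "M \<inter> cp ` M = {}" "m \<subseteq> M" "m' \<subseteq> M"
  shows "canonical cp M V p (m \<union> cp ` m') = (\<Sum>k\<in>Pow M. complex_of_real (sqrt (p k)) * V m k * cnj (V m' k))"
proof -
  have "(m \<union> cp ` m') \<inter> M = m" using assms by blast
  moreover have "uncopy cp M (m \<union> cp ` m') = m'"
    using assms by (auto simp: uncopy_def dest: inj_onD)
  ultimately show ?thesis by (simp add: canonical_def)
qed

lemma sum_Pow_image:
  assumes "inj_on cp M"
  shows "(\<Sum>s\<in>Pow (cp ` M). g s) = (\<Sum>m\<in>Pow M. g (cp ` m))"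
proof -
  have "bij_betw ((`) cp) (Pow M) (Pow (cp ` M))"
    using assms by (intro bij_betw_Pow) (simp add: inj_on_imp_bij_betw)
  then show ?thesis by (rule sum.reindex_bij_betw[symmetric])
qed

text \<open>The conjugation in the second register turns each pair of eigenvectors into a squared
  modulus. So the inner product is real, as \<open>measurement_difference\<close> requires.\<close>

lemma canonical_inner:
  assumes cp: "inj_on cp M" "M \<inter> cp ` M = {}" and A: "spectral (Pow M) A V p" and B: "spectral (Pow M) B W q"
  shows "(\<Sum>m\<in>Pow M. \<Sum>s\<in>Pow (cp ` M). cnj (canonical cp M V p (m \<union> s)) * canonical cp M W q (m \<union> s)) =
    complex_of_real (overlap (Pow M) V p W q)"
proof -
  let ?I = "Pow M"
  have "(\<Sum>m\<in>?I. \<Sum>s\<in>Pow (cp ` M). cnj (canonical cp M V p (m \<union> s)) * canonical cp M W q (m \<union> s))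
     = (\<Sum>m\<in>?I. \<Sum>m'\<in>?I. \<Sum>j\<in>?I. \<Sum>k\<in>?I. complex_of_real (sqrt (p j * q k)) *
         (cnj (V m j) * W m k * (V m' j * cnj (W m' k))))"
    unfolding sum_Pow_image[OF cp(1)]
  proof (intro sum.cong refl)
    fix m m' assume m: "m \<in> ?I" "m' \<in> ?I"
    have "cnj (canonical cp M V p (m \<union> cp ` m')) * canonical cp M W q (m \<union> cp ` m') =
      (\<Sum>j\<in>?I. \<Sum>k\<in>?I. cnj (complex_of_real (sqrt (p j)) * V m j * cnj (V m' j)) * (complex_of_real (sqrt (q k)) * W m k * cnj (W m' k)))"
      using m by (simp add: canonical_Un[OF cp] cnj_sum sum_product del: complex_cnj_mult)
    also have "\<dots> = (\<Sum>j\<in>?I. \<Sum>k\<in>?I. complex_of_real (sqrt (p j * q k)) *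
         (cnj (V m j) * W m k * (V m' j * cnj (W m' k))))"
      by (intro sum.cong refl) (simp add: real_sqrt_mult mult_ac)
    finally show "cnj (canonical cp M V p (m \<union> cp ` m')) * canonical cp M W q (m \<union> cp ` m') = \<dots>" .
  qed
  also have "\<dots> = (\<Sum>m\<in>?I. \<Sum>j\<in>?I. \<Sum>k\<in>?I. \<Sum>m'\<in>?I. complex_of_real (sqrt (p j * q k)) *
         (cnj (V m j) * W m k * (V m' j * cnj (W m' k))))"
    by (rule sum.cong[OF refl], subst sum.swap, rule sum.cong[OF refl], rule sum.swap)
  also have "\<dots> = (\<Sum>j\<in>?I. \<Sum>k\<in>?I. \<Sum>m\<in>?I. \<Sum>m'\<in>?I. complex_of_real (sqrt (p j * q k)) *
         (cnj (V m j) * W m k * (V m' j * cnj (W m' k))))"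
    by (subst sum.swap, rule sum.cong[OF refl], rule sum.swap)
  also have "\<dots> = (\<Sum>j\<in>?I. \<Sum>k\<in>?I. complex_of_real (sqrt (p j * q k)) *
         (inner_on ?I (mcol V j) (mcol W k) * cnj (inner_on ?I (mcol V j) (mcol W k))))"
  proof (intro sum.cong refl)
    fix j k
    have "inner_on ?I (mcol V j) (mcol W k) * cnj (inner_on ?I (mcol V j) (mcol W k)) =
       (\<Sum>m\<in>?I. \<Sum>m'\<in>?I. cnj (V m j) * W m k * (V m' j * cnj (W m' k)))"
      unfolding inner_on_def mcol_def cnj_sum sum_product by simp
    then show "(\<Sum>m\<in>?I. \<Sum>m'\<in>?I. complex_of_real (sqrt (p j * q k)) *
         (cnj (V m j) * W m k * (V m' j * cnj (W m' k)))) = complex_of_real (sqrt (p j * q k)) *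
         (inner_on ?I (mcol V j) (mcol W k) * cnj (inner_on ?I (mcol V j) (mcol W k)))"
      by (simp only: sum_distrib_left)
  qed
  also have "\<dots> = complex_of_real (overlap (Pow M) V p W q)"
    unfolding overlap_def of_real_sum
    by (intro sum.cong refl) (simp add: complex_norm_square mult_ac flip: of_real_power)
  finally show ?thesis .
qed

text \<open>Tracing out the copy returns \<open>A\<close>. The Gram form is the one in which two
  purifications are compared.\<close>

lemma canonical_gram:
  assumes M: "finite M" and cp: "inj_on cp M" "M \<inter> cp ` M = {}" and A: "spectral (Pow M) A V p"
    and m: "m \<subseteq> M" "m' \<subseteq> M"
  shows "(\<Sum>s\<in>Pow (cp ` M). cnj (canonical cp M V p (m' \<union> s)) * canonical cp M V p (m \<union> s)) = A m m'"
proof -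
  let ?I = "Pow M"
  have V: "(\<Sum>s\<in>?I. cnj (V s u) * V s v) = (if u = v then 1 else 0)" if "u \<in> ?I" "v \<in> ?I" for u v
    using A that unfolding spectral_def unitary_mat_def by blast
  have "(\<Sum>s\<in>Pow (cp ` M). cnj (canonical cp M V p (m' \<union> s)) * canonical cp M V p (m \<union> s)) =
    (\<Sum>s\<in>?I. \<Sum>j\<in>?I. \<Sum>k\<in>?I. cnj (complex_of_real (sqrt (p j)) * V m' j) * (complex_of_real (sqrt (p k)) * V m k) * (cnj (V s k) * V s j))"
    unfolding sum_Pow_image[OF cp(1)]
  proof (intro sum.cong refl)
    fix s assume s: "s \<in> ?I"
    have "cnj (canonical cp M V p (m' \<union> cp ` s)) * canonical cp M V p (m \<union> cp ` s) =
      (\<Sum>j\<in>?I. \<Sum>k\<in>?I. cnj (complex_of_real (sqrt (p j)) * V m' j * cnj (V s j)) * (complex_of_real (sqrt (p k)) * V m k * cnj (V s k)))"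
      using m s by (simp add: canonical_Un[OF cp] cnj_sum sum_product del: complex_cnj_mult)
    also have "\<dots> = (\<Sum>j\<in>?I. \<Sum>k\<in>?I. cnj (complex_of_real (sqrt (p j)) * V m' j) * (complex_of_real (sqrt (p k)) * V m k) * (cnj (V s k) * V s j))"
      by (intro sum.cong refl) (simp add: mult_ac)
    finally show "cnj (canonical cp M V p (m' \<union> cp ` s)) * canonical cp M V p (m \<union> cp ` s) = \<dots>" .
  qed
  also have "\<dots> = (\<Sum>j\<in>?I. \<Sum>k\<in>?I. \<Sum>s\<in>?I. cnj (complex_of_real (sqrt (p j)) * V m' j) * (complex_of_real (sqrt (p k)) * V m k) * (cnj (V s k) * V s j))"
    by (subst sum.swap, rule sum.cong[OF refl], rule sum.swap)
  also have "\<dots> = (\<Sum>j\<in>?I. \<Sum>k\<in>?I. if k = j then cnj (complex_of_real (sqrt (p j)) * V m' j) * (complex_of_real (sqrt (p j)) * V m j) else 0)"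
    unfolding sum_distrib_left[symmetric] by (intro sum.cong refl) (simp add: V)
  also have "\<dots> = (\<Sum>j\<in>?I. cnj (complex_of_real (sqrt (p j)) * V m' j) * (complex_of_real (sqrt (p j)) * V m j))"
    using M by simp
  also have "\<dots> = (\<Sum>j\<in>?I. complex_of_real (p j) * V m j * cnj (V m' j))"
  proof (intro sum.cong refl)
    fix j assume "j \<in> ?I"
    then have "0 \<le> p j" using A by (simp add: spectral_def)
    then have sq: "complex_of_real (sqrt (p j)) * complex_of_real (sqrt (p j)) = complex_of_real (p j)"
      by (simp flip: of_real_mult)
    show "cnj (complex_of_real (sqrt (p j)) * V m' j) * (complex_of_real (sqrt (p j)) * V m j) = complex_of_real (p j) * V m j * cnj (V m' j)"
      unfolding sq[symmetric] by (simp add: mult_ac)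
  qed
  also have "\<dots> = A m m'" using A m by (simp add: spectral_def)
  finally show ?thesis .
qed

lemma overlap_self:
  assumes "finite I" "spectral I A V p"
  shows "overlap I V p V p = (\<Sum>k\<in>I. p k)"
proof -
  have "overlap I V p V p = (\<Sum>j\<in>I. \<Sum>k\<in>I. if k = j then p j else 0)"
    unfolding overlap_def using assms
    by (intro sum.cong refl) (auto simp: inner_on_mcol spectral_def)
  then show ?thesis using assms by simp
qed

section \<open>Existence of Alice's rotation and Bob's preparation\<close>

context weighted_game_protocol
begin

definition rotation_source :: "(nat \<Rightarrow> nat) \<Rightarrow> qmatrix \<Rightarrow> (nat set \<Rightarrow> real) \<Rightarrow> nat set \<Rightarrow> nat set \<Rightarrow> complex" where
  "rotation_source cp V p m r = (if r \<subseteq> cp ` M then canonical cp M V p (m \<union> r) else 0)"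

text \<open>The part of the old state outside \<open>M\<close> when \<open>M\<close> holds
  \<open>m\<close>: a superposition of the suffixes, each marked by its code in \<open>S\<close>,
  with the copy register reset to 0.\<close>

definition rotation_target ::
  "(nat \<Rightarrow> nat) \<Rightarrow> nat set \<Rightarrow> ('a list \<Rightarrow> nat set) \<Rightarrow> 'a list \<Rightarrow> nat set \<Rightarrow> nat set \<Rightarrow> complex" where
  "rotation_target cp S seed ws m r = (if r \<inter> cp ` M = {} then
     (\<Sum>vs\<in>words X (n - length ws). if r \<inter> S = seed (ws @ vs)
        then amp vs * msg_state (ws @ vs) (m \<union> (r \<inter> QA)) else 0) else 0)"

text \<open>Two purifications of one density matrix on \<open>M\<close> differ by a unitary on the
  other qubits: the vectors belonging to the basis states \<open>m\<close> have equal Gram matrices,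
  so \<open>same_gram_unitary\<close> applies.\<close>

lemma rotation_exists:
  assumes cp: "inj_on cp M" "Q \<inter> cp ` M = {}" and S: "finite S" "(Q \<union> cp ` M) \<inter> S = {}"
    and seed: "inj_on seed (words X n)" "\<And>xs. xs \<in> words X n \<Longrightarrow> seed xs \<subseteq> S"
    and ws: "set ws \<subseteq> X" "length ws \<le> n" and spec: "spectral (Pow M) (density ws) V p"
  shows "\<exists>U. unitary_on ((QA - M) \<union> S \<union> cp ` M) U \<and> (\<forall>m\<in>Pow M. \<forall>r\<in>Pow ((QA - M) \<union> S \<union> cp ` M).
    (\<Sum>s\<in>Pow ((QA - M) \<union> S \<union> cp ` M). U r s * rotation_source cp V p m s) = rotation_target cp S seed ws m r)"
  unfolding unitary_on_iff
proof (rule same_gram_unitary)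
  let ?R = "(QA - M) \<union> S \<union> cp ` M" and ?D = "words X (n - length ws)"
  show f: "finite (Pow ?R)" using finite_init S finite_M by simp
  show "finite (Pow M)" using finite_M by simp
  have QA: "QA \<subseteq> Q" by (auto simp: all_qubits_def)
  have app: "ws @ vs \<in> words X n" if "vs \<in> ?D" for vs using ws that by (auto simp: words_def)
  have inj: "inj_on (\<lambda>vs. seed (ws @ vs)) ?D"
    using seed(1) app by (auto simp: inj_on_def)
  fix m m' assume m: "m \<in> Pow M" "m' \<in> Pow M"
  have "inner_on (Pow ?R) (rotation_source cp V p m) (rotation_source cp V p m') =
      (\<Sum>s\<in>Pow (cp ` M). cnj (canonical cp M V p (m \<union> s)) * canonical cp M V p (m' \<union> s))"
    unfolding inner_on_def using f
    by (intro sum.mono_neutral_cong_right) (auto simp: rotation_source_def)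
  also have "\<dots> = density ws m' m"
  proof (rule canonical_gram[OF finite_M cp(1) _ spec])
    show "M \<inter> cp ` M = {}" using cp(2) M_sub QA by blast
  qed (use m in auto)
  also have "\<dots> = (\<Sum>q\<in>Pow (QA - M). \<Sum>vs\<in>?D. complex_of_real (wt \<mu> vs) *
      (cnj (msg_state (ws @ vs) (m \<union> q)) * msg_state (ws @ vs) (m' \<union> q)))"
    unfolding density_eq[OF ws(1)] sum_distrib_left by (subst sum.swap) (simp add: mult_ac)
  also have "\<dots> = (\<Sum>q\<in>Pow (QA - M). \<Sum>z\<in>Pow S.
      cnj (rotation_target cp S seed ws m (q \<union> z)) * rotation_target cp S seed ws m' (q \<union> z))"
  proof (rule sum.cong[OF refl])
    fix q assume q: "q \<in> Pow (QA - M)"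
    have tgt: "rotation_target cp S seed ws m (q \<union> z) = (\<Sum>vs\<in>?D. if z = seed (ws @ vs)
        then amp vs * msg_state (ws @ vs) (m \<union> q) else 0)" if "z \<subseteq> S" for z m
    proof -
      have *: "(q \<union> z) \<inter> cp ` M = {}" "(q \<union> z) \<inter> S = z" "(q \<union> z) \<inter> QA = q"
        using q that QA cp(2) S(2) by blast+
      show ?thesis unfolding rotation_target_def * by simp
    qed
    have sq: "amp vs * amp vs = complex_of_real (wt \<mu> vs)"
      if "vs \<in> ?D" for vs
      using wt_nonneg[of X \<mu> vs] \<mu>_nonneg that by (simp add: words_def flip: of_real_mult)
    have "(\<Sum>z\<in>Pow S. cnj (rotation_target cp S seed ws m (q \<union> z)) * rotation_target cp S seed ws m' (q \<union> z)) =
      (\<Sum>z\<in>Pow S. \<Sum>vs\<in>?D. if z = seed (ws @ vs) then complex_of_real (wt \<mu> vs) *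
        (cnj (msg_state (ws @ vs) (m \<union> q)) * msg_state (ws @ vs) (m' \<union> q)) else 0)"
    proof (rule sum.cong[OF refl])
      fix z assume z: "z \<in> Pow S"
      then have "cnj (rotation_target cp S seed ws m (q \<union> z)) * rotation_target cp S seed ws m' (q \<union> z) =
        (\<Sum>vs\<in>?D. if z = seed (ws @ vs) then cnj (amp vs * msg_state (ws @ vs) (m \<union> q)) *
          (amp vs * msg_state (ws @ vs) (m' \<union> q)) else 0)"
        by (simp only: tgt PowD cnj_sum_if_mult[OF finite_words[OF finite_X] inj])
      also have "\<dots> = (\<Sum>vs\<in>?D. if z = seed (ws @ vs) then complex_of_real (wt \<mu> vs) *
        (cnj (msg_state (ws @ vs) (m \<union> q)) * msg_state (ws @ vs) (m' \<union> q)) else 0)"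
        by (intro sum.cong refl) (simp add: sq[symmetric] mult_ac)
      finally show "cnj (rotation_target cp S seed ws m (q \<union> z)) * rotation_target cp S seed ws m' (q \<union> z) = \<dots>" .
    qed
    also have "\<dots> = (\<Sum>vs\<in>?D. \<Sum>z\<in>Pow S. if z = seed (ws @ vs) then complex_of_real (wt \<mu> vs) *
        (cnj (msg_state (ws @ vs) (m \<union> q)) * msg_state (ws @ vs) (m' \<union> q)) else 0)"
      by (rule sum.swap)
    also have "\<dots> = (\<Sum>vs\<in>?D. complex_of_real (wt \<mu> vs) *
        (cnj (msg_state (ws @ vs) (m \<union> q)) * msg_state (ws @ vs) (m' \<union> q)))"
      using S(1) seed(2)[OF app] by (intro sum.cong refl) simp
    finally show "(\<Sum>vs\<in>?D. complex_of_real (wt \<mu> vs) *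
        (cnj (msg_state (ws @ vs) (m \<union> q)) * msg_state (ws @ vs) (m' \<union> q))) =
      (\<Sum>z\<in>Pow S. cnj (rotation_target cp S seed ws m (q \<union> z)) * rotation_target cp S seed ws m' (q \<union> z))" ..
  qed
  also have "\<dots> = (\<Sum>r\<in>Pow ((QA - M) \<union> S). cnj (rotation_target cp S seed ws m r) * rotation_target cp S seed ws m' r)"
    using QA S(2) by (subst sum_Pow_Un) auto
  also have "\<dots> = inner_on (Pow ?R) (rotation_target cp S seed ws m) (rotation_target cp S seed ws m')"
    unfolding inner_on_def using f
    by (intro sum.mono_neutral_left) (auto simp: rotation_target_def)
  finally show "inner_on (Pow ?R) (rotation_source cp V p m) (rotation_source cp V p m') =
      inner_on (Pow ?R) (rotation_target cp S seed ws m) (rotation_target cp S seed ws m')" .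
qed

lemma canonical_norm:
  assumes cp: "inj_on cp M" "M \<inter> cp ` M = {}"
    and ws: "set ws \<subseteq> X" "length ws \<le> n" and spec: "spectral (Pow M) (density ws) V p"
  shows "(\<Sum>m\<in>Pow M. \<Sum>s\<in>Pow (cp ` M). cnj (canonical cp M V p (m \<union> s)) * canonical cp M V p (m \<union> s)) = 1"
proof -
  have "complex_of_real (overlap (Pow M) V p V p) = (\<Sum>m\<in>Pow M. density ws m m)"
    using finite_M by (simp add: overlap_self[OF _ spec] trace_spectral[OF spec])
  then show ?thesis
    unfolding canonical_inner[OF cp spec spec] using trace_density[OF ws] by simp
qed

text \<open>A unitary can send the all-zero state to any unit vector; this is
  \<open>same_gram_unitary\<close> for a family of one vector.\<close>

lemma preparation_exists:
  assumes cp: "inj_on cp M" "Q \<inter> cp ` M = {}" and e: "e \<subseteq> QB"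
    and ws: "set ws \<subseteq> X" "length ws \<le> n" and spec: "spectral (Pow M) (density ws) V p"
  shows "\<exists>U. unitary_on (QB \<union> M \<union> cp ` M) U \<and> (\<forall>u\<in>Pow (QB \<union> M \<union> cp ` M).
    U u {} = (if u \<inter> QB = e then canonical cp M V p (u - QB) else 0))"
proof -
  let ?R = "QB \<union> M \<union> cp ` M"
  define \<phi> where "\<phi> = (\<lambda>u. if u \<inter> QB = e then canonical cp M V p (u - QB) else 0)"
  define \<delta> where "\<delta> = (\<lambda>u :: nat set. if u = {} then 1 else 0 :: complex)"
  have f: "finite (Pow ?R)" using finite_init finite_M by simp
  have MM: "M \<inter> cp ` M = {}" using M_sub cp(2) by (auto simp: all_qubits_def)
  have dis: "QB \<inter> (M \<union> cp ` M) = {}" using M_sub disjoint_init cp(2) by (auto simp: all_qubits_def)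
  have "inner_on (Pow ?R) \<delta> \<delta> = (\<Sum>u\<in>Pow ?R. if u = {} then 1 else 0)"
    unfolding inner_on_def \<delta>_def by (intro sum.cong refl) simp
  then have 1: "inner_on (Pow ?R) \<delta> \<delta> = 1" using f by simp
  have val: "\<phi> (a \<union> b) = (if a = e then canonical cp M V p b else 0)"
    if "a \<subseteq> QB" "b \<subseteq> M \<union> cp ` M" for a b
  proof -
    have "(a \<union> b) \<inter> QB = a" "a \<union> b - QB = b" using that dis by blast+
    then show ?thesis unfolding \<phi>_def by (cases "a = e") simp_all
  qed
  have "inner_on (Pow ?R) \<phi> \<phi> = (\<Sum>a\<in>Pow QB. \<Sum>b\<in>Pow (M \<union> cp ` M). cnj (\<phi> (a \<union> b)) * \<phi> (a \<union> b))"
    unfolding inner_on_def Un_assoc by (rule sum_Pow_Un[OF dis])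
  also have "\<dots> = (\<Sum>a\<in>Pow QB. if a = e then
      \<Sum>b\<in>Pow (M \<union> cp ` M). cnj (canonical cp M V p b) * canonical cp M V p b else 0)"
    by (intro sum.cong refl) (auto simp: val)
  also have "\<dots> = (\<Sum>b\<in>Pow (M \<union> cp ` M). cnj (canonical cp M V p b) * canonical cp M V p b)"
    using e finite_init by simp
  also have "\<dots> = 1"
    unfolding sum_Pow_Un[OF MM] by (rule canonical_norm[OF cp(1) MM ws spec])
  finally obtain U where U: "unitary_mat (Pow ?R) U" "\<And>u. u \<in> Pow ?R \<Longrightarrow> (\<Sum>s\<in>Pow ?R. U u s * \<delta> s) = \<phi> u"
    using same_gram_unitary[OF f, of "{()}" "\<lambda>_. \<delta>" "\<lambda>_. \<phi>"] 1 by auto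
  have "U u {} = \<phi> u" if "u \<in> Pow ?R" for u
  proof -
    have "(\<Sum>s\<in>Pow ?R. U u s * \<delta> s) = (\<Sum>s\<in>Pow ?R. if s = {} then U u {} else 0)"
      by (intro sum.cong refl) (simp add: \<delta>_def)
    also have "\<dots> = U u {}" using f by simp
    finally show ?thesis using U(2)[OF that] by simp
  qed
  then show ?thesis using U(1) unfolding unitary_on_iff \<phi>_def by blast
qed

end

section \<open>Comparison with the ideal run\<close>

locale weighted_reduced_protocol =
  weighted_game_protocol X Y f n t c l P \<mu> +
  reduced_protocol X Y f n t c l P pre cp S IA IB seed encx ency UA UB "canonical cp (messages P ! 0) V0 p0"
  for X :: "'x set" and Y :: "'y set" and f :: "'x \<Rightarrow> 'y \<Rightarrow> 'z"
    and n t c :: nat and l :: "nat list"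
    and P :: "('x list, 'y \<times> nat \<times> 'x list, 'z) protocol" and \<mu> :: "'x \<Rightarrow> real"
    and pre cp S IA IB seed encx ency UA UB V0 p0 +
  fixes V1 :: "'x \<Rightarrow> qmatrix" and p1 :: "'x \<Rightarrow> nat set \<Rightarrow> real"
  assumes spec0: "spectral (Pow M) (density pre) V0 p0"
    and spec1: "x \<in> X \<Longrightarrow> spectral (Pow M) (density (pre @ [x])) (V1 x) (p1 x)"
    and UA_map: "x \<in> X \<Longrightarrow> m \<subseteq> M \<Longrightarrow> r \<subseteq> RA \<Longrightarrow>
      (\<Sum>s\<in>Pow RA. UA x r s * rotation_source cp (V1 x) (p1 x) m s) = rotation_target cp S seed (pre @ [x]) m r"
begin

abbreviation "D \<equiv> words X (n - Suc (length pre))"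

text \<open>The state after \<open>k\<close> operations of the old protocol when Alice's remaining
  letters are in superposition, with their codes in \<open>S\<close>. The condition on
  \<open>u - (Q \<union> S)\<close> also says that \<open>M'\<close> is 0.\<close>

definition ideal :: "'x \<Rightarrow> 'y \<Rightarrow> nat \<Rightarrow> qstate" where
  "ideal x y k u = (if u - (Q \<union> S) = new_input x y then
     (\<Sum>ws\<in>D. if u \<inter> S = seed (pre @ x # ws) then amp ws *
        state_after P (pre @ x # ws) (old_input y) k (u \<inter> Q) else 0) else 0)"

lemma Q_S: "Q \<inter> S = {}" and Q_M': "Q \<inter> M' = {}" and M'_S: "M' \<inter> S = {}"
  using fresh_S fresh_M' by blast+

lemma M_M': "M \<inter> M' = {}"
  using Q_M' M_sub init_sub_Q by blast

lemma seed_inj: "x \<in> X \<Longrightarrow> inj_on (\<lambda>ws. seed (pre @ x # ws)) D"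
proof (rule inj_onI)
  fix vs ws assume x: "x \<in> X" and "vs \<in> D" "ws \<in> D" and eq: "seed (pre @ x # vs) = seed (pre @ x # ws)"
  then have "pre @ x # vs \<in> words X n" "pre @ x # ws \<in> words X n"
    using pre_sub pre_len by (auto simp: words_def)
  then have "pre @ x # vs = pre @ x # ws" by (rule inj_onD[OF seed(1) eq])
  then show "vs = ws" by simp
qed

lemma finite_D: "finite D"
  using finite_X by simp

lemma pre_x: "x \<in> X \<Longrightarrow> set (pre @ [x]) \<subseteq> X \<and> length (pre @ [x]) \<le> n"
  using pre_sub pre_len by simp

text \<open>In each branch the control selects the old operation for the word stored in
  \<open>S\<close>, so the superposition evolves branch by branch.\<close>

lemma G_ideal:
  assumes xy: "x \<in> X" "y \<in> Y" and k: "k \<le> t"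
  shows "G y k (ideal x y k) = ideal x y (Suc k)"
proof
  fix u
  define H where "H = held P k (turn P k)"
  define W where "W = (if even k then ctrl k (u \<inter> S) else ops_B P k (old_input y))"
  have HQ: "H \<subseteq> Q" unfolding H_def by (rule held_sub[OF k])
  have GW: "G y k \<psi> u = apply_on H W \<psi> u" for \<psi>
    by (simp add: G_def GA_def GB_def W_def H_def turn_P)
  have parts: "s \<union> (u - H) - (Q \<union> S) = u - (Q \<union> S)" "(s \<union> (u - H)) \<inter> S = u \<inter> S"
    "(s \<union> (u - H)) \<inter> Q = s \<union> (u \<inter> Q - H)" if "s \<subseteq> H" for s
    using that HQ Q_S by blast+
  have uQ: "u \<inter> Q \<inter> H = u \<inter> H" using HQ by blast
  show "G y k (ideal x y k) u = ideal x y (Suc k) u"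
  proof (cases "u - (Q \<union> S) = new_input x y")
    case False
    then show ?thesis unfolding GW by (simp add: apply_on_def ideal_def parts)
  next
    case True
    let ?st = "\<lambda>ws k. state_after P (pre @ x # ws) (old_input y) k"
    have "G y k (ideal x y k) u = (\<Sum>s\<in>Pow H. \<Sum>ws\<in>D. if u \<inter> S = seed (pre @ x # ws) then
        amp ws * (W (u \<inter> H) s * ?st ws k (s \<union> (u \<inter> Q - H))) else 0)"
      unfolding GW apply_on_def
      by (intro sum.cong refl) (auto simp: ideal_def parts True sum_distrib_left intro!: sum.cong)
    also have "\<dots> = (\<Sum>ws\<in>D. \<Sum>s\<in>Pow H. if u \<inter> S = seed (pre @ x # ws) then
        amp ws * (W (u \<inter> H) s * ?st ws k (s \<union> (u \<inter> Q - H))) else 0)"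
      by (rule sum.swap)
    also have "\<dots> = (\<Sum>ws\<in>D. if u \<inter> S = seed (pre @ x # ws) then
        amp ws * ?st ws (Suc k) (u \<inter> Q) else 0)"
    proof (rule sum.cong[OF refl])
      fix ws assume "ws \<in> D"
      then have w: "pre @ x # ws \<in> words X n" by (rule legal_old(2)[OF xy])
      have "step_op P k (pre @ x # ws) (old_input y) = W" if "u \<inter> S = seed (pre @ x # ws)"
        using w seed(1) that by (simp add: W_def ctrl_def step_op_def turn_P inv_into_f_f)
      then show "(\<Sum>s\<in>Pow H. if u \<inter> S = seed (pre @ x # ws) then
        amp ws * (W (u \<inter> H) s * ?st ws k (s \<union> (u \<inter> Q - H))) else 0) =
        (if u \<inter> S = seed (pre @ x # ws) then amp ws * ?st ws (Suc k) (u \<inter> Q) else 0)"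
        by (simp add: apply_on_def uQ sum_distrib_left flip: H_def)
    qed
    also have "\<dots> = ideal x y (Suc k) u" using True by (simp add: ideal_def)
    finally show ?thesis .
  qed
qed

lemma run_ideal:
  assumes "x \<in> X" "y \<in> Y" "k \<le> t"
  shows "run y k (ideal x y 1) = ideal x y (Suc k)"
  using assms(3)
proof (induction k)
  case (Suc k)
  then show ?case using G_ideal[OF assms(1,2) Suc.prems] by simp
qed simp

text \<open>The branches are orthogonal because their codes differ, and the answer does not involve
  \<open>S\<close>; hence probabilities are averaged with the weights of the suffixes.\<close>

lemma ideal_error:
  assumes xy: "x \<in> X" "y \<in> Y"
  shows "(\<Sum>u\<in>wrong x y. (cmod (ideal x y (Suc t) u))\<^sup>2) =
    (\<Sum>ws\<in>D. wt \<mu> ws * coinless_error_prob (game_A X Y f n) P (pre @ x # ws) (old_input y))"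
proof -
  let ?inp = "new_input x y"
  let ?st = "\<lambda>ws. state_after P (pre @ x # ws) (old_input y) (Suc t)"
  define bad where "bad = (\<lambda>v. decode P (v \<inter> answer_qubits P) \<noteq> f x y)"
  have inp: "?inp \<inter> (Q \<union> M' \<union> S) = {}" "?inp \<subseteq> Q'"
    using new_input_disjoint[OF xy] new_input_sub[OF xy] by (auto simp: all_qubits_P')
  have ansQ: "answer_qubits P \<subseteq> Q" using answer_held held_sub[of t] by blast
  define F where "F = (\<lambda>u. if bad u then (cmod (ideal x y (Suc t) u))\<^sup>2 else 0)"
  have QS: "Q \<union> S \<subseteq> Q'" by (auto simp: all_qubits_P')
  have F0: "F (w \<union> e) = 0" if "w \<subseteq> Q \<union> S" "e \<subseteq> Q' - (Q \<union> S)" "e \<noteq> ?inp" for w e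
  proof -
    have "w \<union> e - (Q \<union> S) = e" using that by blast
    then show ?thesis using that(3) by (simp add: F_def ideal_def)
  qed
  have summand: "(cmod (\<Sum>ws\<in>D. if z = seed (pre @ x # ws) then amp ws * a ws else 0))\<^sup>2
    = (\<Sum>ws\<in>D. if z = seed (pre @ x # ws) then wt \<mu> ws * (cmod (a ws))\<^sup>2 else 0)" for z a
  proof -
    have "complex_of_real ((cmod (\<Sum>ws\<in>D. if z = seed (pre @ x # ws) then amp ws * a ws else 0))\<^sup>2)
      = (\<Sum>ws\<in>D. if z = seed (pre @ x # ws) then
          cnj (amp ws * a ws) * (amp ws * a ws) else 0)"
      unfolding cnj_sum_if_mult[OF finite_D seed_inj[OF xy(1)], symmetric] complex_norm_square by (rule mult.commute)
    also have "\<dots> = complex_of_real (\<Sum>ws\<in>D. if z = seed (pre @ x # ws) then wt \<mu> ws * (cmod (a ws))\<^sup>2 else 0)"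
      unfolding of_real_sum
    proof (rule sum.cong[OF refl])
      fix ws assume "ws \<in> D"
      then have "0 \<le> wt \<mu> ws" using wt_nonneg[of X \<mu> ws] \<mu>_nonneg by (simp add: words_def)
      then have norm: "(cmod (amp ws * a ws))\<^sup>2 = wt \<mu> ws * (cmod (a ws))\<^sup>2"
        by (simp add: norm_mult power_mult_distrib)
      have eq: "cnj (amp ws * a ws) * (amp ws * a ws) =
          complex_of_real (wt \<mu> ws * (cmod (a ws))\<^sup>2)"
        unfolding norm[symmetric] complex_norm_square by (rule mult.commute)
      show "(if z = seed (pre @ x # ws) then
          cnj (amp ws * a ws) * (amp ws * a ws) else 0) =
          complex_of_real (if z = seed (pre @ x # ws) then wt \<mu> ws * (cmod (a ws))\<^sup>2 else 0)"
        unfolding eq by simp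
    qed
    finally show ?thesis by (simp only: of_real_eq_iff)
  qed
  have Fval: "F (v \<union> z \<union> ?inp) = (\<Sum>ws\<in>D. if z = seed (pre @ x # ws) then
      wt \<mu> ws * (if bad v then (cmod (?st ws v))\<^sup>2 else 0) else 0)"
    if "v \<subseteq> Q" "z \<subseteq> S" for v z
  proof -
    have *: "v \<union> z \<union> ?inp - (Q \<union> S) = ?inp" "(v \<union> z \<union> ?inp) \<inter> S = z" "(v \<union> z \<union> ?inp) \<inter> Q = v"
      "(v \<union> z \<union> ?inp) \<inter> answer_qubits P = v \<inter> answer_qubits P"
      using that inp Q_S ansQ by blast+
    then have b: "bad (v \<union> z \<union> ?inp) = bad v" by (simp add: bad_def)
    show ?thesis
    proof (cases "bad v")
      case True
      then show ?thesis
        unfolding F_def b ideal_def * by (simp add: summand del: state_after.simps cong: if_cong)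
    next
      case False
      then show ?thesis unfolding F_def b by (simp cong: if_cong)
    qed
  qed
  have "(\<Sum>u\<in>wrong x y. (cmod (ideal x y (Suc t) u))\<^sup>2) = (\<Sum>u\<in>Pow Q'. F u)"
    unfolding F_def using finite_Q' by (intro sum.mono_neutral_cong_left) (auto simp: wrong_def bad_def)
  also have "\<dots> = (\<Sum>e\<in>Pow (Q' - (Q \<union> S)). if e = ?inp then \<Sum>w\<in>Pow (Q \<union> S). F (w \<union> ?inp) else 0)"
    unfolding sum_Pow_split[OF QS] by (intro sum.cong refl) (auto simp: F0)
  also have "\<dots> = (\<Sum>w\<in>Pow (Q \<union> S). F (w \<union> ?inp))"
  proof -
    have "?inp \<subseteq> Q' - (Q \<union> S)" using inp by blast
    then show ?thesis using finite_Q' by simp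
  qed
  also have "\<dots> = (\<Sum>v\<in>Pow Q. \<Sum>z\<in>Pow S. \<Sum>ws\<in>D. if z = seed (pre @ x # ws) then
      wt \<mu> ws * (if bad v then (cmod (?st ws v))\<^sup>2 else 0) else 0)"
    unfolding sum_Pow_Un[OF Q_S] by (intro sum.cong refl) (simp add: Fval del: state_after.simps)
  also have "\<dots> = (\<Sum>v\<in>Pow Q. \<Sum>ws\<in>D. wt \<mu> ws * (if bad v then (cmod (?st ws v))\<^sup>2 else 0))"
  proof (rule sum.cong[OF refl], subst sum.swap, rule sum.cong[OF refl])
    fix v ws assume "ws \<in> D"
    then have "seed (pre @ x # ws) \<subseteq> S" using legal_old(2)[OF xy] seed(2) by blast
    then show "(\<Sum>z\<in>Pow S. if z = seed (pre @ x # ws) then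
      wt \<mu> ws * (if bad v then (cmod (?st ws v))\<^sup>2 else 0) else 0) = wt \<mu> ws * (if bad v then (cmod (?st ws v))\<^sup>2 else 0)"
      using fin by (simp del: state_after.simps)
  qed
  also have "\<dots> = (\<Sum>ws\<in>D. wt \<mu> ws * (\<Sum>v\<in>Pow Q. if bad v then (cmod (?st ws v))\<^sup>2 else 0))"
    unfolding sum_distrib_left by (rule sum.swap)
  also have "\<dots> = (\<Sum>ws\<in>D. wt \<mu> ws * coinless_error_prob (game_A X Y f n) P (pre @ x # ws) (old_input y))"
  proof (intro sum.cong refl arg_cong2[where f = "(*)"])
    fix ws
    have "target (game_A X Y f n) (pre @ x # ws) (old_input y) = f x y"
      by (simp add: game_A_def old_input_def)
    then show "(\<Sum>v\<in>Pow Q. if bad v then (cmod (?st ws v))\<^sup>2 else 0) =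
        coinless_error_prob (game_A X Y f n) P (pre @ x # ws) (old_input y)"
      unfolding coinless_error_prob_def final_state_def rounds bad_def using finite_Q
      by (intro sum.mono_neutral_cong_right) auto
  qed
  finally show ?thesis .
qed

definition prepared_from :: "qstate \<Rightarrow> 'x \<Rightarrow> 'y \<Rightarrow> qstate" where
  "prepared_from \<psi> x y u = (if u - (M \<union> M') = encode_B P (old_input y) \<union> new_input x y
                     then \<psi> (u \<inter> (M \<union> M')) else 0)"

lemma prepared_from: "prepared x y = prepared_from (canonical cp M V0 p0) x y"
  by (intro ext) (simp add: prepared_def prepared_from_def)

text \<open>From the purification belonging to \<open>pre @ [x]\<close> the rotation is exact. All
  loss comes from Bob having prepared the one belonging to \<open>pre\<close>.\<close>

lemma rotate_prepared:
  assumes xy: "x \<in> X" "y \<in> Y"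
  shows "apply_on RA (UA x) (prepared_from (canonical cp M (V1 x) (p1 x)) x y) = ideal x y 1"
proof
  fix u
  let ?e = "encode_B P (old_input y)" and ?inp = "new_input x y"
  let ?v = "?e \<union> ?inp"
  have e: "?e \<subseteq> QB" by (rule encode_old_sub[OF xy])
  have inp: "?inp \<inter> (Q \<union> M' \<union> S) = {}" by (rule new_input_disjoint[OF xy])
  have QB: "QB \<inter> (QA \<union> M' \<union> S) = {}" using disjoint_init init_sub_Q Q_S Q_M' by blast
  have vRA: "?v \<inter> (RA \<union> M) = {}" using e inp QB M_sub init_sub_Q by blast
  have MRA: "M \<inter> RA = {}" using M_M' M_sub init_sub_Q Q_S by blast
  have lhs: "apply_on RA (UA x) (prepared_from (canonical cp M (V1 x) (p1 x)) x y) u =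
    (if u - RA - M = ?v then rotation_target cp S seed (pre @ [x]) (u \<inter> M) (u \<inter> RA) else 0)"
  proof -
    have "prepared_from (canonical cp M (V1 x) (p1 x)) x y (s \<union> (u - RA)) =
      (if u - RA - M = ?v then rotation_source cp (V1 x) (p1 x) (u \<inter> M) s else 0)" if s: "s \<subseteq> RA" for s
    proof -
      have d: "s \<union> (u - RA) - (M \<union> M') = (s - M') \<union> (u - RA - M)" using s MRA by blast
      have "(s - M') \<union> (u - RA - M) = {} \<union> ?v \<longleftrightarrow> s - M' = {} \<and> u - RA - M = ?v"
      proof (rule Un_eq_Un_iff[where Z = RA])
        show "s - M' \<subseteq> RA" using s by blast
        show "?v \<inter> RA = {}" using vRA by blast
      qed auto
      then have iff: "s \<union> (u - RA) - (M \<union> M') = ?v \<longleftrightarrow> s \<subseteq> M' \<and> u - RA - M = ?v"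
        unfolding d by auto
      have "(s \<union> (u - RA)) \<inter> (M \<union> M') = (u \<inter> M) \<union> s" if "s \<subseteq> M'" using that s MRA by blast
      then show ?thesis unfolding prepared_from_def iff rotation_source_def by auto
    qed
    then have "apply_on RA (UA x) (prepared_from (canonical cp M (V1 x) (p1 x)) x y) u =
      (\<Sum>s\<in>Pow RA. if u - RA - M = ?v then UA x (u \<inter> RA) s * rotation_source cp (V1 x) (p1 x) (u \<inter> M) s else 0)"
      unfolding apply_on_def by (intro sum.cong refl) simp
    then show ?thesis using UA_map[OF xy(1), of "u \<inter> M" "u \<inter> RA"] by simp
  qed
  have cond: "u - RA - M = ?v \<and> u \<inter> RA \<inter> M' = {} \<longleftrightarrow> u - (Q \<union> S) = ?inp \<and> u \<inter> Q - QA = ?e"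
  proof -
    have 1: "u - (Q \<union> S) = ?inp \<Longrightarrow> u \<inter> M' = {}" using inp Q_M' M'_S by blast
    have 2: "u - RA - M = (u \<inter> Q - QA) \<union> (u - (Q \<union> S))" if "u \<inter> M' = {}"
      using that M_sub init_sub_Q QB Q_S by (auto simp: all_qubits_def)
    have 3: "(u \<inter> Q - QA) \<union> (u - (Q \<union> S)) = ?v \<longleftrightarrow> u \<inter> Q - QA = ?e \<and> u - (Q \<union> S) = ?inp"
    proof (rule Un_eq_Un_iff[where Z = Q])
      show "?e \<subseteq> Q" using e init_sub_Q by blast
      show "?inp \<inter> Q = {}" using inp by blast
    qed auto
    have 4: "u \<inter> RA \<inter> M' = u \<inter> M'" by blast
    show ?thesis unfolding 4 using 1 2 3 by metis
  qed
  have st: "state_after P (pre @ x # ws) (old_input y) 1 (u \<inter> Q) =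
      (if u \<inter> Q - QA = ?e then msg_state (pre @ x # ws) (u \<inter> QA) else 0)" if "ws \<in> D" for ws
  proof -
    have "u \<inter> Q \<inter> QA = u \<inter> QA" using init_sub_Q by blast
    then show ?thesis using state_after_1[OF legal_old(1)[OF xy that], of "u \<inter> Q"] by (simp del: state_after.simps)
  qed
  have sets: "u \<inter> RA \<inter> S = u \<inter> S" "u \<inter> M \<union> u \<inter> RA \<inter> QA = u \<inter> QA"
    using Q_S Q_M' M_sub init_sub_Q by blast+
  show "apply_on RA (UA x) (prepared_from (canonical cp M (V1 x) (p1 x)) x y) u = ideal x y 1 u"
  proof (cases "u - RA - M = ?v \<and> u \<inter> RA \<inter> M' = {}")
    case True
    then have c: "u - (Q \<union> S) = ?inp" "u \<inter> Q - QA = ?e" using cond by blast+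
    have "rotation_target cp S seed (pre @ [x]) (u \<inter> M) (u \<inter> RA) =
      (\<Sum>ws\<in>D. if u \<inter> S = seed (pre @ x # ws)
        then amp ws * msg_state (pre @ x # ws) (u \<inter> QA) else 0)"
      unfolding rotation_target_def sets using True by (simp cong: if_cong)
    also have "\<dots> = ideal x y 1 u"
      unfolding ideal_def using c by (intro trans[OF sum.cong[OF refl] if_P[symmetric]]) (simp_all add: st del: One_nat_def state_after.simps)
    finally show ?thesis unfolding lhs using True by simp
  next
    case False
    then have "ideal x y 1 u = 0"
      unfolding cond ideal_def by (auto simp: st simp del: One_nat_def intro!: sum.neutral)
    then show ?thesis unfolding lhs rotation_target_def using False by auto
  qed
qed

lemma prepared_inner:
  assumes xy: "x \<in> X" "y \<in> Y"
  shows "inner_on (Pow Q') (prepared_from \<psi> x y) (prepared_from \<phi> x y) =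
    (\<Sum>m\<in>Pow M. \<Sum>s\<in>Pow M'. cnj (\<psi> (m \<union> s)) * \<phi> (m \<union> s))"
proof -
  let ?v = "encode_B P (old_input y) \<union> new_input x y" and ?MM = "M \<union> M'"
  have sub: "?MM \<subseteq> Q'" using M_sub init_sub_Q by (auto simp: all_qubits_P')
  have v: "?v \<subseteq> Q' - ?MM"
    using encode_old_sub[OF xy] new_input_sub[OF xy] new_input_disjoint[OF xy] QB_disjoint init_sub_Q M_sub
    unfolding all_qubits_P' by blast
  have val: "prepared_from \<theta> x y (w \<union> e) = (if e = ?v then \<theta> w else 0)"
    if "w \<subseteq> ?MM" "e \<subseteq> Q' - ?MM" for \<theta> w e
  proof -
    have gen: "w \<union> e - Z = e \<and> (w \<union> e) \<inter> Z = w" if "w \<subseteq> Z" "e \<subseteq> R - Z" for R Z :: "nat set"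
      using that by blast
    have "w \<union> e - ?MM = e" "(w \<union> e) \<inter> ?MM = w" using gen[OF that] by simp_all
    then show ?thesis unfolding prepared_from_def by (cases "e = ?v") simp_all
  qed
  have "inner_on (Pow Q') (prepared_from \<psi> x y) (prepared_from \<phi> x y) =
    (\<Sum>e\<in>Pow (Q' - ?MM). if e = ?v then \<Sum>w\<in>Pow ?MM. cnj (\<psi> w) * \<phi> w else 0)"
    unfolding inner_on_def sum_Pow_split[OF sub]
  proof (rule sum.cong[OF refl])
    fix e assume "e \<in> Pow (Q' - ?MM)"
    then show "(\<Sum>w\<in>Pow ?MM. cnj (prepared_from \<psi> x y (w \<union> e)) * prepared_from \<phi> x y (w \<union> e)) =
      (if e = ?v then \<Sum>w\<in>Pow ?MM. cnj (\<psi> w) * \<phi> w else 0)"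
      by (simp add: val)
  qed
  also have "\<dots> = (\<Sum>w\<in>Pow ?MM. cnj (\<psi> w) * \<phi> w)" using v finite_Q' by simp
  finally show ?thesis unfolding sum_Pow_Un[OF M_M'] .
qed

text \<open>Rotation and replay are the same unitary maps in both runs, so the final states have the
  inner product of the two canonical purifications.\<close>

lemma error_P'_le:
  assumes xy: "x \<in> X" "y \<in> Y"
  shows "coinless_error_prob (comm_of_fun X Y f) P' x y \<le>
    (\<Sum>ws\<in>D. wt \<mu> ws * coinless_error_prob (game_A X Y f n) P (pre @ x # ws) (old_input y)) +
    sqrt (1 - (overlap (Pow M) (V1 x) (p1 x) V0 p0)\<^sup>2)"
proof -
  let ?I = "Pow Q'" and ?rot = "apply_on RA (UA x)"
  let ?p0 = "prepared_from (canonical cp M V0 p0) x y"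
  let ?p1 = "prepared_from (canonical cp M (V1 x) (p1 x)) x y"
  have RA: "RA \<subseteq> Q'" using init_sub_Q by (auto simp: all_qubits_P')
  note rot = local_unitary_inner[OF UA_local[OF xy(1)] RA finite_Q']
  note run = run_inner[OF xy order.refl]
  have fI: "finite ?I" using finite_Q' by simp
  have "inner_on ?I (run y t (?rot ?p0)) (run y t (?rot ?p0)) = 1"
    unfolding run rot prepared_inner[OF xy]
    using pre_sub pre_len by (intro canonical_norm[OF cp_inj M_M' _ _ spec0]) auto
  moreover have "inner_on ?I (run y t (?rot ?p1)) (run y t (?rot ?p1)) = 1"
    unfolding run rot prepared_inner[OF xy]
    using pre_x[OF xy(1)] by (intro canonical_norm[OF cp_inj M_M' _ _ spec1[OF xy(1)]]) auto
  moreover have "inner_on ?I (run y t (?rot ?p1)) (run y t (?rot ?p0)) =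
      complex_of_real (overlap (Pow M) (V1 x) (p1 x) V0 p0)"
    unfolding run rot prepared_inner[OF xy]
    by (rule canonical_inner[OF cp_inj M_M' spec1[OF xy(1)] spec0])
  moreover have "wrong x y \<subseteq> ?I" by (auto simp: wrong_def)
  ultimately have "(\<Sum>u\<in>wrong x y. (cmod (run y t (?rot ?p0) u))\<^sup>2) \<le>
      (\<Sum>u\<in>wrong x y. (cmod (run y t (?rot ?p1) u))\<^sup>2) + sqrt (1 - (overlap (Pow M) (V1 x) (p1 x) V0 p0)\<^sup>2)"
    by (intro measurement_difference[OF fI])
  then show ?thesis
    unfolding error_P'[OF xy] prepared_from rotate_prepared[OF xy] run_ideal[OF xy order.refl] ideal_error[OF xy] .
qed

end

section \<open>Fresh registers and elementary bounds\<close>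

lemma fresh_encoding:
  fixes F :: "nat set"
  assumes "finite A" "finite F"
  shows "\<exists>h :: 'a \<Rightarrow> nat. inj_on h A \<and> F \<inter> h ` A = {}"
proof -
  define m where "m = Suc (Max (insert 0 F))"
  have "x < m" if "x \<in> F" for x using that assms by (simp add: m_def less_Suc_eq_le)
  moreover have "inj_on (to_nat_on A) A" using assms by (intro inj_on_to_nat_on countable_finite)
  ultimately show ?thesis by (intro exI[of _ "\<lambda>a. m + to_nat_on A a"]) (fastforce simp: inj_on_def)
qed

text \<open>A unary code: one fresh qubit for each element of \<open>A\<close>.\<close>

lemma fresh_register:
  fixes F :: "nat set"
  assumes "finite A" "finite F"
  shows "\<exists>R (e :: 'a \<Rightarrow> nat set). finite R \<and> F \<inter> R = {} \<and> inj_on e A \<and> (\<forall>a\<in>A. e a \<subseteq> R)"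
proof -
  obtain h :: "'a \<Rightarrow> nat" where "inj_on h A" "F \<inter> h ` A = {}" using fresh_encoding[OF assms] by (elim exE conjE) (rule that)
  then show ?thesis
    using assms by (intro exI[of _ "h ` A"] exI[of _ "\<lambda>a. {h a}"]) (auto simp: inj_on_def)
qed

text \<open>Jensen for the square root, by Cauchy-Schwarz applied to \<open>sqrt (c j)\<close> and
  \<open>sqrt (c j * a j)\<close>.\<close>

lemma sum_mult_sqrt_le:
  fixes c a :: "'j \<Rightarrow> real"
  assumes c: "\<And>j. j \<in> J \<Longrightarrow> 0 \<le> c j" "(\<Sum>j\<in>J. c j) = 1" and a: "\<And>j. j \<in> J \<Longrightarrow> 0 \<le> a j"
  shows "(\<Sum>j\<in>J. c j * sqrt (a j)) \<le> sqrt (\<Sum>j\<in>J. c j * a j)"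
proof (rule real_le_rsqrt)
  have "(\<Sum>j\<in>J. c j * sqrt (a j))\<^sup>2 = (\<Sum>j\<in>J. sqrt (c j) * sqrt (c j * a j))\<^sup>2"
    using c(1) a by (intro arg_cong[where f = "\<lambda>x. x\<^sup>2"] sum.cong refl) (simp add: real_sqrt_mult flip: mult.assoc)
  also have "\<dots> \<le> (\<Sum>j\<in>J. (sqrt (c j))\<^sup>2) * (\<Sum>j\<in>J. (sqrt (c j * a j))\<^sup>2)"
    by (rule Cauchy_Schwarz_ineq_sum)
  also have "\<dots> = (\<Sum>j\<in>J. c j * a j)"
    using c a by (simp cong: sum.cong)
  finally show "(\<Sum>j\<in>J. c j * sqrt (a j))\<^sup>2 \<le> (\<Sum>j\<in>J. c j * a j)" .
qed

lemma coinless_error_prob_range: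
  assumes F: "coinless_protocol F P" and legal: "(a, b) \<in> legal_inputs F"
  shows "0 \<le> coinless_error_prob F P a b \<and> coinless_error_prob F P a b \<le> 1"
proof -
  let ?Q = "all_qubits P"
  have init: "\<forall>p. finite (init_qubits P p) \<and> input_qubits P p \<subseteq> init_qubits P p"
    and msg: "\<And>k. k < rounds P \<Longrightarrow> messages P ! k \<subseteq> held P k (turn P k)"
    using F by (simp_all add: coinless_protocol_def)
  have op: "\<And>k. k \<le> rounds P \<Longrightarrow> unitary_on (held P k (turn P k)) (step_op P k a b)"
    and sub: "encode_A P a \<subseteq> input_qubits P Alice" "encode_B P b \<subseteq> input_qubits P Bob"
    using F legal unfolding coinless_protocol_def by fast+
  have fin: "finite ?Q" using init by (simp add: all_qubits_def)
  have enc: "encode_A P a \<union> encode_B P b \<subseteq> ?Q"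
    using sub init unfolding all_qubits_def by blast
  have held: "held P k p \<subseteq> ?Q" if "k \<le> rounds P" for k p
    using that
  proof (induction k arbitrary: p)
    case 0
    then show ?case by (cases p) (auto simp: all_qubits_def)
  next
    case (Suc k)
    then have h: "held P k q \<subseteq> ?Q" for q by simp
    moreover have "messages P ! k \<subseteq> ?Q" using msg[of k] Suc.prems h[of "turn P k"] by simp
    ultimately show ?case by (cases "p = turn P k") auto
  qed
  have norm: "inner_on (Pow ?Q) (state_after P a b k) (state_after P a b k) = 1" if "k \<le> Suc (rounds P)" for k
    using that
  proof (induction k)
    case 0
    have "inner_on (Pow ?Q) (state_after P a b 0) (state_after P a b 0) =
        (\<Sum>u\<in>Pow ?Q. if u = encode_A P a \<union> encode_B P b then 1 else 0)"
      unfolding inner_on_def by (intro sum.cong refl) (simp add: basis_state_def)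
    then show ?case using fin enc by simp
  next
    case (Suc k)
    then show ?case
      using local_unitary_inner[OF local_unitary_apply_on[OF op] held fin] by simp
  qed
  have "(\<Sum>u\<in>Pow ?Q. (cmod (final_state P a b u))\<^sup>2) = 1"
    using norm[OF order.refl] unfolding inner_on_self final_state_def by (simp only: of_real_eq_1_iff)
  moreover have "coinless_error_prob F P a b \<le> (\<Sum>u\<in>Pow ?Q. (cmod (final_state P a b u))\<^sup>2)"
    unfolding coinless_error_prob_def using fin by (intro sum_mono2) auto
  ultimately show ?thesis unfolding coinless_error_prob_def by (simp add: sum_nonneg)
qed

context game_protocol
begin

lemma fresh_registers:
  assumes Y: "finite Y"
  obtains cp S IA IB seed encx ency where
    "finite S" "finite IA" "finite IB" "inj_on cp M" "Q \<inter> cp ` M = {}" "(Q \<union> cp ` M) \<inter> S = {}"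
    "(Q \<union> cp ` M \<union> S) \<inter> IA = {}" "(Q \<union> cp ` M \<union> S \<union> IA) \<inter> IB = {}"
    "inj_on seed (words X n)" "\<And>xs. xs \<in> words X n \<Longrightarrow> seed xs \<subseteq> S"
    "inj_on encx X" "\<And>x. x \<in> X \<Longrightarrow> encx x \<subseteq> IA" "inj_on ency Y" "\<And>y. y \<in> Y \<Longrightarrow> ency y \<subseteq> IB"
proof -
  obtain cp where cp: "inj_on cp M" "Q \<inter> cp ` M = {}"
    using fresh_encoding[OF finite_M finite_Q] by (elim exE conjE) (rule that)
  have f1: "finite (Q \<union> cp ` M)" using finite_Q finite_M by simp
  obtain S and seed :: "'x list \<Rightarrow> nat set" where S: "finite S" "(Q \<union> cp ` M) \<inter> S = {}"
    "inj_on seed (words X n)" "\<forall>xs\<in>words X n. seed xs \<subseteq> S"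
    using fresh_register[OF finite_words[OF finite_X, of n] f1] by (elim exE conjE) (rule that)
  have f2: "finite (Q \<union> cp ` M \<union> S)" using f1 S by simp
  obtain IA and encx :: "'x \<Rightarrow> nat set" where IA: "finite IA" "(Q \<union> cp ` M \<union> S) \<inter> IA = {}"
    "inj_on encx X" "\<forall>x\<in>X. encx x \<subseteq> IA"
    using fresh_register[OF finite_X f2] by (elim exE conjE) (rule that)
  have f3: "finite (Q \<union> cp ` M \<union> S \<union> IA)" using f2 IA by simp
  obtain IB and ency :: "'y \<Rightarrow> nat set" where IB: "finite IB" "(Q \<union> cp ` M \<union> S \<union> IA) \<inter> IB = {}"
    "inj_on ency Y" "\<forall>y\<in>Y. ency y \<subseteq> IB"
    using fresh_register[OF Y f3] by (elim exE conjE) (rule that)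
  show ?thesis by (rule that[OF S(1) IA(1) IB(1) cp S(2) IA(2) IB(2) S(3) _ IA(3) _ IB(3)])
      (use S(4) IA(4) IB(4) in auto)
qed

text \<open>Without inputs there is no distribution to play against, but a protocol with the right
  message lengths is still demanded; the same construction with dummy data provides it.\<close>

lemma safe_protocol_exists_if_no_inputs:
  assumes Y: "finite Y" and empty: "X = {} \<or> Y = {}"
  shows "\<exists>P'. safe_coinless_protocol (comm_of_fun X Y f) Bob (t - 1) (c + l ! 0) (tl l) P'"
proof -
  obtain cp S IA IB seed encx ency where fresh:
    "finite S" "finite IA" "finite IB" "inj_on cp M" "Q \<inter> cp ` M = {}" "(Q \<union> cp ` M) \<inter> S = {}"
    "(Q \<union> cp ` M \<union> S) \<inter> IA = {}" "(Q \<union> cp ` M \<union> S \<union> IA) \<inter> IB = {}"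
    "inj_on seed (words X n)" "\<And>xs. xs \<in> words X n \<Longrightarrow> seed xs \<subseteq> S"
    "inj_on encx X" "\<And>x. x \<in> X \<Longrightarrow> encx x \<subseteq> IA" "inj_on ency Y" "\<And>y. y \<in> Y \<Longrightarrow> ency y \<subseteq> IB"
    by (rule fresh_registers[OF Y]) (rule that)
  \<comment> \<open>If only \<open>Y\<close> is empty, \<open>UA\<close> still has to be unitary,
    hence the identity; the conditions on \<open>UB\<close> hold vacuously, so 0 will do.\<close>
  interpret reduced_protocol X Y f n t c l P "[]" cp S IA IB seed encx ency
    "\<lambda>_ u v. if u = v then 1 else 0" "\<lambda>_ _ _. 0" "\<lambda>_. 0"
  proof unfold_locales
    show "unitary_on (QA - M \<union> S \<union> cp ` M) (\<lambda>u v. if u = v then 1 else 0)" for x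
      unfolding unitary_on_iff using finite_init finite_M fresh(1) by (intro unitary_mat_id) simp
  qed (use fresh n_pos empty in auto)
  show ?thesis using safe_P' by blast
qed

end

context weighted_game_protocol
begin

lemma reduced_protocol_exists:
  assumes Y: "finite Y" and pre: "set pre \<subseteq> X" "length pre < n"
    and spec: "\<And>ws. set ws \<subseteq> X \<Longrightarrow> length ws \<le> n \<Longrightarrow> spectral (Pow M) (density ws) (V ws) (p ws)"
  shows "\<exists>P'. safe_coinless_protocol (comm_of_fun X Y f) Bob (t - 1) (c + l ! 0) (tl l) P' \<and>
    (\<forall>x\<in>X. \<forall>y\<in>Y. coinless_error_prob (comm_of_fun X Y f) P' x y \<le>
      (\<Sum>ws\<in>words X (n - Suc (length pre)). wt \<mu> ws *
        coinless_error_prob (game_A X Y f n) P (pre @ x # ws) (y, Suc (length pre), pre)) +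
      sqrt (1 - (overlap (Pow M) (V (pre @ [x])) (p (pre @ [x])) (V pre) (p pre))\<^sup>2))"
proof -
  obtain cp S IA IB seed encx ency where fresh:
    "finite S" "finite IA" "finite IB" "inj_on cp M" "Q \<inter> cp ` M = {}" "(Q \<union> cp ` M) \<inter> S = {}"
    "(Q \<union> cp ` M \<union> S) \<inter> IA = {}" "(Q \<union> cp ` M \<union> S \<union> IA) \<inter> IB = {}"
    "inj_on seed (words X n)" "\<And>xs. xs \<in> words X n \<Longrightarrow> seed xs \<subseteq> S"
    "inj_on encx X" "\<And>x. x \<in> X \<Longrightarrow> encx x \<subseteq> IA" "inj_on ency Y" "\<And>y. y \<in> Y \<Longrightarrow> ency y \<subseteq> IB"
    by (rule fresh_registers[OF Y]) (rule that)
  let ?RA = "QA - M \<union> S \<union> cp ` M" and ?RB = "QB \<union> M \<union> cp ` M"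
  have pre_x: "set (pre @ [x]) \<subseteq> X" "length (pre @ [x]) \<le> n" if "x \<in> X" for x
    using pre that by auto
  have "\<exists>U. x \<in> X \<longrightarrow> unitary_on ?RA U \<and> (\<forall>m\<in>Pow M. \<forall>r\<in>Pow ?RA.
    (\<Sum>s\<in>Pow ?RA. U r s * rotation_source cp (V (pre @ [x])) (p (pre @ [x])) m s) =
      rotation_target cp S seed (pre @ [x]) m r)" for x
    using rotation_exists[OF fresh(4,5,1,6,9,10) pre_x spec[OF pre_x]] by blast
  from choice[OF allI, OF this] obtain UA where "\<forall>x. x \<in> X \<longrightarrow> unitary_on ?RA (UA x) \<and> (\<forall>m\<in>Pow M. \<forall>r\<in>Pow ?RA.
    (\<Sum>s\<in>Pow ?RA. UA x r s * rotation_source cp (V (pre @ [x])) (p (pre @ [x])) m s) =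
      rotation_target cp S seed (pre @ [x]) m r)" ..
  then have UA: "\<And>x. x \<in> X \<Longrightarrow> unitary_on ?RA (UA x)"
    "\<And>x m r. x \<in> X \<Longrightarrow> m \<subseteq> M \<Longrightarrow> r \<subseteq> ?RA \<Longrightarrow>
      (\<Sum>s\<in>Pow ?RA. UA x r s * rotation_source cp (V (pre @ [x])) (p (pre @ [x])) m s) =
      rotation_target cp S seed (pre @ [x]) m r"
    by simp_all
  have spec0: "spectral (Pow M) (density pre) (V pre) (p pre)" using spec pre by simp
  obtain x0 where x0: "x0 \<in> X" using \<mu>_sum by fastforce
  have "encode_B P (y, Suc (length pre), pre) \<subseteq> QB" if "y \<in> Y" for y
  proof -
    let ?xs = "pre @ replicate (n - length pre) x0"
    have xs: "?xs \<in> words X n" using pre x0 by (auto simp: words_def)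
    have "(?xs, (y, Suc (length pre), pre)) \<in> legal_inputs (game_A X Y f n)"
      using legal_game[OF xs that, of "Suc (length pre)"] pre by simp
    then show ?thesis by (rule encode_B_sub)
  qed
  note encB = this
  have "\<exists>U. y \<in> Y \<longrightarrow> unitary_on ?RB U \<and> (\<forall>u\<in>Pow ?RB. U u {} =
    (if u \<inter> QB = encode_B P (y, Suc (length pre), pre) then canonical cp M (V pre) (p pre) (u - QB) else 0))" for y
    using preparation_exists[OF fresh(4,5) encB pre(1) less_imp_le[OF pre(2)] spec0] by blast
  from choice[OF allI, OF this] obtain UB where "\<forall>y. y \<in> Y \<longrightarrow> unitary_on ?RB (UB y) \<and> (\<forall>u\<in>Pow ?RB. UB y u {} =
    (if u \<inter> QB = encode_B P (y, Suc (length pre), pre) then canonical cp M (V pre) (p pre) (u - QB) else 0))" ..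
  then have UB: "\<And>y. y \<in> Y \<Longrightarrow> unitary_on ?RB (UB y)"
    "\<And>y u. y \<in> Y \<Longrightarrow> u \<subseteq> ?RB \<Longrightarrow> UB y u {} =
    (if u \<inter> QB = encode_B P (y, Suc (length pre), pre) then canonical cp M (V pre) (p pre) (u - QB) else 0)"
    by simp_all
  interpret weighted_reduced_protocol X Y f n t c l P \<mu> pre cp S IA IB seed encx ency UA UB "V pre" "p pre"
    "\<lambda>x. V (pre @ [x])" "\<lambda>x. p (pre @ [x])"
    by unfold_locales (use fresh pre UA UB spec0 spec[OF pre_x] in auto)
  show ?thesis using safe_P' error_P'_le unfolding old_input_def by blast
qed

end

section \<open>Averaging over positions and prefixes\<close>

lemma exists_le_weighted_average:
  fixes d a :: "'k \<Rightarrow> real"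
  assumes "finite K" "\<And>k. k \<in> K \<Longrightarrow> 0 \<le> d k" "(\<Sum>k\<in>K. d k) = 1" "(\<Sum>k\<in>K. d k * a k) \<le> b"
  shows "\<exists>k\<in>K. a k \<le> b"
proof (rule ccontr)
  assume "\<not> ?thesis"
  then have gt: "b < a k" if "k \<in> K" for k using that by force
  obtain k where k: "k \<in> K" "d k \<noteq> 0" using assms(3) by (metis sum.neutral zero_neq_one)
  then have "0 < d k" using assms(2)[OF k(1)] by simp
  then have "d k * b < d k * a k" using gt[OF k(1)] by simp
  moreover have "\<forall>k\<in>K. d k * b \<le> d k * a k"
    using assms(2) gt by (simp add: mult_left_mono less_imp_le)
  ultimately have "(\<Sum>k\<in>K. d k * b) < (\<Sum>k\<in>K. d k * a k)"
    using assms(1) k(1) by (intro sum_strict_mono_ex1) auto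
  then show False using assms(3,4) by (simp flip: sum_distrib_right)
qed

text \<open>
  The index \<open>(i, pre, (x, y), ws)\<close> stands for the inputs \<open>pre @ x # ws\<close> and \<open>(y, i + 1, pre)\<close> of
  the game, drawn by choosing \<open>i\<close> uniformly, \<open>(x, y)\<close> according to \<open>w\<close> and the other entries
  independently according to the marginal \<open>\<mu>\<close> of \<open>w\<close>.
\<close>

definition draws :: "'x set \<Rightarrow> 'y set \<Rightarrow> nat \<Rightarrow> (nat \<times> 'x list \<times> ('x \<times> 'y) \<times> 'x list) set" where
  "draws X Y n = (SIGMA i:{..<n}. words X i \<times> (X \<times> Y) \<times> words X (n - Suc i))"

definition draw_prob :: "('x \<Rightarrow> real) \<Rightarrow> ('x \<times> 'y \<Rightarrow> real) \<Rightarrow> nat \<Rightarrow> nat \<times> 'x list \<times> ('x \<times> 'y) \<times> 'x list \<Rightarrow> real" where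
  "draw_prob \<mu> w n = (\<lambda>(i, pre, z, ws). wt \<mu> pre / real n * (w z * wt \<mu> ws))"

definition draw_A :: "nat \<times> 'x list \<times> ('x \<times> 'y) \<times> 'x list \<Rightarrow> 'x list" where
  "draw_A = (\<lambda>(i, pre, z, ws). pre @ fst z # ws)"

definition draw_B :: "nat \<times> 'x list \<times> ('x \<times> 'y) \<times> 'x list \<Rightarrow> 'y \<times> nat \<times> 'x list" where
  "draw_B = (\<lambda>(i, pre, z, ws). (snd z, Suc i, pre))"

lemma sum_draws:
  assumes "finite X" "finite Y"
  shows "(\<Sum>k\<in>draws X Y n. draw_prob \<mu> w n k * g (draw_A k) (draw_B k)) =
    (\<Sum>i<n. \<Sum>pre\<in>words X i. wt \<mu> pre / real n * (\<Sum>z\<in>X \<times> Y. w z *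
      (\<Sum>ws\<in>words X (n - Suc i). wt \<mu> ws * g (pre @ fst z # ws) (snd z, Suc i, pre))))"
proof -
  have "(\<Sum>k\<in>draws X Y n. draw_prob \<mu> w n k * g (draw_A k) (draw_B k)) =
    (\<Sum>i<n. \<Sum>(pre, z, ws)\<in>words X i \<times> (X \<times> Y) \<times> words X (n - Suc i).
      wt \<mu> pre / real n * (w z * wt \<mu> ws) * g (pre @ fst z # ws) (snd z, Suc i, pre))"
    unfolding draws_def using assms
    by (subst sum.Sigma) (auto simp: draw_prob_def draw_A_def draw_B_def case_prod_unfold intro!: sum.cong)
  also have "\<dots> = (\<Sum>i<n. \<Sum>pre\<in>words X i. \<Sum>z\<in>X \<times> Y. \<Sum>ws\<in>words X (n - Suc i).
      wt \<mu> pre / real n * (w z * wt \<mu> ws) * g (pre @ fst z # ws) (snd z, Suc i, pre))"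
    by (simp add: sum.cartesian_product case_prod_unfold)
  finally show ?thesis by (simp add: sum_distrib_left mult.assoc)
qed

lemma sum_draw_prob:
  assumes "finite X" "finite Y" "1 \<le> n" "(\<Sum>x\<in>X. \<mu> x) = 1" "(\<Sum>z\<in>X \<times> Y. w z) = 1"
  shows "(\<Sum>k\<in>draws X Y n. draw_prob \<mu> w n k) = 1"
  using sum_draws[OF assms(1,2), of \<mu> w n "\<lambda>_ _. 1"] assms(3-)
  by (simp add: sum_wt_words flip: sum_divide_distrib)

lemma draw_prob_nonneg:
  assumes "\<And>x. x \<in> X \<Longrightarrow> 0 \<le> \<mu> x" "\<And>z. z \<in> X \<times> Y \<Longrightarrow> 0 \<le> w z" "k \<in> draws X Y n"
  shows "0 \<le> draw_prob \<mu> w n k"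
proof -
  obtain i pre z ws where k: "k = (i, pre, z, ws)" by (cases k) auto
  have "0 \<le> wt \<mu> pre" "0 \<le> wt \<mu> ws" "0 \<le> w z"
    using assms(2,3) wt_nonneg[of X \<mu>, OF assms(1)] by (auto simp: k draws_def words_def)
  then show ?thesis by (simp add: k draw_prob_def)
qed

lemma draws_legal:
  assumes "k \<in> draws X Y n"
  shows "(draw_A k, draw_B k) \<in> legal_inputs (game_A X Y f n)"
proof -
  obtain i pre x y ws where k: "k = (i, pre, (x, y), ws)" by (cases k) auto
  have "take (Suc i - 1) (pre @ x # ws) = pre" "length (pre @ x # ws) = n" "set (pre @ x # ws) \<subseteq> X"
    "y \<in> Y" "Suc i \<in> {1..n}"
    using assms by (auto simp: k draws_def words_def)
  then show ?thesis unfolding k draw_A_def draw_B_def game_A_def by force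
qed

context game_protocol
begin

text \<open>
  The average over \<open>i\<close> and \<open>pre\<close> of the increase of the error is controlled by
  \<open>1 - B\<^sup>2 \<le> 2 (1 - B)\<close> for the overlaps \<open>B\<close>, concavity of the square root and the bound on the
  information.
\<close>

lemma round_reduction:
  assumes Y: "finite Y" and w0: "\<And>z. z \<in> X \<times> Y \<Longrightarrow> 0 \<le> w z" and w1: "(\<Sum>z\<in>X \<times> Y. w z) = 1"
    and \<mu>: "\<mu> = (\<lambda>x. \<Sum>y\<in>Y. w (x, y))"
  shows "\<exists>P'. safe_coinless_protocol (comm_of_fun X Y f) Bob (t - 1) (c + l ! 0) (tl l) P' \<and>
    (\<Sum>z\<in>X \<times> Y. w z * coinless_error_prob (comm_of_fun X Y f) P' (fst z) (snd z)) \<le>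
    (\<Sum>k\<in>draws X Y n. draw_prob \<mu> w n k * coinless_error_prob (game_A X Y f n) P (draw_A k) (draw_B k)) +
    sqrt (2 * real (l ! 0) * ln 2 / real n)"
proof -
  let ?err = "coinless_error_prob (game_A X Y f n) P" and ?F = "comm_of_fun X Y f"
  have marg: "(\<Sum>z\<in>X \<times> Y. w z * h (fst z)) = (\<Sum>x\<in>X. \<mu> x * h x)" for h
    by (simp add: \<mu> sum_distrib_right sum.cartesian_product case_prod_unfold)
  have "Y \<noteq> {}" using w1 by auto
  then interpret weighted_game_protocol X Y f n t c l P \<mu>
    using w0 w1 marg[of "\<lambda>_. 1"] by unfold_locales (auto simp: \<mu> intro: sum_nonneg)
  have fin: "finite (Pow M)" using finite_M by simp
  have "\<exists>Vp. spectral (Pow M) (density ws) (fst Vp) (snd Vp)" for ws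
    using spectral_gram[OF fin] unfolding density_def by simp
  from choice[OF allI, OF this] obtain Vp where Vp: "\<forall>ws. spectral (Pow M) (density ws) (fst (Vp ws)) (snd (Vp ws))" ..
  define V where "V = (\<lambda>ws. fst (Vp ws))"
  define p where "p = (\<lambda>ws. snd (Vp ws))"
  have spec: "spectral (Pow M) (density ws) (V ws) (p ws)" for ws using Vp by (simp add: V_def p_def)
  define B where "B = (\<lambda>pre x. overlap (Pow M) (V (pre @ [x])) (p (pre @ [x])) (V pre) (p pre))"
  define J where "J = (SIGMA i:{..<n}. words X i)"
  define d where "d = (\<lambda>j :: nat \<times> 'x list. wt \<mu> (snd j) / real n)"
  define avg where "avg = (\<lambda>j. \<Sum>z\<in>X \<times> Y. w z *
      (\<Sum>ws\<in>words X (n - Suc (fst j)). wt \<mu> ws * ?err (snd j @ fst z # ws) (snd z, Suc (fst j), snd j)))"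
  define inc where "inc = (\<lambda>j :: nat \<times> 'x list. \<Sum>x\<in>X. \<mu> x * sqrt (1 - (B (snd j) x)\<^sup>2))"
  have finJ: "finite J" unfolding J_def using finite_X by auto
  have sumJ: "(\<Sum>j\<in>J. d j * g (fst j) (snd j)) = (\<Sum>i<n. \<Sum>pre\<in>words X i. wt \<mu> pre / real n * g i pre)" for g
    unfolding J_def d_def using finite_X by (subst sum.Sigma) (auto simp: case_prod_unfold)
  have d0: "0 \<le> d j" if "j \<in> J" for j
    using that wt_nonneg[of X \<mu> "snd j", OF \<mu>_nonneg] by (auto simp: J_def d_def words_def)
  have d1: "(\<Sum>j\<in>J. d j) = 1"
    using sumJ[of "\<lambda>_ _. 1"] n_pos by (simp add: sum_wt_words[OF \<mu>_sum] flip: sum_divide_distrib)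
  have avg: "(\<Sum>j\<in>J. d j * avg j) = (\<Sum>k\<in>draws X Y n. draw_prob \<mu> w n k * ?err (draw_A k) (draw_B k))"
    unfolding sum_draws[OF finite_X Y] avg_def by (rule sumJ)
  have B: "0 \<le> B pre x" "B pre x \<le> 1" if "set pre \<subseteq> X" "length pre < n" "x \<in> X" for pre x
  proof -
    have p1: "(\<Sum>k\<in>Pow M. p ws k) = 1" if "set ws \<subseteq> X" "length ws \<le> n" for ws
      using trace_spectral[OF spec] trace_density[OF that] by (metis of_real_eq_1_iff)
    show "0 \<le> B pre x" unfolding B_def by (rule overlap_nonneg[OF spec spec])
    show "B pre x \<le> 1" unfolding B_def using that by (intro overlap_le_1[OF fin spec spec] p1) auto
  qed
  have incr: "(\<Sum>j\<in>J. d j * inc j) \<le> sqrt (2 * real (l ! 0) * ln 2 / real n)"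
  proof -
    \<comment> \<open>Jensen is applied once, to the joint distribution of position, prefix and
      letter.\<close>
    define e where "e = (\<lambda>(j, x). d j * \<mu> x)"
    define b where "b = (\<lambda>(j :: nat \<times> 'x list, x). 1 - (B (snd j) x)\<^sup>2)"
    have J: "set (snd j) \<subseteq> X \<and> length (snd j) < n" if "j \<in> J" for j
      using that by (auto simp: J_def words_def)
    have b0: "0 \<le> b jx" "b jx \<le> 2 * (1 - B (snd (fst jx)) (snd jx))" if "jx \<in> J \<times> X" for jx
    proof -
      have r: "0 \<le> B (snd (fst jx)) (snd jx)" "B (snd (fst jx)) (snd jx) \<le> 1"
        using B J that by auto
      then show "0 \<le> b jx" by (simp add: b_def case_prod_unfold abs_square_le_1)
      have "0 \<le> (1 - B (snd (fst jx)) (snd jx))\<^sup>2" by simp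
      then show "b jx \<le> 2 * (1 - B (snd (fst jx)) (snd jx))"
        by (simp add: b_def case_prod_unfold power2_eq_square algebra_simps)
    qed
    have e0: "0 \<le> e jx" if "jx \<in> J \<times> X" for jx using that d0 \<mu>_nonneg by (auto simp: e_def)
    have e1: "(\<Sum>jx\<in>J \<times> X. e jx) = 1"
      by (simp add: e_def d1 \<mu>_sum flip: sum.cartesian_product sum_distrib_left)
    have "(\<Sum>j\<in>J. d j * inc j) = (\<Sum>jx\<in>J \<times> X. e jx * sqrt (b jx))"
      by (simp add: inc_def e_def b_def sum_distrib_left sum.cartesian_product case_prod_unfold mult.assoc)
    also have "\<dots> \<le> sqrt (\<Sum>jx\<in>J \<times> X. e jx * b jx)"
      by (rule sum_mult_sqrt_le[OF e0 e1 b0(1)])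
    also have "(\<Sum>jx\<in>J \<times> X. e jx * b jx) \<le> (\<Sum>jx\<in>J \<times> X. e jx * (2 * (1 - B (snd (fst jx)) (snd jx))))"
      using b0(2) e0 by (intro sum_mono mult_left_mono) auto
    also have "\<dots> = (\<Sum>j\<in>J. d j * (\<Sum>x\<in>X. \<mu> x * (2 * (1 - B (snd j) x))))"
      by (simp only: e_def sum_distrib_left sum.cartesian_product case_prod_unfold mult.assoc fst_conv snd_conv)
    also have "\<dots> = (\<Sum>i<n. \<Sum>pre\<in>words X i. wt \<mu> pre * (\<Sum>x\<in>X. \<mu> x * (2 * (1 - B pre x)))) / real n"
      unfolding sumJ[of "\<lambda>_ pre. \<Sum>x\<in>X. \<mu> x * (2 * (1 - B pre x))"] by (simp add: sum_divide_distrib)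
    also have "\<dots> \<le> 2 * real (l ! 0) * ln 2 / real n"
      unfolding B_def by (intro divide_right_mono information_bound spec) simp
    finally show ?thesis by simp
  qed
  \<comment> \<open>One choice of position and prefix has to serve both terms, so their sum is
    averaged.\<close>
  have "(\<Sum>j\<in>J. d j * (avg j + inc j)) \<le>
    (\<Sum>k\<in>draws X Y n. draw_prob \<mu> w n k * ?err (draw_A k) (draw_B k)) + sqrt (2 * real (l ! 0) * ln 2 / real n)"
    using incr unfolding avg[symmetric] by (simp add: distrib_left sum.distrib)
  from exists_le_weighted_average[OF finJ d0 d1 this] obtain j where j: "j \<in> J"
    "avg j + inc j \<le> (\<Sum>k\<in>draws X Y n. draw_prob \<mu> w n k * ?err (draw_A k) (draw_B k)) +
      sqrt (2 * real (l ! 0) * ln 2 / real n)" by blast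
  obtain i pre where ij: "j = (i, pre)" by (cases j)
  then have pre: "set pre \<subseteq> X" "length pre < n" "i = length pre" using j(1) by (auto simp: J_def words_def)
  obtain P' where P': "safe_coinless_protocol ?F Bob (t - 1) (c + l ! 0) (tl l) P'"
    "\<forall>x\<in>X. \<forall>y\<in>Y. coinless_error_prob ?F P' x y \<le>
      (\<Sum>ws\<in>words X (n - Suc (length pre)). wt \<mu> ws * ?err (pre @ x # ws) (y, Suc (length pre), pre)) +
      sqrt (1 - (B pre x)\<^sup>2)"
    using reduced_protocol_exists[OF Y pre(1,2) spec] unfolding B_def by blast
  have "(\<Sum>z\<in>X \<times> Y. w z * coinless_error_prob ?F P' (fst z) (snd z)) \<le>
    (\<Sum>z\<in>X \<times> Y. w z * ((\<Sum>ws\<in>words X (n - Suc (length pre)). wt \<mu> ws *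
      ?err (pre @ fst z # ws) (snd z, Suc (length pre), pre)) + sqrt (1 - (B pre (fst z))\<^sup>2)))"
    using P'(2) w0 by (intro sum_mono mult_left_mono) auto
  also have "\<dots> = avg j + inc j"
    unfolding distrib_left sum.distrib marg[of "\<lambda>x. sqrt (1 - (B pre x)\<^sup>2)"]
    by (simp add: avg_def inc_def ij pre(3))
  finally show ?thesis using P'(1) j(2) by (intro exI[of _ P']) simp
qed

end

theorem lemma5:
  fixes X :: "'x set" and Y :: "'y set" and f :: "'x \<Rightarrow> 'y \<Rightarrow> 'z"
    and n t c :: nat and l :: "nat list" and \<delta> \<epsilon> :: real
    and \<P> :: "('x list, 'y \<times> nat \<times> 'x list, 'z) protocol pmf"
  assumes "finite X" and "finite Y"
    and "n \<ge> 1" and "t \<ge> 1" and "\<delta> > 0"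
    and "length l = t"
    and "safe_public_coin_protocol (game_A X Y f n) Alice t c l \<P>"
    and "worst_case_error (game_A X Y f n) \<P> < \<delta>"
    and "\<epsilon> = \<delta> + 1 / 2 * sqrt (8 * real (l ! 0) * ln 2 / real n)"
  shows "\<exists>\<P>' :: ('x, 'y, 'z) protocol pmf.
           safe_public_coin_protocol (comm_of_fun X Y f) Bob (t - 1) (c + l ! 0) (tl l) \<P>' \<and>
           worst_case_error (comm_of_fun X Y f) \<P>' < \<epsilon>"
proof -
  let ?G = "game_A X Y f n" and ?F = "comm_of_fun X Y f"
  let ?safe = "safe_coinless_protocol ?F Bob (t - 1) (c + l ! 0) (tl l)"
  \<comment> \<open>\<open>1 / 2 * sqrt (8 * a)\<close> is \<open>sqrt (2 * a)\<close>, the form in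
    which the averaging argument delivers the increase.\<close>
  define r where "r = sqrt (2 * real (l ! 0) * ln 2 / real n)"
  have "8 * real (l ! 0) * ln 2 / real n = 2\<^sup>2 * (2 * real (l ! 0) * ln 2 / real n)" by simp
  then have "sqrt (8 * real (l ! 0) * ln 2 / real n) = 2 * r"
    unfolding r_def by (simp only: real_sqrt_mult real_sqrt_abs)
  then have \<epsilon>: "\<epsilon> = \<delta> + r" using assms(9) by simp
  have r0: "0 \<le> r" by (simp add: r_def)
  have finP: "finite (set_pmf \<P>)" and safeP: "\<And>P. P \<in> set_pmf \<P> \<Longrightarrow> safe_coinless_protocol ?G Alice t c l P"
    using assms(7) by (auto simp: safe_public_coin_protocol_def)
  have game: "game_protocol X Y f n t c l P" if "P \<in> set_pmf \<P>" for P
    using that assms safeP by unfold_locales auto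
  define \<alpha> where "\<alpha> = worst_case_error ?G \<P>"
  have "legal_inputs ?G \<subseteq> {xs. set xs \<subseteq> X \<and> length xs = n} \<times> (Y \<times> {1..n} \<times> {xs. set xs \<subseteq> X \<and> length xs \<le> n})"
    by (auto simp: game_A_def dest: in_set_takeD)
  then have finG: "finite (legal_inputs ?G)"
    by (rule finite_subset)
      (use assms(1,2) finite_lists_length_eq[of X n] finite_lists_length_le[of X n] in auto)
  have \<alpha>: "0 \<le> \<alpha>" "\<And>a b. (a, b) \<in> legal_inputs ?G \<Longrightarrow> error_prob ?G \<P> a b \<le> \<alpha>"
    unfolding \<alpha>_def worst_case_error_def using finG by (auto intro!: Max_ge)
  \<comment> \<open>Minimax attains only values above \<open>\<alpha> + r\<close>; the midpoint of
    \<open>\<alpha>\<close> and \<open>\<delta>\<close> leaves room for this and for the strict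
    inequality.\<close>
  have "\<exists>\<P>'. finite (set_pmf \<P>') \<and> set_pmf \<P>' \<subseteq> {P. ?safe P} \<and>
      (\<forall>z\<in>X \<times> Y. measure_pmf.expectation \<P>' (\<lambda>P. coinless_error_prob ?F P (fst z) (snd z)) \<le> (\<alpha> + \<delta>) / 2 + r)"
  proof (cases "X \<times> Y = {}")
    case True
    obtain P where "P \<in> set_pmf \<P>" using set_pmf_not_empty[of \<P>] by blast
    then obtain P' where "?safe P'"
      using game_protocol.safe_protocol_exists_if_no_inputs[OF game assms(2)] True by blast
    then show ?thesis using True by (intro exI[of _ "return_pmf P'"]) auto
  next
    case False
    show ?thesis
    proof (rule minimax_pmf[where \<alpha> = "\<alpha> + r"])
      show "finite (X \<times> Y)" using assms(1,2) by simp
      show "0 \<le> \<alpha> + r" using \<alpha>(1) r0 by simp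
      show "\<alpha> + r < (\<alpha> + \<delta>) / 2 + r" using assms(8) by (simp add: \<alpha>_def)
      show "0 \<le> coinless_error_prob ?F P (fst z) (snd z) \<and> coinless_error_prob ?F P (fst z) (snd z) \<le> 1"
        if "P \<in> {P. ?safe P}" "z \<in> X \<times> Y" for P z
        using that by (intro coinless_error_prob_range) (auto simp: safe_coinless_protocol_def comm_of_fun_def)
      fix w :: "'x \<times> 'y \<Rightarrow> real"
      assume w: "\<And>z. z \<in> X \<times> Y \<Longrightarrow> 0 \<le> w z" "(\<Sum>z\<in>X \<times> Y. w z) = 1"
      define \<mu> where "\<mu> = (\<lambda>x. \<Sum>y\<in>Y. w (x, y))"
      have \<mu>: "0 \<le> \<mu> x" if "x \<in> X" for x unfolding \<mu>_def using that w(1) by (intro sum_nonneg) auto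
      have \<mu>1: "(\<Sum>x\<in>X. \<mu> x) = 1" using w(2) by (simp add: \<mu>_def sum.cartesian_product)
      let ?d = "draw_prob \<mu> w n"
      define avg where "avg = (\<lambda>P. \<Sum>k\<in>draws X Y n. ?d k * coinless_error_prob ?G P (draw_A k) (draw_B k))"
      have expect: "error_prob ?G \<P> a b = (\<Sum>P\<in>set_pmf \<P>. coinless_error_prob ?G P a b * pmf \<P> P)" for a b
        unfolding error_prob_def by (rule integral_measure_pmf_real[OF finP])
      \<comment> \<open>Exchanging the averages over coins and inputs yields a single coinless
        protocol whose average error is at most \<open>\<alpha>\<close>.\<close>
      have "(\<Sum>P\<in>set_pmf \<P>. pmf \<P> P * avg P) = (\<Sum>k\<in>draws X Y n. ?d k * error_prob ?G \<P> (draw_A k) (draw_B k))"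
        unfolding avg_def expect sum_distrib_left
        by (subst sum.swap) (simp add: mult_ac)
      also have "\<dots> \<le> (\<Sum>k\<in>draws X Y n. ?d k * \<alpha>)"
        by (intro sum_mono mult_left_mono \<alpha>(2) draws_legal draw_prob_nonneg[of X \<mu> Y w] \<mu> w(1))
      also have "\<dots> = \<alpha>"
        using sum_draw_prob[OF assms(1,2,3) \<mu>1 w(2)] by (simp flip: sum_distrib_right)
      finally obtain P where P: "P \<in> set_pmf \<P>" "avg P \<le> \<alpha>"
        using exists_le_weighted_average[OF finP, of "pmf \<P>" avg \<alpha>] sum_pmf_eq_1[OF finP] by auto
      obtain P' where "?safe P'"
        "(\<Sum>z\<in>X \<times> Y. w z * coinless_error_prob ?F P' (fst z) (snd z)) \<le> avg P + r"
        using game_protocol.round_reduction[OF game[OF P(1)] assms(2) w \<mu>_def] unfolding avg_def r_def by blast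
      then show "\<exists>P\<in>{P. ?safe P}. (\<Sum>z\<in>X \<times> Y. w z * coinless_error_prob ?F P (fst z) (snd z)) \<le> \<alpha> + r"
        using P(2) by force
    qed (use False in auto)
  qed
  then obtain \<P>' where \<P>': "finite (set_pmf \<P>')" "set_pmf \<P>' \<subseteq> {P. ?safe P}"
    "\<forall>z\<in>X \<times> Y. measure_pmf.expectation \<P>' (\<lambda>P. coinless_error_prob ?F P (fst z) (snd z)) \<le> (\<alpha> + \<delta>) / 2 + r"
    by blast
  have lt: "(\<alpha> + \<delta>) / 2 + r < \<epsilon>" using assms(8) by (simp add: \<alpha>_def \<epsilon>)
  have "error_prob ?F \<P>' x y < \<epsilon>" if "x \<in> X" "y \<in> Y" for x y
    using bspec[OF \<P>'(3), of "(x, y)"] that lt by (simp add: error_prob_def)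
  moreover have "0 < \<epsilon>" using assms(5) r0 by (simp add: \<epsilon>)
  ultimately have "worst_case_error ?F \<P>' < \<epsilon>"
    unfolding worst_case_error_def using assms(1,2) by (auto simp: comm_of_fun_def)
  then show ?thesis using \<P>'(1,2) unfolding safe_public_coin_protocol_def by blast
qed

end
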